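(* Let $\mathcal{SH}(\phi,\psi,\widetilde\psi)$ be a compactly supported shearlet frame for $L^2(\mathbb{R}^2)$ with generators $\phi,\psi,\widetilde\psi$ satisfying the standing assumptions in the context, with regularity parameters $\alpha, r$, and let $\delta\ge \frac{2}{2r-1}$. Then for every $\theta>1$ there exists a constant $S_\theta>0$, which does not depend on $N$ (but depends on $\theta,\alpha,r$), such that for all $J\in\mathbb{N}$ and all $N\le N_J=\mathcal{O}(2^{2J})$, $$c_{N,M}=\inf_{\substack{f\in\mathcal{R}_N\\ \|f\|=1}}\|P_{\mathcal{S}^{(\varepsilon)}_M}f\|\ \ge\ \frac1\theta ,$$ where $M=(M_1,M_2)\in\mathbb{N}\times\mathbb{N}$ with $$M_i=\left\lceil \frac{S_\theta\, A_N^{-1/(2r-1)}\,2^{J(1+\delta)}}{\varepsilon}\right\rceil ,\qquad i=1,2 .$$ Consequently the stable sampling rate satisfies $\Theta(N,\theta)=\mathcal{O}\big(N^{1+\delta}A_N^{-2/(2r-1)}\big)$.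
   Context: Fourier transform: $\widehat f(\xi)=\int_{\mathbb{R}^2}f(x)e^{-2\pi i\langle x,\xi\rangle}\,dx$. Norm and inner product are those of $L^2(\mathbb{R}^2)$. Shearlet system. For $j\in\mathbb{N}\cup\{0\}$, $k\in\mathbb{Z}$ let $A_{2^j}=\mathrm{diag}(2^j,2^{j/2})$, $\widetilde A_{2^j}=\mathrm{diag}(2^{j/2},2^j)$, $S_k=\begin{pmatrix}1&k\\0&1\end{pmatrix}$. For $c=(c_1,c_2)\in(\mathbb{R}^+)^2$ and $\widetilde c=(c_2,c_1)$, the (cone-adapted discrete) shearlet system generated by $\phi,\psi,\widetilde\psi\in L^2(\mathbb{R}^2)$ consists of $\phi_m=\phi(\cdot-c_1m)$, $m\in\mathbb{Z}^2$; $\psi_{j,k,m}=2^{3j/4}\psi(S_kA_{2^j}\cdot-cm)$; and $\widetilde\psi_{j,k,m}=2^{3j/4}\widetilde\psi(S_k^T\widetilde A_{2^j}\cdot-\widetilde cm)$, with $j\ge0$, $|k|\le2^{j/2}$, $m\in\mathbb{Z}^2$ (products $cm,\widetilde cm$ are entrywise). The parameter $c$ is fixed such that the system is a frame, and is omitted from the notation. Standing assumptions on generators. $\phi,\psi\in L^2(\mathbb{R}^2)$ are compactly supported, $\widetilde\psi(x_1,x_2)=\psi(x_2,x_1)$, and without loss of generality all three are supported in $[0,a]^2$ for a positive integer $a$. There are constants $C_1,C_2>0$ with $$|\widehat\phi(\xi_1,\xi_2)|\le \frac{C_1}{(1+|\xi_1|)^r(1+|\xi_2|)^r},\qquad |\widehat\psi(\xi_1,\xi_2)|\le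 \frac{C_2\min\{1,|\xi_1|^\alpha\}}{(1+|\xi_1|)^r(1+|\xi_2|)^r},$$ where the regularity parameters $\alpha>r>3$ are large enough that the shearlet system forms a frame for $L^2(\mathbb{R}^2)$. Reconstruction spaces. Let $\Omega=\{m\in\mathbb{Z}^2:\operatorname{supp}\phi_m\cap[0,a]^2\ne\emptyset\}$, $\Omega_{j,k}=\{m\in\mathbb{Z}^2:\operatorname{supp}\psi_{j,k,m}\cap[0,a]^2\neq\emptyset\}$, $\widetilde\Omega_{j,k}=\{m\in\mathbb{Z}^2:\operatorname{supp}\widetilde\psi_{j,k,m}\cap[0,a]^2\neq\emptyset\}$. For $J\in\mathbb{N}$ let $\Lambda_J=\{(j,k,m):0\le j\le J-1,|k|\le2^{j/2},m\in\Omega_{j,k}\}$ and $\widetilde\Lambda_J$ analogously with $\widetilde\Omega_{j,k}$. Let $\mathcal{R}_{N_J}$ be the span of the finite system $\{\phi_m:m\in\Omega\}\cup\{\psi_{j,k,m}:(j,k,m)\in\Lambda_J\}\cup\{\widetilde\psi_{j,k,m}:(j,k,m)\in\widetilde\Lambda_J\}$, where $N_J$ denotes the number of generating functions, asymptotically of order $2^{2J}$. The full system (over all $J$) is enumerated as $(\psi_\lambda)_{\lambda\in\mathbb{N}}$: first the $\phi_m$, then along increasing scales; within a scale the shearing parameter runs from $-2^{j/2}$ to $2^{j/2}$ and translations are ordered lexicographically for each fixed scale and shear. $\mathcal{R}_N$ is the span of the first $N$ elements, and $\mathcal{R}$ is the closed span of all elements. $A_N>0$ denotes the lower frame bound of the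 finite system $(\psi_\lambda)_{\lambda\le N}$ as a frame for its span $\mathcal{R}_N$. Sampling spaces. Choose $T_1,T_2>0$ large enough that $\mathcal{R}\subset L^2([-T_1,T_2]^2)$ and let $0<\varepsilon\le\frac1{T_1+T_2}<1$. For $\ell\in\mathbb{Z}^2$ let $s^{(\varepsilon)}_\ell(x)=\varepsilon e^{2\pi i\varepsilon\langle\ell,x\rangle}\chi_{[-T_1,T_2]^2}(x)$. For $M=(M_1,M_2)\in\mathbb{N}\times\mathbb{N}$, $\mathcal{S}^{(\varepsilon)}_M=\operatorname{span}\{s_\ell^{(\varepsilon)}:-M_i\le\ell_i\le M_i,\ i=1,2\}$ and $P_{\mathcal{S}^{(\varepsilon)}_M}f=\sum_{-M_i\le\ell_i\le M_i}\langle f,s^{(\varepsilon)}_\ell\rangle s^{(\varepsilon)}_\ell$. Stable sampling rate. $\Theta(N,\theta)$ is the least number of measurements needed for $c_{N,M}>1/\theta$; for $M=(M_1,M_2)$ the number of measurements is counted, up to constants, as $M_1\cdot M_2$, i.e. $\Theta(N,\theta)=\min\{M_1M_2: c_{N,M}>1/\theta\}$. The $\mathcal{O}$ is as $N\to\infty$ with $\theta$ (and $\varepsilon$, $\delta$, generators) fixed. *)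

theory Defs
  imports "HOL-Analysis.Analysis" "HOL-Library.Landau_Symbols"
begin

section \<open>The Hilbert space of square-integrable functions on the plane\<close>

text \<open>
  The plane is the type \<open>real \<times> real\<close> with Lebesgue measure \<open>lborel\<close>. Elements of
  \<open>L\<^sup>2\<close> are given by Borel representatives; all notions below (including the support) are
  invariant under changes on null sets.
\<close>

definition L2 :: "(real \<times> real \<Rightarrow> complex) set" where
  "L2 = {f. f \<in> borel_measurable lborel \<and> integrable lborel (\<lambda>x. (cmod (f x))\<^sup>2)}"

definition L2_inner :: "(real \<times> real \<Rightarrow> complex) \<Rightarrow> (real \<times> real \<Rightarrow> complex) \<Rightarrow> complex" where
  "L2_inner f g = (LINT x|lborel. f x * cnj (g x))"

definition L2_norm :: "(real \<times> real \<Rightarrow> complex) \<Rightarrow> real" where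
  "L2_norm f = sqrt (LINT x|lborel. (cmod (f x))\<^sup>2)"

definition L2_on :: "(real \<times> real) set \<Rightarrow> (real \<times> real \<Rightarrow> complex) set" where
  "L2_on Q = {f \<in> L2. AE x in lborel. x \<notin> Q \<longrightarrow> f x = 0}"

text \<open>The support of an \<open>L\<^sup>2\<close> class: the complement of the largest open set on which it
  vanishes almost everywhere.\<close>

definition ess_supp :: "(real \<times> real \<Rightarrow> complex) \<Rightarrow> (real \<times> real) set" where
  "ess_supp f = - \<Union>{U. open U \<and> (AE x in lborel. x \<in> U \<longrightarrow> f x = 0)}"

definition fourier :: "(real \<times> real \<Rightarrow> complex) \<Rightarrow> real \<times> real \<Rightarrow> complex" where
  "fourier f \<xi> = (LINT x|lborel. f x * exp (- 2 * pi * \<i> * complex_of_real (x \<bullet> \<xi>)))"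

text \<open>Complex linear span of the family \<open>(v i)\<close>, \<open>i \<in> I\<close>, and its \<open>L\<^sup>2\<close> closure.\<close>

definition lin_span :: "'i set \<Rightarrow> ('i \<Rightarrow> real \<times> real \<Rightarrow> complex) \<Rightarrow> (real \<times> real \<Rightarrow> complex) set" where
  "lin_span I v = {(\<lambda>x. \<Sum>i\<in>F. b i * v i x) | F b. finite F \<and> F \<subseteq> I}"

definition closed_span :: "'i set \<Rightarrow> ('i \<Rightarrow> real \<times> real \<Rightarrow> complex) \<Rightarrow> (real \<times> real \<Rightarrow> complex) set" where
  "closed_span I v = {f \<in> L2. \<forall>e>0. \<exists>g\<in>lin_span I v. L2_norm (\<lambda>x. f x - g x) < e}"

definition is_frame_for ::
  "'i set \<Rightarrow> ('i \<Rightarrow> real \<times> real \<Rightarrow> complex) \<Rightarrow> (real \<times> real \<Rightarrow> complex) set \<Rightarrow> bool" where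
  "is_frame_for I v H \<longleftrightarrow> (\<exists>A B. 0 < A \<and> 0 < B \<and> (\<forall>f\<in>H.
      (\<lambda>i. (cmod (L2_inner f (v i)))\<^sup>2) summable_on I \<and>
      A * (L2_norm f)\<^sup>2 \<le> (\<Sum>\<^sub>\<infinity>i\<in>I. (cmod (L2_inner f (v i)))\<^sup>2) \<and>
      (\<Sum>\<^sub>\<infinity>i\<in>I. (cmod (L2_inner f (v i)))\<^sup>2) \<le> B * (L2_norm f)\<^sup>2))"

text \<open>The lower frame bound is the optimal one. (The supremum is only meaningful if
  \<open>H\<close> contains a function of nonzero norm.)\<close>

definition lower_frame_bound ::
  "'i set \<Rightarrow> ('i \<Rightarrow> real \<times> real \<Rightarrow> complex) \<Rightarrow> (real \<times> real \<Rightarrow> complex) set \<Rightarrow> real" where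
  "lower_frame_bound I v H =
     Sup {A. \<forall>f\<in>H. A * (L2_norm f)\<^sup>2 \<le> (\<Sum>\<^sub>\<infinity>i\<in>I. (cmod (L2_inner f (v i)))\<^sup>2)}"


section \<open>Cone-adapted discrete shearlet systems\<close>

text \<open>The matrices \<open>A\<close>, \<open>A~\<close> (at scale \<open>j\<close>, i.e. with parameter \<open>2^j\<close>), \<open>S\<^sub>k\<close> and
  the transpose of \<open>S\<^sub>k\<close>, as linear maps of the plane.\<close>

definition dil :: "nat \<Rightarrow> real \<times> real \<Rightarrow> real \<times> real" where
  "dil j x = (2 ^ j * fst x, 2 powr (real j / 2) * snd x)"

definition dil' :: "nat \<Rightarrow> real \<times> real \<Rightarrow> real \<times> real" where
  "dil' j x = (2 powr (real j / 2) * fst x, 2 ^ j * snd x)"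

definition shear :: "int \<Rightarrow> real \<times> real \<Rightarrow> real \<times> real" where
  "shear k x = (fst x + of_int k * snd x, snd x)"

definition shear' :: "int \<Rightarrow> real \<times> real \<Rightarrow> real \<times> real" where
  "shear' k x = (fst x, of_int k * fst x + snd x)"

text \<open>\<open>Phi m\<close>, \<open>Psi j k m\<close>, \<open>Psi' j k m\<close> index \<open>\<phi>\<^sub>m\<close>, \<open>\<psi>\<close> and \<open>\<psi>~\<close> with scale \<open>j\<close>,
  shear \<open>k\<close> and translation \<open>m\<close>.\<close>

datatype shearlet_index =
    Phi "int \<times> int"
  | Psi nat int "int \<times> int"
  | Psi' nat int "int \<times> int"

fun shearlet ::
  "real \<times> real \<Rightarrow> (real \<times> real \<Rightarrow> complex) \<Rightarrow> (real \<times> real \<Rightarrow> complex) \<Rightarrow> (real \<times> real \<Rightarrow> complex) \<Rightarrow>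
   shearlet_index \<Rightarrow> real \<times> real \<Rightarrow> complex" where
  "shearlet (c1, c2) \<phi> \<psi> \<psi>' (Phi (m1, m2)) =
     (\<lambda>x. \<phi> (x - (c1 * of_int m1, c1 * of_int m2)))"
| "shearlet (c1, c2) \<phi> \<psi> \<psi>' (Psi j k (m1, m2)) =
     (\<lambda>x. of_real (2 powr (3 * real j / 4)) *
        \<psi> (shear k (dil j x) - (c1 * of_int m1, c2 * of_int m2)))"
| "shearlet (c1, c2) \<phi> \<psi> \<psi>' (Psi' j k (m1, m2)) =
     (\<lambda>x. of_real (2 powr (3 * real j / 4)) *
        \<psi>' (shear' k (dil' j x) - (c2 * of_int m1, c1 * of_int m2)))"

definition shears :: "nat \<Rightarrow> int set" where
  "shears j = {k. real_of_int \<bar>k\<bar> \<le> 2 powr (real j / 2)}"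

definition all_indices :: "shearlet_index set" where
  "all_indices = range Phi \<union> {Psi j k m | j k m. k \<in> shears j} \<union> {Psi' j k m | j k m. k \<in> shears j}"

definition shearlet_frame ::
  "real \<times> real \<Rightarrow> (real \<times> real \<Rightarrow> complex) \<Rightarrow> (real \<times> real \<Rightarrow> complex) \<Rightarrow> (real \<times> real \<Rightarrow> complex) \<Rightarrow> bool" where
  "shearlet_frame c \<phi> \<psi> \<psi>' \<longleftrightarrow> is_frame_for all_indices (shearlet c \<phi> \<psi> \<psi>') L2"

definition square :: "nat \<Rightarrow> (real \<times> real) set" where
  "square a = {0..real a} \<times> {0..real a}"

definition admissible_generators ::
  "nat \<Rightarrow> real \<Rightarrow> real \<Rightarrow> (real \<times> real \<Rightarrow> complex) \<Rightarrow> (real \<times> real \<Rightarrow> complex) \<Rightarrow>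
   (real \<times> real \<Rightarrow> complex) \<Rightarrow> bool" where
  "admissible_generators a \<alpha> r \<phi> \<psi> \<psi>' \<longleftrightarrow>
     0 < a \<and> 3 < r \<and> r < \<alpha> \<and>
     \<phi> \<in> L2 \<and> \<psi> \<in> L2 \<and> (\<forall>x1 x2. \<psi>' (x1, x2) = \<psi> (x2, x1)) \<and>
     ess_supp \<phi> \<subseteq> square a \<and> ess_supp \<psi> \<subseteq> square a \<and> ess_supp \<psi>' \<subseteq> square a \<and>
     (\<exists>C1>0. \<forall>\<xi>1 \<xi>2. cmod (fourier \<phi> (\<xi>1, \<xi>2)) \<le>
        C1 / ((1 + \<bar>\<xi>1\<bar>) powr r * (1 + \<bar>\<xi>2\<bar>) powr r)) \<and>
     (\<exists>C2>0. \<forall>\<xi>1 \<xi>2. cmod (fourier \<psi> (\<xi>1, \<xi>2)) \<le>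
        C2 * min 1 (\<bar>\<xi>1\<bar> powr \<alpha>) / ((1 + \<bar>\<xi>1\<bar>) powr r * (1 + \<bar>\<xi>2\<bar>) powr r))"


section \<open>Reconstruction spaces\<close>

text \<open>In this section and the next, \<open>v\<close> stands for the family \<open>shearlet c \<phi> \<psi> \<psi>'\<close>.
  \<open>meets a v\<close> is the condition defining \<open>\<Omega>\<close>, \<open>\<Omega>\<^sub>j\<^sub>,\<^sub>k\<close> and \<open>\<Omega>~\<^sub>j\<^sub>,\<^sub>k\<close>, and
  \<open>index_set a v J\<close> indexes the generating system of \<open>\<R>\<close> with parameter
  \<open>N\<^sub>J = num_generators a v J\<close> (generators are counted as a family, by index).\<close>

definition meets :: "nat \<Rightarrow> (shearlet_index \<Rightarrow> real \<times> real \<Rightarrow> complex) \<Rightarrow> shearlet_index \<Rightarrow> bool" where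
  "meets a v i \<longleftrightarrow> ess_supp (v i) \<inter> square a \<noteq> {}"

definition index_set ::
  "nat \<Rightarrow> (shearlet_index \<Rightarrow> real \<times> real \<Rightarrow> complex) \<Rightarrow> nat \<Rightarrow> shearlet_index set" where
  "index_set a v J =
     {Phi m | m. meets a v (Phi m)} \<union>
     {Psi j k m | j k m. j < J \<and> k \<in> shears j \<and> meets a v (Psi j k m)} \<union>
     {Psi' j k m | j k m. j < J \<and> k \<in> shears j \<and> meets a v (Psi' j k m)}"

definition num_generators :: "nat \<Rightarrow> (shearlet_index \<Rightarrow> real \<times> real \<Rightarrow> complex) \<Rightarrow> nat \<Rightarrow> nat" where
  "num_generators a v J = card (index_set a v J)"

definition full_index_set ::
  "nat \<Rightarrow> (shearlet_index \<Rightarrow> real \<times> real \<Rightarrow> complex) \<Rightarrow> shearlet_index set" where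
  "full_index_set a v = (\<Union>J. index_set a v J)"

text \<open>
  The order constraints on the enumeration: the \<open>\<phi>\<^sub>m\<close> precede everything else, scales increase,
  and for two elements of the same type and the same scale, shears increase and, for equal shears,
  translations are ordered lexicographically. The relative position of the two types \<open>\<psi>\<close> and
  \<open>\<psi>~\<close> within one scale, and the order among the \<open>\<phi>\<^sub>m\<close>, are left open.
\<close>

abbreviation int_less :: "(int \<times> int) set" where
  "int_less \<equiv> {(x, y). x < y}"

fun precedes :: "shearlet_index \<Rightarrow> shearlet_index \<Rightarrow> bool" where
  "precedes (Phi m) (Phi n) \<longleftrightarrow> False"
| "precedes (Phi m) (Psi j k n) \<longleftrightarrow> True"
| "precedes (Phi m) (Psi' j k n) \<longleftrightarrow> True"
| "precedes (Psi i h m) (Phi n) \<longleftrightarrow> False"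
| "precedes (Psi' i h m) (Phi n) \<longleftrightarrow> False"
| "precedes (Psi i h m) (Psi' j k n) \<longleftrightarrow> i < j"
| "precedes (Psi' i h m) (Psi j k n) \<longleftrightarrow> i < j"
| "precedes (Psi i h m) (Psi j k n) \<longleftrightarrow>
     i < j \<or> i = j \<and> ((h, m), (k, n)) \<in> int_less <*lex*> int_less <*lex*> int_less"
| "precedes (Psi' i h m) (Psi' j k n) \<longleftrightarrow>
     i < j \<or> i = j \<and> ((h, m), (k, n)) \<in> int_less <*lex*> int_less <*lex*> int_less"

definition is_enumeration ::
  "nat \<Rightarrow> (shearlet_index \<Rightarrow> real \<times> real \<Rightarrow> complex) \<Rightarrow> (nat \<Rightarrow> shearlet_index) \<Rightarrow> bool" where
  "is_enumeration a v e \<longleftrightarrow>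
     bij_betw e UNIV (full_index_set a v) \<and> (\<forall>p q. precedes (e p) (e q) \<longrightarrow> p < q)"

text \<open>\<open>\<R>\<^sub>N\<close> is spanned by \<open>v (e 0), \<dots>, v (e (N - 1))\<close>.\<close>

definition rec_space ::
  "(shearlet_index \<Rightarrow> real \<times> real \<Rightarrow> complex) \<Rightarrow> (nat \<Rightarrow> shearlet_index) \<Rightarrow> nat \<Rightarrow>
   (real \<times> real \<Rightarrow> complex) set" where
  "rec_space v e N = lin_span (e ` {..<N}) v"

definition rec_frame_bound ::
  "(shearlet_index \<Rightarrow> real \<times> real \<Rightarrow> complex) \<Rightarrow> (nat \<Rightarrow> shearlet_index) \<Rightarrow> nat \<Rightarrow> real" where
  "rec_frame_bound v e N = lower_frame_bound (e ` {..<N}) v (rec_space v e N)"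


section \<open>Sampling spaces and the stable sampling rate\<close>

definition sampling_params ::
  "nat \<Rightarrow> (shearlet_index \<Rightarrow> real \<times> real \<Rightarrow> complex) \<Rightarrow> real \<Rightarrow> real \<Rightarrow> real \<Rightarrow> bool" where
  "sampling_params a v T1 T2 \<epsilon> \<longleftrightarrow>
     0 < T1 \<and> 0 < T2 \<and>
     closed_span (full_index_set a v) v \<subseteq> L2_on ({-T1..T2} \<times> {-T1..T2}) \<and>
     0 < \<epsilon> \<and> \<epsilon> \<le> 1 / (T1 + T2) \<and> 1 / (T1 + T2) < 1"

definition sampler :: "real \<Rightarrow> real \<Rightarrow> real \<Rightarrow> int \<times> int \<Rightarrow> real \<times> real \<Rightarrow> complex" where
  "sampler T1 T2 \<epsilon> l x =
     of_real \<epsilon> *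
     exp (2 * pi * \<i> * of_real (\<epsilon> * ((of_int (fst l), of_int (snd l)) \<bullet> x))) *
     indicator ({-T1..T2} \<times> {-T1..T2}) x"

definition sampling_op ::
  "real \<Rightarrow> real \<Rightarrow> real \<Rightarrow> nat \<Rightarrow> nat \<Rightarrow> (real \<times> real \<Rightarrow> complex) \<Rightarrow> real \<times> real \<Rightarrow> complex" where
  "sampling_op T1 T2 \<epsilon> M1 M2 f x =
     (\<Sum>l \<in> {- int M1..int M1} \<times> {- int M2..int M2}.
        L2_inner f (sampler T1 T2 \<epsilon> l) * sampler T1 T2 \<epsilon> l x)"

definition stability_const ::
  "(shearlet_index \<Rightarrow> real \<times> real \<Rightarrow> complex) \<Rightarrow> (nat \<Rightarrow> shearlet_index) \<Rightarrow> real \<Rightarrow> real \<Rightarrow> real \<Rightarrow>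
   nat \<Rightarrow> nat \<Rightarrow> nat \<Rightarrow> real" where
  "stability_const v e T1 T2 \<epsilon> N M1 M2 =
     Inf {L2_norm (sampling_op T1 T2 \<epsilon> M1 M2 f) | f. f \<in> rec_space v e N \<and> L2_norm f = 1}"

text \<open>The possible numbers of measurements, and their minimum. (On \<open>nat\<close>, \<open>Inf {} = 0\<close>, so the
  minimum has its intended meaning only where the set is nonempty.)\<close>

definition measurement_counts ::
  "(shearlet_index \<Rightarrow> real \<times> real \<Rightarrow> complex) \<Rightarrow> (nat \<Rightarrow> shearlet_index) \<Rightarrow> real \<Rightarrow> real \<Rightarrow> real \<Rightarrow>
   nat \<Rightarrow> real \<Rightarrow> nat set" where
  "measurement_counts v e T1 T2 \<epsilon> N \<theta> =
     {M1 * M2 | M1 M2. 1 \<le> M1 \<and> 1 \<le> M2 \<and> stability_const v e T1 T2 \<epsilon> N M1 M2 > 1 / \<theta>}"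

definition stable_sampling_rate ::
  "(shearlet_index \<Rightarrow> real \<times> real \<Rightarrow> complex) \<Rightarrow> (nat \<Rightarrow> shearlet_index) \<Rightarrow> real \<Rightarrow> real \<Rightarrow> real \<Rightarrow>
   nat \<Rightarrow> real \<Rightarrow> nat" where
  "stable_sampling_rate v e T1 T2 \<epsilon> N \<theta> = Inf (measurement_counts v e T1 T2 \<epsilon> N \<theta>)"

end

theory Submission
  imports Defs "HOL-Analysis.Regularity"
begin

text \<open>
  On a square of side \<open>1 / \<epsilon>\<close> containing the supports, the exponentials behind \<open>sampler T1 T2 \<epsilon>\<close> form an
  orthonormal basis (Stone-Weierstrass on the torus), so for \<open>f\<close> of norm \<open>1\<close> the energy lost by
  sampling is the tail \<open>\<epsilon>\<^sup>2 * \<Sum> \<bar>fourier f (\<epsilon> l)\<bar>\<^sup>2\<close> over the frequencies \<open>l\<close>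
  outside the box. Expanding \<open>f\<close> with the dual frame coefficients, whose square sum is at
  most \<open>1 / A\<^sub>N\<close>, and applying the Cauchy-Schwarz inequality bounds this by \<open>1 / A\<^sub>N\<close> times the sum of the
  tails of the individual generators. By the decay of \<open>fourier \<psi>\<close> each of these is
  \<open>O((2\<^sup>J / (\<epsilon> M)) powr (2 r - 1))\<close>, and there are \<open>O(4\<^sup>J)\<close> of them. The choice of \<open>M\<close>
  together with \<open>\<delta> (2 r - 1) \<ge> 2\<close> makes the product small. The rate follows since \<open>N\<^sub>J\<close> is also
  bounded below by a multiple of \<open>4\<^sup>J\<close>.
\<close>

section \<open>Finite frames in semi-inner product spaces\<close>

text \<open>Three obstacles shape the proof. The shearlets spanning \<open>rec_space v e N\<close>
  may be linearly dependent, and functions are only representatives of classes; hence the Hilbert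
  space part works with a semi-inner product, where coefficients exist up to a null vector and the
  Gram matrix may be singular. For \<open>\<epsilon> < 1 / (T1 + T2)\<close> the samplers are
  restrictions of an orthonormal basis of a larger square and are not orthogonal; the norm of the
  sampled function is therefore bounded from below through its inner product with \<open>f\<close>,
  which equals the sum of the squared samples. Finally, the decay of \<open>fourier \<psi>\<close>
  is a product over the coordinates, and shearing mixes these; the cone restriction
  \<open>\<bar>k\<bar> * 2 powr (j / 2) \<le> 2 ^ j\<close> keeps the mixing under control. The
  sampling rate adds two points: the strict inequality in \<open>measurement_counts\<close> calls
  for a threshold between 1 and \<theta>, and the rounding in \<open>M\<close> is harmless only
  because \<open>rec_frame_bound v e N\<close> stays bounded in \<open>N\<close>.\<close>

locale semi_inner =
  fixes V :: "('x \<Rightarrow> complex) set" and B :: "('x \<Rightarrow> complex) \<Rightarrow> ('x \<Rightarrow> complex) \<Rightarrow> complex"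
  assumes zero_mem: "(\<lambda>_. 0) \<in> V"
    and add_mem: "f \<in> V \<Longrightarrow> g \<in> V \<Longrightarrow> (\<lambda>x. f x + g x) \<in> V"
    and scale_mem: "f \<in> V \<Longrightarrow> (\<lambda>x. a * f x) \<in> V"
    and B_add: "f \<in> V \<Longrightarrow> g \<in> V \<Longrightarrow> h \<in> V \<Longrightarrow> B (\<lambda>x. f x + g x) h = B f h + B g h"
    and B_scale: "f \<in> V \<Longrightarrow> h \<in> V \<Longrightarrow> B (\<lambda>x. a * f x) h = a * B f h"
    and B_cnj: "f \<in> V \<Longrightarrow> g \<in> V \<Longrightarrow> B g f = cnj (B f g)"
    and B_nonneg: "f \<in> V \<Longrightarrow> 0 \<le> Re (B f f)"
begin

definition Q :: "('x \<Rightarrow> complex) \<Rightarrow> real" where "Q f = Re (B f f)"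

lemma Q_nonneg: "f \<in> V \<Longrightarrow> 0 \<le> Q f"
  by (simp add: Q_def B_nonneg)

lemma B_self: "f \<in> V \<Longrightarrow> B f f = of_real (Q f)"
  using arg_cong[OF B_cnj[of f f], of Im] by (simp add: Q_def complex_eq_iff)

lemma diff_mem: "f \<in> V \<Longrightarrow> g \<in> V \<Longrightarrow> (\<lambda>x. f x - g x) \<in> V"
  using add_mem[OF _ scale_mem, of f g "-1"] by simp

lemma sum_mem: "(\<And>i. i \<in> I \<Longrightarrow> w i \<in> V) \<Longrightarrow> (\<lambda>x. \<Sum>i\<in>I. b i * w i x) \<in> V"
  by (induction I rule: infinite_finite_induct) (auto simp: zero_mem intro!: add_mem scale_mem)

lemma B_zero: "h \<in> V \<Longrightarrow> B (\<lambda>_. 0) h = 0"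
  using B_scale[of "\<lambda>_. 0" h 0] zero_mem by simp

lemma B_diff: "f \<in> V \<Longrightarrow> g \<in> V \<Longrightarrow> h \<in> V \<Longrightarrow> B (\<lambda>x. f x - g x) h = B f h - B g h"
  using B_add[OF _ scale_mem, of f g h "-1"] B_scale[of g h "-1"] by simp

lemma B_sum: "(\<And>i. i \<in> I \<Longrightarrow> w i \<in> V) \<Longrightarrow> h \<in> V \<Longrightarrow>
    B (\<lambda>x. \<Sum>i\<in>I. b i * w i x) h = (\<Sum>i\<in>I. b i * B (w i) h)"
proof (induction I rule: infinite_finite_induct)
  case (insert i I)
  then show ?case
    using B_add[OF scale_mem[of "w i" "b i"] sum_mem[of I w b], of h] by (simp add: B_scale)
qed (simp_all add: B_zero)

lemma B_diff_right:
  assumes "f \<in> V" "g \<in> V" "h \<in> V"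
  shows "B h (\<lambda>x. f x - g x) = B h f - B h g"
proof -
  have "B h (\<lambda>x. f x - g x) = cnj (B (\<lambda>x. f x - g x) h)"
    by (rule B_cnj[OF diff_mem[OF assms(1,2)] assms(3)])
  then show ?thesis
    by (simp only: B_diff[OF assms] complex_cnj_diff B_cnj[OF assms(1,3)] B_cnj[OF assms(2,3)])
qed

lemma B_sum_right:
  assumes "\<And>i. i \<in> I \<Longrightarrow> w i \<in> V" "h \<in> V"
  shows "B h (\<lambda>x. \<Sum>i\<in>I. b i * w i x) = (\<Sum>i\<in>I. cnj (b i) * B h (w i))"
proof -
  have "B h (\<lambda>x. \<Sum>i\<in>I. b i * w i x) = cnj (B (\<lambda>x. \<Sum>i\<in>I. b i * w i x) h)"
    using assms by (intro B_cnj sum_mem)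
  also have "\<dots> = (\<Sum>i\<in>I. cnj (b i) * cnj (B (w i) h))"
    using assms by (subst B_sum) auto
  also have "\<dots> = (\<Sum>i\<in>I. cnj (b i) * B h (w i))"
    using assms by (intro sum.cong refl) (simp only: B_cnj[symmetric])
  finally show ?thesis .
qed

lemma Q_diff_scale:
  assumes "f \<in> V" "g \<in> V"
  shows "Q (\<lambda>x. f x - a * g x) = Q f - 2 * Re (cnj a * B f g) + (cmod a)\<^sup>2 * Q g"
proof -
  have ag: "(\<lambda>x. a * g x) \<in> V" by (simp add: assms scale_mem)
  have 1: "B f (\<lambda>x. a * g x) = cnj a * B f g"
    using B_cnj[OF ag assms(1)] B_scale[OF assms(2,1)] B_cnj[OF assms(1,2)] by simp
  have 2: "B (\<lambda>x. a * g x) (\<lambda>x. a * g x) = of_real ((cmod a)\<^sup>2 * Q g)"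
    using B_scale[OF assms(2) ag, of a] B_cnj[OF ag assms(2)] B_scale[OF assms(2,2), of a]
    by (simp add: B_self assms complex_norm_square mult_ac del: of_real_power)
  have 3: "B (\<lambda>x. a * g x) f = cnj (cnj a * B f g)"
    using B_scale[OF assms(2,1), of a] B_cnj[OF assms] by simp
  show ?thesis
    unfolding Q_def[of "\<lambda>x. f x - a * g x"]
    using assms ag by (simp add: B_diff B_diff_right diff_mem 1 2 3 B_self)
qed

lemma Cauchy_Schwarz:
  assumes "f \<in> V" "g \<in> V"
  shows "(cmod (B f g))\<^sup>2 \<le> Q f * Q g"
proof (cases "Q g = 0")
  case True
  have "B f g = 0"
  proof (rule ccontr)
    assume n: "B f g \<noteq> 0"
    \<comment> \<open>Along \<open>a = t * B f g\<close> with \<open>Q g = 0\<close> the value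
      \<open>Q (f - a * g)\<close> is affine in \<open>t\<close>; this \<open>t\<close> makes it
      \<open>-1\<close>.\<close>
    define t where "t = (Q f + 1) / (2 * (cmod (B f g))\<^sup>2)"
    have "0 \<le> Q (\<lambda>x. f x - (of_real t * B f g) * g x)"
      using assms by (intro Q_nonneg diff_mem scale_mem)
    also have "\<dots> = Q f - 2 * t * (cmod (B f g))\<^sup>2"
    proof -
      have "cnj (of_real t * B f g) * B f g = of_real (t * (cmod (B f g))\<^sup>2)"
        unfolding of_real_mult complex_norm_square by (simp add: mult_ac)
      then show ?thesis
        using Q_diff_scale[OF assms, of "of_real t * B f g"] True by (simp only: Re_complex_of_real)
    qed
    also have "\<dots> = -1" using n by (simp add: t_def field_simps)
    finally show False by simp
  qed
  then show ?thesis by (simp add: True)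
next
  case False
  then have p: "Q g > 0" using Q_nonneg assms by (simp add: order_less_le)
  \<comment> \<open>The minimiser of \<open>Q (f - a * g)\<close>.\<close>
  define a where "a = B f g / of_real (Q g)"
  have "0 \<le> Q (\<lambda>x. f x - a * g x)"
    using assms by (intro Q_nonneg diff_mem scale_mem)
  also have "\<dots> = Q f - (cmod (B f g))\<^sup>2 / Q g"
  proof -
    have "cnj a * B f g = of_real ((cmod (B f g))\<^sup>2 / Q g)"
      using complex_norm_square[of "B f g"] by (simp add: a_def mult.commute)
    moreover have "(cmod a)\<^sup>2 * Q g = (cmod (B f g))\<^sup>2 / Q g"
      using p by (simp add: a_def norm_divide field_simps power2_eq_square)
    ultimately show ?thesis by (simp add: Q_diff_scale assms)
  qed
  finally show ?thesis using p by (simp add: field_simps)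
qed

lemma B_eq_0: "f \<in> V \<Longrightarrow> g \<in> V \<Longrightarrow> Q f = 0 \<Longrightarrow> B f g = 0"
  using Cauchy_Schwarz[of f g] by simp

lemma B_eq_0': "f \<in> V \<Longrightarrow> g \<in> V \<Longrightarrow> Q g = 0 \<Longrightarrow> B f g = 0"
  using Cauchy_Schwarz[of f g] by simp

text \<open>Gram-Schmidt for a family that may be dependent. The new vector enters only through its
  part \<open>u\<close> orthogonal to the earlier ones; if \<open>u\<close> is null there is nothing
  to subtract.\<close>

lemma projection:
  assumes "finite I" "\<And>i. i \<in> I \<Longrightarrow> w i \<in> V" "x \<in> V"
  shows "\<exists>d. \<forall>i\<in>I. B (\<lambda>t. x t - (\<Sum>j\<in>I. d j * w j t)) (w i) = 0"
  using assms
proof (induction I arbitrary: x rule: finite_induct)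
  case (insert k I)
  have wI: "\<And>i. i \<in> I \<Longrightarrow> w i \<in> V" and wk: "w k \<in> V" using insert by auto
  from insert.IH[OF wI insert.prems(2)] obtain d where
    d: "\<And>i. i \<in> I \<Longrightarrow> B (\<lambda>t. x t - (\<Sum>j\<in>I. d j * w j t)) (w i) = 0" by blast
  from insert.IH[OF wI wk] obtain p where
    p: "\<And>i. i \<in> I \<Longrightarrow> B (\<lambda>t. w k t - (\<Sum>j\<in>I. p j * w j t)) (w i) = 0" by blast
  define y where "y = (\<lambda>t. x t - (\<Sum>j\<in>I. d j * w j t))"
  define u where "u = (\<lambda>t. w k t - (\<Sum>j\<in>I. p j * w j t))"
  have yV: "y \<in> V" and uV: "u \<in> V" unfolding y_def u_def
    using wI wk insert.prems by (auto intro!: diff_mem sum_mem)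
  have yi: "B y (w i) = 0" and ui: "B u (w i) = 0" if "i \<in> I" for i
    using d p that by (auto simp: y_def u_def)
  define p' where "p' = (\<lambda>j. - p j)"
  have wk_eq: "w k = (\<lambda>t. u t - (\<Sum>j\<in>I. p' j * w j t))"
    by (auto simp: u_def p'_def fun_eq_iff sum_negf)
  \<comment> \<open>Against a vector orthogonal to the old family, \<open>w k\<close> and
    \<open>u\<close> are interchangeable.\<close>
  have wkB: "B h (w k) = B h u" if "h \<in> V" "\<And>i. i \<in> I \<Longrightarrow> B h (w i) = 0" for h
    using that wI uV by (subst wk_eq) (simp add: B_diff_right sum_mem B_sum_right)
  obtain b where b: "B (\<lambda>t. y t - b * u t) u = 0"
  proof (cases "Q u = 0")
    case True
    then show ?thesis using that[of 0] yV uV B_eq_0'[of y u] by simp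
  next
    case False
    define b where "b = B y u / of_real (Q u)"
    have "b * of_real (Q u) = B y u" using False by (simp add: b_def)
    then show ?thesis using yV uV
      by (intro that[of b]) (simp add: B_diff scale_mem B_scale B_self)
  qed
  define z where "z = (\<lambda>t. y t - b * u t)"
  have zV: "z \<in> V" unfolding z_def using yV uV by (auto intro!: diff_mem scale_mem)
  have zi: "B z (w i) = 0" if "i \<in> I" for i
    using that yV uV wI by (simp add: z_def B_diff scale_mem B_scale yi ui)
  have zk: "B z (w k) = 0" using wkB[OF zV zi] b by (simp add: z_def)
  \<comment> \<open>Subtracting \<open>b * u\<close> subtracts \<open>b * w k\<close> and adds back
    \<open>b * p j * w j\<close> for the old indices.\<close>
  define e where "e = (\<lambda>j. if j = k then b else d j - b * p j)"
  have "z t = x t - (\<Sum>j\<in>insert k I. e j * w j t)" for t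
  proof -
    have "(\<Sum>j\<in>I. e j * w j t) = (\<Sum>j\<in>I. d j * w j t) - b * (\<Sum>j\<in>I. p j * w j t)"
      using insert(2) by (subst sum_distrib_left, subst sum_subtractf[symmetric])
        (intro sum.cong, auto simp: e_def algebra_simps)
    then show ?thesis using insert by (simp add: z_def y_def u_def e_def algebra_simps)
  qed
  then have "z = (\<lambda>t. x t - (\<Sum>j\<in>insert k I. e j * w j t))" by auto
  then show ?case using zi zk by (intro exI[of _ e]) auto
qed simp

lemma Pythagoras:
  assumes "f \<in> V" "g \<in> V" "B f g = 0"
  shows "Q (\<lambda>x. f x + b * g x) = Q f + (cmod b)\<^sup>2 * Q g"
  using Q_diff_scale[OF assms(1,2), of "-b"] assms(3) by simp

text \<open>Stands in for equality of functions: \<open>B\<close> cannot distinguish vectors that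
  differ by a null vector.\<close>

lemma Q_null_diff:
  assumes "f \<in> V" "g \<in> V" "Q (\<lambda>x. f x - g x) = 0"
  shows "h \<in> V \<Longrightarrow> B f h = B g h" "h \<in> V \<Longrightarrow> B h f = B h g" "Q f = Q g"
proof -
  show *: "B f h = B g h" if "h \<in> V" for h
    using B_eq_0[OF diff_mem[OF assms(1,2)] that assms(3)] assms that by (simp add: B_diff)
  show **: "B h f = B h g" if "h \<in> V" for h
    using *[OF that] B_cnj[OF assms(1) that] B_cnj[OF assms(2) that] by simp
  show "Q f = Q g" using *[OF assms(1)] **[OF assms(2)] by (simp add: Q_def)
qed

text \<open>A dependent family admits arbitrarily large coefficients for the same sum, so the given
  \<open>c\<close> has to be replaced. The induction splits \<open>w k\<close> into a combination of
  the earlier vectors and an orthogonal rest \<open>u\<close>; Pythagoras bounds the coefficient of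
  \<open>u\<close>, which is set to 0 when \<open>u\<close> is null.\<close>

lemma bounded_coefficients:
  assumes "finite I" "\<And>i. i \<in> I \<Longrightarrow> w i \<in> V"
  shows "\<exists>K>0. \<forall>c. \<exists>c'. Q (\<lambda>x. (\<Sum>i\<in>I. c i * w i x) - (\<Sum>i\<in>I. c' i * w i x)) = 0 \<and>
           (\<Sum>i\<in>I. (cmod (c' i))\<^sup>2) \<le> K * Q (\<lambda>x. \<Sum>i\<in>I. c i * w i x)"
  using assms
proof (induction I rule: finite_induct)
  case empty
  then show ?case by (intro exI[of _ 1]) (auto simp: Q_def B_zero zero_mem)
next
  case (insert k I)
  have wI: "\<And>i. i \<in> I \<Longrightarrow> w i \<in> V" and wk: "w k \<in> V" using insert by auto
  define S where "S = (\<lambda>c x. \<Sum>i\<in>I. c i * w i x)"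
  have S: "S c \<in> V" for c unfolding S_def using wI by (intro sum_mem)
  have "\<exists>K>0. \<forall>c. \<exists>c'. Q (\<lambda>x. S c x - S c' x) = 0 \<and> (\<Sum>i\<in>I. (cmod (c' i))\<^sup>2) \<le> K * Q (S c)"
    using insert.IH[OF wI] by (simp only: S_def)
  then obtain K where "K > 0" and
    K: "\<And>c. \<exists>c'. Q (\<lambda>x. S c x - S c' x) = 0 \<and> (\<Sum>i\<in>I. (cmod (c' i))\<^sup>2) \<le> K * Q (S c)"
    by blast
  have "\<exists>p. \<forall>i\<in>I. B (\<lambda>t. w k t - S p t) (w i) = 0"
    unfolding S_def using insert(1) wI wk by (intro projection)
  then obtain p where p: "\<And>i. i \<in> I \<Longrightarrow> B (\<lambda>t. w k t - S p t) (w i) = 0" by blast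
  define u where "u = (\<lambda>t. w k t - S p t)"
  have uV: "u \<in> V" unfolding u_def using wk S by (intro diff_mem)
  have uS: "B u (S c) = 0" for c unfolding S_def
    using p uV wI by (subst B_sum_right) (auto simp: u_def)
  have Su: "B (S c) u = 0" for c using uS B_cnj[OF uV S] by simp
  \<comment> \<open>Substituting \<open>w k = S p + u\<close> redistributes \<open>c k\<close> over
    the old indices.\<close>
  define q where "q = (\<lambda>c i. c i + c k * p i)"
  have ins: "(\<lambda>x. \<Sum>i\<in>insert k I. c i * w i x) = (\<lambda>x. S (q c) x + c k * u x)" for c :: "_ \<Rightarrow> complex"
    using insert(1,2) by (auto simp: S_def q_def u_def fun_eq_iff algebra_simps sum.distrib sum_distrib_left)
  have Qins: "Q (\<lambda>x. \<Sum>i\<in>insert k I. c i * w i x) = Q (S (q c)) + (cmod (c k))\<^sup>2 * Q u" for c :: "_ \<Rightarrow> complex"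
    unfolding ins using Pythagoras[OF S uV Su] .
  define P where "P = (\<Sum>i\<in>I. (cmod (p i))\<^sup>2)"
  have "P \<ge> 0" by (simp add: P_def sum_nonneg)
  define U where "U = (if Q u = 0 then 0 else 1 / Q u)"
  have "U \<ge> 0" using Q_nonneg[OF uV] by (simp add: U_def)
  show ?case
  \<comment> \<open>\<open>2 * K\<close> and \<open>2 * P * U\<close> come from bounding the square
    of \<open>c0 i - b * p i\<close> by twice the sum of the squares; the remaining \<open>U\<close>
    belongs to the coefficient \<open>b\<close> itself.\<close>
  proof (intro exI[of _ "2 * K + (2 * P + 1) * U"] conjI allI)
    show "2 * K + (2 * P + 1) * U > 0" using \<open>K > 0\<close> \<open>P \<ge> 0\<close> \<open>U \<ge> 0\<close>
      by (intro add_pos_nonneg mult_nonneg_nonneg) auto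
    fix c :: "_ \<Rightarrow> complex"
    define b where "b = (if Q u = 0 then 0 else c k)"
    obtain c0 where c0: "Q (\<lambda>x. S (q c) x - S c0 x) = 0"
      "(\<Sum>i\<in>I. (cmod (c0 i))\<^sup>2) \<le> K * Q (S (q c))" using K by blast
    \<comment> \<open>Arranged so that \<open>q c'\<close> agrees with \<open>c0\<close> on
      \<open>I\<close>.\<close>
    define c' where "c' = (\<lambda>i. if i = k then b else c0 i - b * p i)"
    have Sc': "S (q c') = S c0" unfolding S_def q_def
      using insert(2) by (intro ext sum.cong) (auto simp: c'_def)
    have bound: "(cmod b)\<^sup>2 \<le> U * Q (\<lambda>x. \<Sum>i\<in>insert k I. c i * w i x)"
      using Q_nonneg[OF uV] Q_nonneg[OF S] unfolding Qins by (auto simp: b_def U_def field_simps)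
    have mono: "K * Q (S (q c)) \<le> K * Q (\<lambda>x. \<Sum>i\<in>insert k I. c i * w i x)"
      using Q_nonneg[OF uV] \<open>K > 0\<close> unfolding Qins by simp
    have "Q (\<lambda>x. (\<Sum>i\<in>insert k I. c i * w i x) - (\<Sum>i\<in>insert k I. c' i * w i x)) = 0"
    proof -
      have "(\<lambda>x. (\<Sum>i\<in>insert k I. c i * w i x) - (\<Sum>i\<in>insert k I. c' i * w i x)) =
            (\<lambda>x. (S (q c) x - S c0 x) + (c k - b) * u x)"
        unfolding fun_cong[OF ins] Sc' by (auto simp: c'_def algebra_simps)
      moreover have "B (\<lambda>x. S (q c) x - S c0 x) u = 0" using S uV by (simp add: B_diff Su)
      ultimately show ?thesis
        using Pythagoras[OF diff_mem[OF S S] uV] c0 by (auto simp: b_def)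
    qed
    moreover have "(\<Sum>i\<in>insert k I. (cmod (c' i))\<^sup>2) \<le>
        (2 * K + (2 * P + 1) * U) * Q (\<lambda>x. \<Sum>i\<in>insert k I. c i * w i x)"
    proof -
      have "(cmod (c0 i - b * p i))\<^sup>2 \<le> 2 * (cmod (c0 i))\<^sup>2 + 2 * (cmod b)\<^sup>2 * (cmod (p i))\<^sup>2" for i
      proof -
        have "(cmod (c0 i - b * p i))\<^sup>2 \<le> (cmod (c0 i) + cmod (b * p i))\<^sup>2"
          by (intro power_mono norm_triangle_ineq4) simp
        also have "\<dots> \<le> 2 * (cmod (c0 i))\<^sup>2 + 2 * (cmod (b * p i))\<^sup>2"
          using sum_squares_bound[of "cmod (c0 i)" "cmod (b * p i)"] by (simp add: power2_sum)
        finally show ?thesis by (simp add: norm_mult power_mult_distrib)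
      qed
      then have "(\<Sum>i\<in>I. (cmod (c' i))\<^sup>2) \<le> (\<Sum>i\<in>I. 2 * (cmod (c0 i))\<^sup>2 + 2 * (cmod b)\<^sup>2 * (cmod (p i))\<^sup>2)"
        using insert(2) by (intro sum_mono) (auto simp: c'_def)
      also have "\<dots> = 2 * (\<Sum>i\<in>I. (cmod (c0 i))\<^sup>2) + 2 * P * (cmod b)\<^sup>2"
        by (simp add: sum.distrib sum_distrib_left P_def mult_ac)
      finally have "(\<Sum>i\<in>insert k I. (cmod (c' i))\<^sup>2) \<le> 2 * (K * Q (S (q c))) + (2 * P + 1) * (cmod b)\<^sup>2"
        using insert(1,2) c0(2) by (simp add: c'_def algebra_simps)
      also have "\<dots> \<le> 2 * (K * Q (\<lambda>x. \<Sum>i\<in>insert k I. c i * w i x)) +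
          (2 * P + 1) * (U * Q (\<lambda>x. \<Sum>i\<in>insert k I. c i * w i x))"
        using bound mono \<open>P \<ge> 0\<close> by (intro add_mono mult_left_mono[of _ _ 2] mult_left_mono[of _ _ "2 * P + 1"]) auto
      finally show ?thesis by (simp add: algebra_simps)
    qed
    ultimately show "\<exists>c'. Q (\<lambda>x. (\<Sum>i\<in>insert k I. c i * w i x) - (\<Sum>i\<in>insert k I. c' i * w i x)) = 0 \<and>
      (\<Sum>i\<in>insert k I. (cmod (c' i))\<^sup>2) \<le>
        (2 * K + (2 * P + 1) * U) * Q (\<lambda>x. \<Sum>i\<in>insert k I. c i * w i x)"
      by blast
  qed
qed

text \<open>\<open>Q f\<close> is the pairing of \<open>f\<close> with its own expansion in bounded
  coefficients, so Cauchy-Schwarz gives \<open>(Q f)\<^sup>2 \<le> K * Q f * s\<close>, and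
  \<open>1 / K\<close> serves. This is what makes the optimal bound \<open>rec_frame_bound\<close>
  positive.\<close>

lemma lower_frame_bound_exists:
  assumes I: "finite I" and w: "\<And>i. i \<in> I \<Longrightarrow> w i \<in> V"
  shows "\<exists>A>0. \<forall>c. A * Q (\<lambda>x. \<Sum>i\<in>I. c i * w i x) \<le>
           (\<Sum>i\<in>I. (cmod (B (\<lambda>x. \<Sum>j\<in>I. c j * w j x) (w i)))\<^sup>2)"
proof -
  obtain K where "K > 0" and
    K: "\<And>c. \<exists>c'. Q (\<lambda>x. (\<Sum>i\<in>I. c i * w i x) - (\<Sum>i\<in>I. c' i * w i x)) = 0 \<and>
           (\<Sum>i\<in>I. (cmod (c' i))\<^sup>2) \<le> K * Q (\<lambda>x. \<Sum>i\<in>I. c i * w i x)"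
    using bounded_coefficients[of I w] assms by blast
  show ?thesis
  proof (intro exI[of _ "1 / K"] conjI allI)
    fix c
    define f where "f = (\<lambda>x. \<Sum>i\<in>I. c i * w i x)"
    define s where "s = (\<Sum>i\<in>I. (cmod (B f (w i)))\<^sup>2)"
    have fV: "f \<in> V" unfolding f_def using w by (rule sum_mem)
    obtain c' where c': "Q (\<lambda>x. f x - (\<Sum>i\<in>I. c' i * w i x)) = 0"
      "(\<Sum>i\<in>I. (cmod (c' i))\<^sup>2) \<le> K * Q f" using K[of c] unfolding f_def by blast
    have "B f f = B (\<lambda>x. \<Sum>i\<in>I. c' i * w i x) f"
      using Q_null_diff(1)[OF fV sum_mem c'(1) fV] w by blast
    also have "\<dots> = (\<Sum>i\<in>I. c' i * cnj (B f (w i)))"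
      using w fV by (subst B_sum) (auto intro!: sum.cong simp: B_cnj[symmetric])
    finally have "Q f = cmod (\<Sum>i\<in>I. c' i * cnj (B f (w i)))"
      using B_self[OF fV] Q_nonneg[OF fV] by (metis norm_of_real abs_of_nonneg)
    also have "\<dots> \<le> (\<Sum>i\<in>I. cmod (c' i) * cmod (B f (w i)))"
      by (rule sum_norm_le) (simp add: norm_mult)
    finally have "(Q f)\<^sup>2 \<le> (\<Sum>i\<in>I. cmod (c' i) * cmod (B f (w i)))\<^sup>2"
      using Q_nonneg[OF fV] by (intro power_mono) auto
    also have "\<dots> \<le> (\<Sum>i\<in>I. (cmod (c' i))\<^sup>2) * s"
      unfolding s_def by (rule Cauchy_Schwarz_ineq_sum)
    also have "\<dots> \<le> (K * Q f) * s"
      using c'(2) by (intro mult_right_mono) (auto simp: s_def sum_nonneg)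
    finally have "Q f * Q f \<le> Q f * (K * s)" by (simp add: power2_eq_square mult_ac)
    then have "Q f \<le> K * s"
      using Q_nonneg[OF fV] \<open>K > 0\<close>
      by (cases "Q f = 0") (auto simp: s_def sum_nonneg)
    then show "1 / K * Q (\<lambda>x. \<Sum>i\<in>I. c i * w i x) \<le>
           (\<Sum>i\<in>I. (cmod (B (\<lambda>x. \<Sum>j\<in>I. c j * w j x) (w i)))\<^sup>2)"
      using \<open>K > 0\<close> by (simp add: f_def s_def field_simps)
  qed (use \<open>K > 0\<close> in simp)
qed

end

text \<open>The instance for coefficient vectors. It is only semidefinite, since values outside
  \<open>I\<close> do not count; with it, \<open>projection\<close> also does the linear algebra of
  Gram matrices.\<close>

lemma semi_inner_sum: "semi_inner UNIV (\<lambda>f g. \<Sum>i\<in>I. f i * cnj (g i))"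
proof
  show "0 \<le> Re (\<Sum>i\<in>I. f i * cnj (f i))" for f
    unfolding Re_sum by (intro sum_nonneg) (simp add: complex_mult_cnj)
qed (simp_all add: distrib_right sum.distrib sum_distrib_left mult.assoc mult.commute[of "cnj _"])

context semi_inner begin

text \<open>The coefficients are those of the dual frame. They exist since the Gram matrix, being
  self-adjoint, has a range that is complementary to its kernel.\<close>

lemma frame_coefficients:
  assumes I: "finite I" and w: "\<And>i. i \<in> I \<Longrightarrow> w i \<in> V" and "A > 0"
    and A: "\<And>c. A * Q (\<lambda>x. \<Sum>i\<in>I. c i * w i x) \<le>
           (\<Sum>i\<in>I. (cmod (B (\<lambda>x. \<Sum>j\<in>I. c j * w j x) (w i)))\<^sup>2)"
  shows "\<exists>c'. Q (\<lambda>x. (\<Sum>i\<in>I. c i * w i x) - (\<Sum>i\<in>I. c' i * w i x)) = 0 \<and>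
           A * (\<Sum>i\<in>I. (cmod (c' i))\<^sup>2) \<le> Q (\<lambda>x. \<Sum>i\<in>I. c i * w i x)"
proof -
  interpret C: semi_inner UNIV "\<lambda>f g. \<Sum>i\<in>I. f i * cnj (g i)" by (rule semi_inner_sum)
  \<comment> \<open>The residual of \<open>c\<close> after projection onto the span of the rows of
    the Gram matrix; by self-adjointness it lies in the kernel.\<close>
  obtain d where d: "\<And>j. j \<in> I \<Longrightarrow>
      (\<Sum>i\<in>I. (c i - (\<Sum>k\<in>I. d k * B (w k) (w i))) * cnj (B (w j) (w i))) = 0"
    using C.projection[OF I, of "\<lambda>j i. B (w j) (w i)" c] by auto
  define g where "g = (\<lambda>x. \<Sum>k\<in>I. d k * w k x)"
  \<comment> \<open>Since these are the analysis coefficients of \<open>g\<close>, the frame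
    inequality for \<open>g\<close> reads \<open>A * Q g \<le> s\<close>.\<close>
  define c' where "c' = (\<lambda>i. B g (w i))"
  define f where "f = (\<lambda>x. \<Sum>i\<in>I. c i * w i x)"
  define s where "s = (\<Sum>i\<in>I. (cmod (c' i))\<^sup>2)"
  have gV: "g \<in> V" and fV: "f \<in> V" and f'V: "(\<lambda>x. \<Sum>i\<in>I. c' i * w i x) \<in> V"
    unfolding g_def f_def using w by (auto intro!: sum_mem)
  have c'_eq: "c' i = (\<Sum>k\<in>I. d k * B (w k) (w i))" if "i \<in> I" for i
    unfolding c'_def g_def using w that by (intro B_sum)
  define q where "q = (\<lambda>i. c i - c' i)"
  have q0: "B (\<lambda>x. \<Sum>i\<in>I. q i * w i x) (w j) = 0" if "j \<in> I" for j
  proof -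
    have "B (\<lambda>x. \<Sum>i\<in>I. q i * w i x) (w j) = (\<Sum>i\<in>I. q i * cnj (B (w j) (w i)))"
      using w that by (subst B_sum) (auto intro!: sum.cong simp: B_cnj[symmetric])
    also have "\<dots> = 0" using d[OF that] by (simp add: q_def c'_eq)
    finally show ?thesis .
  qed
  \<comment> \<open>A combination orthogonal to every \<open>w j\<close> is orthogonal to
    itself.\<close>
  have "B (\<lambda>x. \<Sum>i\<in>I. q i * w i x) (\<lambda>x. \<Sum>i\<in>I. q i * w i x) = 0"
    using w by (subst B_sum_right) (auto intro!: sum_mem sum.neutral simp: q0)
  then have null: "Q (\<lambda>x. f x - (\<Sum>i\<in>I. c' i * w i x)) = 0"
    by (simp add: Q_def f_def q_def algebra_simps sum_subtractf)
  have "of_real s = (\<Sum>i\<in>I. c' i * cnj (B g (w i)))"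
    unfolding s_def of_real_sum by (intro sum.cong) (auto simp: c'_def complex_norm_square simp del: of_real_power)
  also have "\<dots> = B (\<lambda>x. \<Sum>i\<in>I. c' i * w i x) g"
    using w gV by (subst B_sum) (auto intro!: sum.cong simp: B_cnj[symmetric])
  also have "\<dots> = B f g" using Q_null_diff(1)[OF fV f'V null gV] by simp
  finally have "s\<^sup>2 = (cmod (B f g))\<^sup>2" by (metis norm_of_real power2_abs)
  also have "\<dots> \<le> Q f * Q g" by (rule Cauchy_Schwarz[OF fV gV])
  finally have "A * s\<^sup>2 \<le> Q f * (A * Q g)"
    using \<open>A > 0\<close> by (simp add: mult.left_commute)
  also have "\<dots> \<le> Q f * s"
    using A[of d] Q_nonneg[OF fV] by (intro mult_left_mono) (auto simp: s_def c'_def g_def)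
  finally have "s * (A * s) \<le> s * Q f" by (simp add: power2_eq_square mult_ac)
  moreover have "s \<ge> 0" by (simp add: s_def sum_nonneg)
  ultimately have "A * s \<le> Q f" using Q_nonneg[OF fV] by (cases "s = 0") auto
  then show ?thesis using null by (auto simp: f_def s_def)
qed

text \<open>Completing the square: the two sides differ by the sum of
  \<open>(cmod (b i - B f (u i)))\<^sup>2\<close>. Hence any good approximation, whatever its
  coefficients, certifies that the squared coefficients of \<open>f\<close> nearly exhaust
  \<open>Q f\<close>.\<close>

lemma best_approximation:
  assumes F: "finite F" and u: "\<And>i. i \<in> F \<Longrightarrow> u i \<in> V"
    and on: "\<And>i j. i \<in> F \<Longrightarrow> j \<in> F \<Longrightarrow> B (u i) (u j) = (if i = j then 1 else 0)" and f: "f \<in> V"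
  shows "Q f - (\<Sum>i\<in>F. (cmod (B f (u i)))\<^sup>2) \<le> Q (\<lambda>x. f x - (\<Sum>i\<in>F. b i * u i x))"
proof -
  define p where "p = (\<lambda>x. \<Sum>i\<in>F. b i * u i x)"
  have pV: "p \<in> V" unfolding p_def using u by (rule sum_mem)
  have pu: "B p (u j) = b j" if "j \<in> F" for j
    unfolding p_def using u that F by (subst B_sum) (auto simp: on if_distrib cong: if_cong)
  have fp: "B f p = (\<Sum>i\<in>F. cnj (b i) * B f (u i))"
    unfolding p_def using u f by (intro B_sum_right)
  have pp: "B p p = (\<Sum>i\<in>F. cnj (b i) * b i)"
    using u pV unfolding p_def by (subst B_sum_right) (auto intro!: sum.cong simp: pu[unfolded p_def])
  have "Q (\<lambda>x. f x - p x) = Q f - 2 * Re (B f p) + Q p"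
    using Q_diff_scale[OF f pV, of 1] by simp
  also have "\<dots> = Q f + (\<Sum>i\<in>F. Re (cnj (b i) * b i) - 2 * Re (cnj (b i) * B f (u i)))"
    by (simp add: fp Q_def[of p] pp sum_subtractf sum_distrib_left)
  also have "\<dots> \<ge> Q f + (\<Sum>i\<in>F. - (cmod (B f (u i)))\<^sup>2)"
  proof (intro add_left_mono sum_mono)
    fix i
    have "0 \<le> (cmod (b i - B f (u i)))\<^sup>2" by simp
    then show "- (cmod (B f (u i)))\<^sup>2 \<le> Re (cnj (b i) * b i) - 2 * Re (cnj (b i) * B f (u i))"
      unfolding cmod_power2 by (simp add: power2_eq_square algebra_simps)
  qed
  finally show ?thesis by (simp add: p_def sum_negf)
qed

end

section \<open>Density in L2 of a finite measure\<close>

lemma ennreal_norm_add_sq: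
  "ennreal ((cmod (a + b))\<^sup>2) \<le> 2 * ennreal ((cmod a)\<^sup>2) + 2 * ennreal ((cmod b)\<^sup>2)"
proof -
  have "(cmod (a + b))\<^sup>2 \<le> (cmod a + cmod b)\<^sup>2"
    by (intro power_mono norm_triangle_ineq) simp
  also have "\<dots> \<le> 2 * (cmod a)\<^sup>2 + 2 * (cmod b)\<^sup>2"
    using sum_squares_bound[of "cmod a" "cmod b"] by (simp add: power2_sum)
  finally have "ennreal ((cmod (a + b))\<^sup>2) \<le> ennreal (2 * (cmod a)\<^sup>2 + 2 * (cmod b)\<^sup>2)"
    by (rule ennreal_leI)
  then show ?thesis by (simp add: ennreal_plus ennreal_mult')
qed

text \<open>Separates the measure theory from the source of uniform approximation. In the
  application \<open>M\<close> is concentrated on a torus inside a larger space, which is why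
  \<open>P_uniform\<close> asks for closeness only almost everywhere.\<close>

locale dense_family = finite_measure M
  for M :: "'a::euclidean_space measure" +
  fixes P :: "('a \<Rightarrow> complex) set"
  assumes borel: "sets M = sets borel"
    and P_measurable: "p \<in> P \<Longrightarrow> p \<in> borel_measurable M"
    and P_zero: "(\<lambda>_. 0) \<in> P"
    and P_add: "p \<in> P \<Longrightarrow> q \<in> P \<Longrightarrow> (\<lambda>x. p x + q x) \<in> P"
    and P_scale: "p \<in> P \<Longrightarrow> (\<lambda>x. a * p x) \<in> P"
    and P_uniform: "continuous_on UNIV g \<Longrightarrow> e > 0 \<Longrightarrow>
      \<exists>p\<in>P. AE x in M. cmod (of_real (g x :: real) - p x) \<le> e"
begin

text \<open>The squared distance as an extended nonnegative real, so that no integrability has to be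
  carried along; the price is the factor 2 in its triangle inequality.\<close>

definition dist2 :: "('a \<Rightarrow> complex) \<Rightarrow> ('a \<Rightarrow> complex) \<Rightarrow> ennreal" where
  "dist2 f g = (\<integral>\<^sup>+x. ennreal ((cmod (f x - g x))\<^sup>2) \<partial>M)"

definition approximable :: "('a \<Rightarrow> complex) \<Rightarrow> bool" where
  "approximable f \<longleftrightarrow> f \<in> borel_measurable M \<and> (\<forall>e>0. \<exists>p\<in>P. dist2 f p \<le> ennreal e)"

lemma dist2_triangle:
  assumes [measurable]: "f \<in> borel_measurable M" "g \<in> borel_measurable M" "h \<in> borel_measurable M"
  shows "dist2 f h \<le> 2 * dist2 f g + 2 * dist2 g h"
proof -
  have "dist2 f h \<le> (\<integral>\<^sup>+x. 2 * ennreal ((cmod (f x - g x))\<^sup>2) + 2 * ennreal ((cmod (g x - h x))\<^sup>2) \<partial>M)"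
    unfolding dist2_def
    by (intro nn_integral_mono order.trans[OF _ ennreal_norm_add_sq]) simp
  also have "\<dots> = 2 * dist2 f g + 2 * dist2 g h"
    unfolding dist2_def by (subst nn_integral_add) (auto simp: nn_integral_cmult)
  finally show ?thesis .
qed

lemma approximable_limit:
  assumes f: "f \<in> borel_measurable M"
    and g: "\<And>e. e > 0 \<Longrightarrow> \<exists>g. approximable g \<and> dist2 f g \<le> ennreal e"
  shows "approximable f"
  unfolding approximable_def
proof (intro conjI f allI impI)
  fix e :: real assume "e > 0"
  then have e4: "e / 4 > 0" by simp
  from g[OF e4] obtain g where g: "approximable g" "dist2 f g \<le> ennreal (e / 4)" by blast
  then obtain p where p: "p \<in> P" "dist2 g p \<le> ennreal (e / 4)" using e4 unfolding approximable_def by blast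
  have "dist2 f p \<le> 2 * dist2 f g + 2 * dist2 g p"
    using f g p P_measurable by (intro dist2_triangle) (auto simp: approximable_def)
  also have "\<dots> \<le> 2 * ennreal (e / 4) + 2 * ennreal (e / 4)"
    using g p by (intro add_mono mult_left_mono) auto
  also have "\<dots> = ennreal e" using \<open>e > 0\<close>
    by (simp flip: ennreal_numeral ennreal_mult' ennreal_plus)
  finally show "\<exists>p\<in>P. dist2 f p \<le> ennreal e" using p by blast
qed

lemma approximable_add:
  assumes "approximable f" "approximable g"
  shows "approximable (\<lambda>x. f x + g x)"
  unfolding approximable_def
proof (intro conjI allI impI)
  have [measurable]: "f \<in> borel_measurable M" "g \<in> borel_measurable M"
    using assms by (auto simp: approximable_def)
  show "(\<lambda>x. f x + g x) \<in> borel_measurable M" by measurable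
  fix e :: real assume "e > 0"
  then have e4: "e / 4 > 0" by simp
  obtain p q where p: "p \<in> P" "dist2 f p \<le> ennreal (e / 4)" and q: "q \<in> P" "dist2 g q \<le> ennreal (e / 4)"
    using assms e4 unfolding approximable_def by blast
  note [measurable] = P_measurable[OF p(1)] P_measurable[OF q(1)]
  have "dist2 (\<lambda>x. f x + g x) (\<lambda>x. p x + q x) \<le>
      (\<integral>\<^sup>+x. 2 * ennreal ((cmod (f x - p x))\<^sup>2) + 2 * ennreal ((cmod (g x - q x))\<^sup>2) \<partial>M)"
    unfolding dist2_def
    by (intro nn_integral_mono order.trans[OF _ ennreal_norm_add_sq]) (simp add: algebra_simps)
  also have "\<dots> = 2 * dist2 f p + 2 * dist2 g q"
    unfolding dist2_def by (subst nn_integral_add) (auto simp: nn_integral_cmult)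
  also have "\<dots> \<le> 2 * ennreal (e / 4) + 2 * ennreal (e / 4)"
    using p q by (intro add_mono mult_left_mono) auto
  also have "\<dots> = ennreal e" using \<open>e > 0\<close>
    by (simp flip: ennreal_numeral ennreal_mult' ennreal_plus)
  finally show "\<exists>p\<in>P. dist2 (\<lambda>x. f x + g x) p \<le> ennreal e" using P_add[OF p(1) q(1)] by blast
qed

lemma approximable_scale:
  assumes "approximable f"
  shows "approximable (\<lambda>x. a * f x)"
  unfolding approximable_def
proof (intro conjI allI impI)
  have [measurable]: "f \<in> borel_measurable M"
    using assms by (auto simp: approximable_def)
  show "(\<lambda>x. a * f x) \<in> borel_measurable M" by measurable
  fix e :: real assume "e > 0"
  \<comment> \<open>The summand 1 covers \<open>a = 0\<close>.\<close>
  define c where "c = (cmod a)\<^sup>2 + 1"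
  have c: "c > 0" by (simp add: c_def add_nonneg_pos)
  then have ec: "e / c > 0" using \<open>e > 0\<close> by simp
  obtain p where p: "p \<in> P" "dist2 f p \<le> ennreal (e / c)"
    using assms ec unfolding approximable_def by blast
  note [measurable] = P_measurable[OF p(1)]
  have "dist2 (\<lambda>x. a * f x) (\<lambda>x. a * p x) = ennreal ((cmod a)\<^sup>2) * dist2 f p"
    unfolding dist2_def
    by (subst nn_integral_cmult[symmetric])
      (auto simp: right_diff_distrib[symmetric] norm_mult power_mult_distrib ennreal_mult'
            simp del: right_diff_distrib intro!: nn_integral_cong)
  also have "\<dots> \<le> ennreal c * ennreal (e / c)"
    using p c by (intro mult_mono ennreal_leI) (auto simp: c_def)
  also have "\<dots> = ennreal e" using c \<open>e > 0\<close> by (simp flip: ennreal_mult')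
  finally show "\<exists>p\<in>P. dist2 (\<lambda>x. a * f x) p \<le> ennreal e" using P_scale[OF p(1)] by blast
qed

lemma approximable_continuous:
  assumes "continuous_on UNIV g"
  shows "approximable (\<lambda>x. of_real (g x))"
  unfolding approximable_def
proof (intro conjI allI impI)
  have "g \<in> borel_measurable borel" using assms by (rule borel_measurable_continuous_onI)
  then have [measurable]: "g \<in> borel_measurable M" using borel measurable_cong_sets by blast
  show "(\<lambda>x. complex_of_real (g x)) \<in> borel_measurable M" by measurable
  fix e :: real assume "e > 0"
  define s where "s = sqrt (e / (measure M (space M) + 1))"
  have m: "measure M (space M) + 1 > 0" by (simp add: add_nonneg_pos)
  have s: "s > 0" using \<open>e > 0\<close> m by (simp add: s_def)
  obtain p where p: "p \<in> P" "AE x in M. cmod (of_real (g x) - p x) \<le> s"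
    using P_uniform[OF assms s] by blast
  have "dist2 (\<lambda>x. of_real (g x)) p \<le> (\<integral>\<^sup>+x. ennreal (s\<^sup>2) \<partial>M)"
    unfolding dist2_def using p(2)
    by (intro nn_integral_mono_AE) (auto elim!: eventually_mono intro!: ennreal_leI power_mono)
  also have "\<dots> = ennreal (s\<^sup>2 * measure M (space M))"
    by (simp add: emeasure_eq_measure ennreal_mult')
  also have "\<dots> \<le> ennreal e"
    using m \<open>e > 0\<close> by (intro ennreal_leI) (simp add: s_def field_simps)
  finally show "\<exists>p\<in>P. dist2 (\<lambda>x. of_real (g x)) p \<le> ennreal e" using p by blast
qed

text \<open>Regularity puts the set between a compact \<open>K\<close> and an open \<open>U\<close>
  with \<open>U - K\<close> of measure at most \<open>e\<close>. A Urysohn function for them differs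
  from the indicator only on \<open>U - K\<close>, and there by at most 1.\<close>

lemma approximable_indicator:
  assumes B: "B \<in> sets M"
  shows "approximable (indicator B)"
proof (rule approximable_limit)
  show "indicator B \<in> borel_measurable M" using B by simp
  fix e :: real assume d: "e > 0"
  have fin: "emeasure M (space M) \<noteq> \<infinity>" by simp
  have B': "B \<in> sets borel" using B borel by simp
  \<comment> \<open>If no compact subset came this close, the supremum in inner regularity would
    stay below the finite measure of \<open>B\<close> by \<open>e / 2\<close>.\<close>
  have "\<exists>K. K \<subseteq> B \<and> compact K \<and> emeasure M B < emeasure M K + ennreal (e/2)"
  proof (rule ccontr)
    assume n: "\<not> ?thesis"
    have "emeasure M B + ennreal (e/2) \<le> emeasure M B"
    proof -
      have "(SUP K\<in>{K. K \<subseteq> B \<and> compact K}. emeasure M K) + ennreal (e/2) =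
            (SUP K\<in>{K. K \<subseteq> B \<and> compact K}. emeasure M K + ennreal (e/2))"
        by (subst ennreal_SUP_add_left) auto
      also have "\<dots> \<le> emeasure M B" using n by (intro SUP_least) (auto simp: not_less)
      finally show ?thesis by (simp add: inner_regular[OF borel fin B'])
    qed
    then show False using d by (simp add: emeasure_eq_measure flip: ennreal_plus)
  qed
  then obtain K where K: "K \<subseteq> B" "compact K" "emeasure M B < emeasure M K + ennreal (e/2)" by blast
  have "\<exists>U. B \<subseteq> U \<and> open U \<and> emeasure M U < emeasure M B + ennreal (e/2)"
  proof -
    have "emeasure M B < emeasure M B + ennreal (e/2)"
      using d by (simp add: emeasure_eq_measure ennreal_less_iff flip: ennreal_plus)
    then show ?thesis
      unfolding outer_regular[OF borel fin B'] INF_less_iff by auto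
  qed
  then obtain U where U: "B \<subseteq> U" "open U" "emeasure M U < emeasure M B + ennreal (e/2)" by blast
  have sK: "K \<in> sets M" and sU: "U \<in> sets M" using K U by (auto simp: borel compact_imp_closed)
  obtain g :: "'a \<Rightarrow> real" where g: "continuous_on UNIV g" "\<And>x. g x \<in> closed_segment 1 0"
     "\<And>x. x \<in> K \<Longrightarrow> g x = 1" "\<And>x. x \<in> - U \<Longrightarrow> g x = 0"
    using Urysohn[of K "- U" "1::real" "0::real"] K U by (auto simp: compact_imp_closed)
  have g01: "0 \<le> g x" "g x \<le> 1" for x using g(2)[of x] by (auto simp: closed_segment_eq_real_ivl)
  have "dist2 (indicator B) (\<lambda>x. of_real (g x)) \<le> (\<integral>\<^sup>+x. indicator (U - K) x \<partial>M)"
    unfolding dist2_def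
  proof (intro nn_integral_mono)
    fix x
    have "indicator B x - of_real (g x) = complex_of_real (indicator B x - g x)"
      by (simp add: indicator_def)
    then have "cmod (indicator B x - of_real (g x)) = \<bar>indicator B x - g x\<bar>"
      by (simp only: norm_of_real)
    moreover have "\<bar>indicator B x - g x\<bar> \<le> 1"
      using g01[of x] by (cases "x \<in> B") auto
    ultimately have "(cmod (indicator B x - of_real (g x)))\<^sup>2 \<le> 1"
      by (simp only: power_le_one abs_ge_zero)
    moreover have "indicator B x = of_real (g x)" if "x \<notin> U - K"
      using that g(3)[of x] g(4)[of x] K(1) U(1) by (cases "x \<in> K") (auto simp: indicator_def)
    ultimately show "ennreal ((cmod (indicator B x - of_real (g x)))\<^sup>2) \<le> indicator (U - K) x"
      by (cases "x \<in> U - K") auto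
  qed
  also have "\<dots> = emeasure M (U - K)" using sU sK by simp
  also have "\<dots> = measure M U - measure M K"
    using sU sK K U by (subst emeasure_Diff) (auto simp: emeasure_eq_measure ennreal_minus)
  also have "\<dots> \<le> ennreal e"
    using K(3) U(3) d by (intro ennreal_leI) (auto simp: emeasure_eq_measure ennreal_less_iff simp flip: ennreal_plus)
  finally show "\<exists>g. approximable g \<and> dist2 (indicator B) g \<le> ennreal e"
    using approximable_continuous[OF g(1)] by blast
qed

lemma approximable_sum:
  "(\<And>i. i \<in> I \<Longrightarrow> approximable (f i)) \<Longrightarrow> approximable (\<lambda>x. \<Sum>i\<in>I. f i x)"
proof (induction I rule: infinite_finite_induct)
  case (insert x F)
  then show ?case using approximable_add[of "f x" "\<lambda>y. \<Sum>i\<in>F. f i y"] by simp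
qed (use approximable_continuous[of "\<lambda>_. 0"] in simp_all)

lemma approximable_simple:
  assumes f: "simple_function M f"
  shows "approximable f"
proof -
  have "approximable (\<lambda>x. \<Sum>y\<in>f ` space M. y * indicator (f -` {y} \<inter> space M) x)"
    using f by (intro approximable_sum approximable_scale approximable_indicator simple_functionD)
  also have "(\<lambda>x. \<Sum>y\<in>f ` space M. y * indicator (f -` {y} \<inter> space M) x) = f"
  proof
    fix x
    have "space M = UNIV" using sets_eq_imp_space_eq[OF borel] by simp
    then have "(\<Sum>y\<in>f ` space M. y * indicator (f -` {y} \<inter> space M) x) = (\<Sum>y\<in>f ` space M. if f x = y then y else 0)"
      by (intro sum.cong) (auto simp: indicator_def)
    also have "\<dots> = f x" using simple_functionD(1)[OF f] \<open>space M = UNIV\<close> by simp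
    finally show "(\<Sum>y\<in>f ` space M. y * indicator (f -` {y} \<inter> space M) x) = f x" .
  qed
  finally show ?thesis .
qed

theorem approximable_L2:
  assumes f[measurable]: "f \<in> borel_measurable M"
    and fin: "(\<integral>\<^sup>+x. ennreal ((cmod (f x))\<^sup>2) \<partial>M) < \<infinity>"
  shows "approximable f"
proof (rule approximable_limit[OF f])
  fix e :: real assume e: "e > 0"
  from borel_measurable_implies_sequence_metric[OF f, of 0] obtain s where
    s': "(\<forall>i. simple_function M (s i)) \<and> (\<forall>x\<in>space M. (\<lambda>i. s i x) \<longlonglongrightarrow> f x) \<and>
         (\<forall>i. \<forall>x\<in>space M. dist (s i x) 0 \<le> 2 * dist (f x) 0)" by blast
  have s: "simple_function M (s i)" for i using s' by blast
  have lim: "(\<lambda>i. s i x) \<longlonglongrightarrow> f x" if "x \<in> space M" for x using s' that by blast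
  have bound: "cmod (s i x) \<le> 2 * cmod (f x)" if "x \<in> space M" for i x using s' that by simp
  have [measurable]: "s i \<in> borel_measurable M" for i
    using s by (rule borel_measurable_simple_function)
  have "(\<lambda>i. dist2 f (s i)) \<longlonglongrightarrow> (\<integral>\<^sup>+x. 0 \<partial>M)"
    unfolding dist2_def
  \<comment> \<open>The simple functions satisfy \<open>cmod (s i x) \<le> 2 * cmod (f x)\<close>,
    so the error is at most \<open>3 * cmod (f x)\<close>; squaring gives the factor 9.\<close>
  proof (rule nn_integral_dominated_convergence[where w = "\<lambda>x. 9 * ennreal ((cmod (f x))\<^sup>2)"])
    show "AE x in M. ennreal ((cmod (f x - s i x))\<^sup>2) \<le> 9 * ennreal ((cmod (f x))\<^sup>2)" for i
    proof (intro AE_I2)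
      fix x assume x: "x \<in> space M"
      have "cmod (f x - s i x) \<le> 3 * cmod (f x)"
        using norm_triangle_ineq4[of "f x" "s i x"] bound[OF x, of i] by simp
      then have "(cmod (f x - s i x))\<^sup>2 \<le> (3 * cmod (f x))\<^sup>2" by (intro power_mono) auto
      then show "ennreal ((cmod (f x - s i x))\<^sup>2) \<le> 9 * ennreal ((cmod (f x))\<^sup>2)"
        by (simp add: power_mult_distrib ennreal_leI ennreal_mult'[symmetric] flip: ennreal_numeral)
    qed
    show "(\<integral>\<^sup>+x. 9 * ennreal ((cmod (f x))\<^sup>2) \<partial>M) < \<infinity>"
      using fin by (simp add: nn_integral_cmult ennreal_mult_less_top)
    show "AE x in M. (\<lambda>i. ennreal ((cmod (f x - s i x))\<^sup>2)) \<longlonglongrightarrow> 0"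
    proof (intro AE_I2)
      fix x assume x: "x \<in> space M"
      have "(\<lambda>i. (cmod (f x - s i x))\<^sup>2) \<longlonglongrightarrow> (cmod (f x - f x))\<^sup>2"
        by (intro tendsto_intros lim x)
      then show "(\<lambda>i. ennreal ((cmod (f x - s i x))\<^sup>2)) \<longlonglongrightarrow> 0"
        using tendsto_ennrealI by fastforce
    qed
  qed auto
  then have "eventually (\<lambda>i. dist2 f (s i) < ennreal e) sequentially"
    using e by (intro order_tendstoD(2)) auto
  then obtain i where "dist2 f (s i) \<le> ennreal e"
    by (auto simp: eventually_sequentially intro: less_imp_le)
  then show "\<exists>g. approximable g \<and> dist2 f g \<le> ennreal e" using approximable_simple[OF s] by blast
qed

end

section \<open>Trigonometric polynomials\<close>

lemma L2D: "f \<in> L2 \<Longrightarrow> f \<in> borel_measurable borel" "f \<in> L2 \<Longrightarrow> integrable lborel (\<lambda>x. (cmod (f x))\<^sup>2)"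
  by (auto simp: L2_def)

lemma borel_measurable_cnj [measurable]: "cnj \<in> borel_measurable borel"
  by (intro borel_measurable_continuous_onI continuous_intros)

lemma L2_mult_integrable:
  assumes "f \<in> L2" "g \<in> L2"
  shows "integrable lborel (\<lambda>x. f x * cnj (g x))"
proof (rule Bochner_Integration.integrable_bound)
  show "integrable lborel (\<lambda>x. (cmod (f x))\<^sup>2 + (cmod (g x))\<^sup>2)"
    using assms by (auto simp: L2_def)
  show "(\<lambda>x. f x * cnj (g x)) \<in> borel_measurable lborel"
    using assms[THEN L2D(1)] by measurable
  show "AE x in lborel. norm (f x * cnj (g x)) \<le> norm ((cmod (f x))\<^sup>2 + (cmod (g x))\<^sup>2)"
  proof (intro AE_I2)
    fix x
    have "cmod (f x) * cmod (g x) \<le> (cmod (f x))\<^sup>2 + (cmod (g x))\<^sup>2"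
      using sum_squares_bound[of "cmod (f x)" "cmod (g x)"]
        mult_nonneg_nonneg[OF norm_ge_zero[of "f x"] norm_ge_zero[of "g x"]] by linarith
    then show "norm (f x * cnj (g x)) \<le> norm ((cmod (f x))\<^sup>2 + (cmod (g x))\<^sup>2)"
      by (simp add: norm_mult)
  qed
qed

lemma L2_add:
  assumes "f \<in> L2" "g \<in> L2"
  shows "(\<lambda>x. f x + g x) \<in> L2"
  unfolding L2_def
proof (intro CollectI conjI)
  show m: "(\<lambda>x. f x + g x) \<in> borel_measurable lborel" using assms by (auto simp: L2_def)
  show "integrable lborel (\<lambda>x. (cmod (f x + g x))\<^sup>2)"
  proof (rule Bochner_Integration.integrable_bound)
    show "integrable lborel (\<lambda>x. 2 * (cmod (f x))\<^sup>2 + 2 * (cmod (g x))\<^sup>2)"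
      using assms by (auto simp: L2_def)
    show "(\<lambda>x. (cmod (f x + g x))\<^sup>2) \<in> borel_measurable lborel" using m by auto
    show "AE x in lborel. norm ((cmod (f x + g x))\<^sup>2) \<le> norm (2 * (cmod (f x))\<^sup>2 + 2 * (cmod (g x))\<^sup>2)"
    proof (intro AE_I2)
      fix x
      have "(cmod (f x + g x))\<^sup>2 \<le> (cmod (f x) + cmod (g x))\<^sup>2"
        by (intro power_mono norm_triangle_ineq) simp
      also have "\<dots> \<le> 2 * (cmod (f x))\<^sup>2 + 2 * (cmod (g x))\<^sup>2"
        using sum_squares_bound[of "cmod (f x)" "cmod (g x)"] by (simp add: power2_sum)
      finally show "norm ((cmod (f x + g x))\<^sup>2) \<le> norm (2 * (cmod (f x))\<^sup>2 + 2 * (cmod (g x))\<^sup>2)"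
        by simp
    qed
  qed
qed

lemma L2_scale: "f \<in> L2 \<Longrightarrow> (\<lambda>x. a * f x) \<in> L2"
  by (auto simp: L2_def norm_mult power_mult_distrib)

interpretation L2: semi_inner L2 L2_inner
proof
  show "(\<lambda>_. 0) \<in> L2" by (simp add: L2_def)
  show "(\<lambda>x. f x + g x) \<in> L2" if "f \<in> L2" "g \<in> L2" for f g using that by (rule L2_add)
  show "(\<lambda>x. a * f x) \<in> L2" if "f \<in> L2" for f a using that by (rule L2_scale)
  show "L2_inner (\<lambda>x. f x + g x) h = L2_inner f h + L2_inner g h"
    if "f \<in> L2" "g \<in> L2" "h \<in> L2" for f g h
    using that by (simp add: L2_inner_def distrib_right L2_mult_integrable)
  show "L2_inner (\<lambda>x. a * f x) h = a * L2_inner f h" for f h a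
    by (simp add: L2_inner_def mult.assoc)
  show "L2_inner g f = cnj (L2_inner f g)" for f g
    unfolding L2_inner_def by (subst Bochner_Integration.integral_cnj[symmetric]) (simp add: mult.commute)
  show "0 \<le> Re (L2_inner f f)" if "f \<in> L2" for f
    unfolding L2_inner_def integral_Re[OF L2_mult_integrable[OF that that], symmetric]
    by (intro integral_nonneg_AE) (simp add: complex_mult_cnj)
qed

lemma L2_Q: "f \<in> L2 \<Longrightarrow> L2.Q f = (LINT x|lborel. (cmod (f x))\<^sup>2)"
  unfolding L2.Q_def L2_inner_def
  by (subst complex_norm_square[symmetric]) (simp del: of_real_power)

lemma L2_norm_eq: "f \<in> L2 \<Longrightarrow> L2_norm f = sqrt (L2.Q f)"
  by (simp add: L2_norm_def L2_Q)

lemma L2_norm_sq: "f \<in> L2 \<Longrightarrow> (L2_norm f)\<^sup>2 = L2.Q f"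
  by (simp add: L2_norm_eq L2.Q_nonneg)

section \<open>Linear spans\<close>

lemma lin_span_add:
  assumes "f \<in> lin_span I v" "g \<in> lin_span I v"
  shows "(\<lambda>x. f x + g x) \<in> lin_span I v"
proof -
  obtain F b where F: "f = (\<lambda>x. \<Sum>i\<in>F. b i * v i x)" "finite F" "F \<subseteq> I"
    using assms(1) unfolding lin_span_def by blast
  obtain G c where G: "g = (\<lambda>x. \<Sum>i\<in>G. c i * v i x)" "finite G" "G \<subseteq> I"
    using assms(2) unfolding lin_span_def by blast
  define d where "d = (\<lambda>i. (if i \<in> F then b i else 0) + (if i \<in> G then c i else 0))"
  have "f x + g x = (\<Sum>i\<in>F \<union> G. d i * v i x)" for x
  proof -
    have "f x = (\<Sum>i\<in>F \<union> G. (if i \<in> F then b i else 0) * v i x)"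
      unfolding F(1) using F(2) G(2) by (intro sum.mono_neutral_cong_left) auto
    moreover have "g x = (\<Sum>i\<in>F \<union> G. (if i \<in> G then c i else 0) * v i x)"
      unfolding G(1) using F(2) G(2) by (intro sum.mono_neutral_cong_left) auto
    ultimately show ?thesis by (simp add: d_def distrib_right sum.distrib)
  qed
  then show ?thesis unfolding lin_span_def using F G
    by (intro CollectI exI[of _ "F \<union> G"] exI[of _ d]) auto
qed

lemma lin_span_scale: "f \<in> lin_span I v \<Longrightarrow> (\<lambda>x. a * f x) \<in> lin_span I v"
proof -
  assume "f \<in> lin_span I v"
  then obtain F b where F: "f = (\<lambda>x. \<Sum>i\<in>F. b i * v i x)" "finite F" "F \<subseteq> I"
    unfolding lin_span_def by blast
  then show ?thesis unfolding lin_span_def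
    by (intro CollectI exI[of _ F] exI[of _ "\<lambda>i. a * b i"]) (auto simp: sum_distrib_left mult.assoc)
qed

lemma lin_span_base: "i \<in> I \<Longrightarrow> v i \<in> lin_span I v"
  unfolding lin_span_def by (intro CollectI exI[of _ "{i}"] exI[of _ "\<lambda>_. 1"]) auto

lemma lin_span_zero: "(\<lambda>x. 0) \<in> lin_span I v"
  unfolding lin_span_def by (intro CollectI exI[of _ "{}"]) auto

lemma lin_span_sum:
  "(\<And>i. i \<in> F \<Longrightarrow> f i \<in> lin_span I v) \<Longrightarrow> (\<lambda>x. \<Sum>i\<in>F. f i x) \<in> lin_span I v"
  by (induction F rule: infinite_finite_induct) (auto intro: lin_span_add lin_span_zero)

lemma lin_span_finite:
  assumes "finite I"
  shows "lin_span I v = {(\<lambda>x. \<Sum>i\<in>I. b i * v i x) | b. True}"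
proof safe
  fix f assume "f \<in> lin_span I v"
  then obtain F b where F: "f = (\<lambda>x. \<Sum>i\<in>F. b i * v i x)" "finite F" "F \<subseteq> I"
    unfolding lin_span_def by blast
  have "f = (\<lambda>x. \<Sum>i\<in>I. (if i \<in> F then b i else 0) * v i x)"
    unfolding F(1) using F assms by (intro ext sum.mono_neutral_cong_left) auto
  then show "\<exists>b. f = (\<lambda>x. \<Sum>i\<in>I. b i * v i x) \<and> True" by (intro exI conjI) auto
next
  fix b show "(\<lambda>x. \<Sum>i\<in>I. b i * v i x) \<in> lin_span I v"
    using assms by (auto simp: lin_span_def)
qed

section \<open>Characters of the torus\<close>

definition character :: "real \<Rightarrow> int \<times> int \<Rightarrow> real \<times> real \<Rightarrow> complex" where
  "character \<epsilon> l x = cis (2 * pi * \<epsilon> * (of_int (fst l) * fst x + of_int (snd l) * snd x))"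

lemma character_add: "character \<epsilon> (k + l) x = character \<epsilon> k x * character \<epsilon> l x"
  by (simp add: character_def cis_mult algebra_simps)

lemma cnj_character: "cnj (character \<epsilon> l x) = character \<epsilon> (- l) x"
  by (simp add: character_def cis_cnj algebra_simps)

lemma continuous_character: "continuous_on UNIV (character \<epsilon> l)"
  unfolding character_def cis_conv_exp by (intro continuous_intros)

lemma norm_character [simp]: "cmod (character \<epsilon> l x) = 1"
  by (simp add: character_def)

lemma trig_mult:
  assumes "f \<in> lin_span UNIV (character \<epsilon>)" "g \<in> lin_span UNIV (character \<epsilon>)"
  shows "(\<lambda>x. f x * g x) \<in> lin_span UNIV (character \<epsilon>)"
proof -
  obtain F b where F: "f = (\<lambda>x. \<Sum>i\<in>F. b i * character \<epsilon> i x)"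
    using assms(1) unfolding lin_span_def by blast
  obtain G c where G: "g = (\<lambda>x. \<Sum>i\<in>G. c i * character \<epsilon> i x)"
    using assms(2) unfolding lin_span_def by blast
  have "(\<lambda>x. \<Sum>i\<in>F. \<Sum>j\<in>G. b i * c j * character \<epsilon> (i + j) x) \<in> lin_span UNIV (character \<epsilon>)"
    by (intro lin_span_sum lin_span_scale lin_span_base) auto
  also have "(\<lambda>x. \<Sum>i\<in>F. \<Sum>j\<in>G. b i * c j * character \<epsilon> (i + j) x) = (\<lambda>x. f x * g x)"
    by (simp add: F G sum_product character_add mult_ac)
  finally show ?thesis .
qed

lemma trig_const: "(\<lambda>x. a) \<in> lin_span UNIV (character \<epsilon>)"
proof -
  have "(\<lambda>x. a * character \<epsilon> 0 x) \<in> lin_span UNIV (character \<epsilon>)"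
    by (intro lin_span_scale lin_span_base) auto
  then show ?thesis by (simp add: character_def)
qed

section \<open>Parseval's identity on the plane\<close>

text \<open>Turns continuous functions with period \<open>1 / \<epsilon>\<close> in each coordinate
  into functions on a compact set, where Stone-Weierstrass applies.\<close>

definition torus_map :: "real \<Rightarrow> real \<times> real \<Rightarrow> complex \<times> complex" where
  "torus_map \<epsilon> x = (cis (2 * pi * \<epsilon> * fst x), cis (2 * pi * \<epsilon> * snd x))"

lemma continuous_torus_map: "continuous_on UNIV (torus_map \<epsilon>)"
  unfolding torus_map_def cis_conv_exp by (intro continuous_intros)

text \<open>Stone-Weierstrass is applied to the real functions of the torus coordinates whose
  pull-back is a trigonometric polynomial. They form a ring because characters multiply to
  characters, and the real and imaginary parts of the two coordinates separate points.\<close>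

lemma trig_approximation:
  fixes g :: "complex \<times> complex \<Rightarrow> real"
  assumes g: "continuous_on UNIV g" and d: "d > 0"
  shows "\<exists>h. continuous_on UNIV h \<and>
    (\<lambda>x. complex_of_real (h (torus_map \<epsilon> x))) \<in> lin_span UNIV (character \<epsilon>) \<and>
    (\<forall>x. \<bar>g (torus_map \<epsilon> x) - h (torus_map \<epsilon> x)\<bar> < d)"
proof -
  define R where "R = {h :: complex \<times> complex \<Rightarrow> real. continuous_on UNIV h \<and>
    (\<lambda>x. complex_of_real (h (torus_map \<epsilon> x))) \<in> lin_span UNIV (character \<epsilon>)}"
  define S where "S = sphere (0::complex) 1 \<times> sphere (0::complex) 1"
  have half: "(\<lambda>x. a * character \<epsilon> k x + b * character \<epsilon> l x) \<in> lin_span UNIV (character \<epsilon>)" for a b k l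
    by (intro lin_span_add lin_span_scale lin_span_base) auto
  \<comment> \<open>Euler's formulas for cosine and sine.\<close>
  have e: "(\<lambda>x. complex_of_real (Re (fst (torus_map \<epsilon> x)))) =
      (\<lambda>x. 1/2 * character \<epsilon> (1,0) x + 1/2 * character \<epsilon> (-1,0) x)"
    "(\<lambda>x. complex_of_real (Im (fst (torus_map \<epsilon> x)))) =
      (\<lambda>x. (- \<i>/2) * character \<epsilon> (1,0) x + (\<i>/2) * character \<epsilon> (-1,0) x)"
    "(\<lambda>x. complex_of_real (Re (snd (torus_map \<epsilon> x)))) =
      (\<lambda>x. 1/2 * character \<epsilon> (0,1) x + 1/2 * character \<epsilon> (0,-1) x)"
    "(\<lambda>x. complex_of_real (Im (snd (torus_map \<epsilon> x)))) =
      (\<lambda>x. (- \<i>/2) * character \<epsilon> (0,1) x + (\<i>/2) * character \<epsilon> (0,-1) x)"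
    by (auto simp: torus_map_def character_def complex_eq_iff)
  have "(\<lambda>w. Re (fst w)) \<in> R" "(\<lambda>w. Im (fst w)) \<in> R" "(\<lambda>w. Re (snd w)) \<in> R" "(\<lambda>w. Im (snd w)) \<in> R"
    unfolding R_def mem_Collect_eq e by (intro conjI half continuous_intros)+
  note coords = this
  interpret function_ring_on R S
  proof
    show "compact S" unfolding S_def by (intro compact_Times) auto
    show "continuous_on S f" if "f \<in> R" for f
      using that continuous_on_subset unfolding R_def by blast
    show "(\<lambda>x. f x + g x) \<in> R" if "f \<in> R" "g \<in> R" for f g
      using that lin_span_add unfolding R_def by (auto intro: continuous_on_add)
    show "(\<lambda>x. f x * g x) \<in> R" if "f \<in> R" "g \<in> R" for f g
      using that trig_mult unfolding R_def by (auto intro: continuous_on_mult)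
    show "(\<lambda>_. c) \<in> R" for c using trig_const unfolding R_def by auto
    show "\<exists>f\<in>R. f x \<noteq> f y" if "x \<noteq> y" for x y
    proof -
      have "Re (fst x) \<noteq> Re (fst y) \<or> Im (fst x) \<noteq> Im (fst y) \<or> Re (snd x) \<noteq> Re (snd y) \<or> Im (snd x) \<noteq> Im (snd y)"
        using that by (auto simp: prod_eq_iff complex_eq_iff)
      then show ?thesis using coords by metis
    qed
  qed
  obtain h where h: "h \<in> R" "\<forall>w\<in>S. \<bar>g w - h w\<bar> < d"
    using Stone_Weierstrass_basic[of g d] continuous_on_subset[OF g] d by blast
  have "torus_map \<epsilon> x \<in> S" for x by (simp add: S_def torus_map_def)
  then show ?thesis using h unfolding R_def by (intro exI[of _ h]) auto
qed

section \<open>Cutting the torus open along a period\<close>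

lemma Arg2pi_measurable [measurable]: "Arg2pi \<in> borel_measurable borel"
  by (intro borel_measurableI_le) (auto intro!: borel_closed closed_Arg2pi2pi_le)

text \<open>The rotation by \<open>- (2 * pi * \<epsilon> * p)\<close> places the cut of
  \<open>Arg2pi\<close>, which jumps at angle 0, on the lower edges of the box with corner
  \<open>(p, p)\<close>.\<close>

definition torus_inv :: "real \<Rightarrow> real \<Rightarrow> complex \<times> complex \<Rightarrow> real \<times> real" where
  "torus_inv \<epsilon> p w = (p + Arg2pi (fst w * cis (- (2 * pi * \<epsilon> * p))) / (2 * pi * \<epsilon>),
                     p + Arg2pi (snd w * cis (- (2 * pi * \<epsilon> * p))) / (2 * pi * \<epsilon>))"

text \<open>Half-open, so that \<open>torus_map \<epsilon>\<close> is injective on it.\<close>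

definition period_box :: "real \<Rightarrow> real \<Rightarrow> (real \<times> real) set" where
  "period_box \<epsilon> p = {p..<p + 1 / \<epsilon>} \<times> {p..<p + 1 / \<epsilon>}"

lemma period_box_borel [measurable]: "period_box \<epsilon> p \<in> sets borel"
  unfolding period_box_def by (simp flip: borel_prod)

lemma emeasure_period_box:
  assumes "\<epsilon> > 0" shows "emeasure lborel (period_box \<epsilon> p) = ennreal (1 / \<epsilon>\<^sup>2)"
  unfolding period_box_def lborel_prod[symmetric] using assms
  by (subst lborel.emeasure_pair_measure_Times)
     (auto simp: power2_eq_square simp flip: ennreal_mult')

lemma torus_inv_measurable [measurable]: "torus_inv \<epsilon> p \<in> borel_measurable borel"
proof -
  have [measurable]: "fst \<in> borel_measurable (borel :: (complex \<times> complex) measure)"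
    "snd \<in> borel_measurable (borel :: (complex \<times> complex) measure)"
    by (auto intro!: borel_measurable_continuous_onI continuous_intros)
  show ?thesis unfolding torus_inv_def by measurable
qed

lemma torus_inv:
  assumes "\<epsilon> > 0" "x \<in> period_box \<epsilon> p"
  shows "torus_inv \<epsilon> p (torus_map \<epsilon> x) = x"
proof -
  have *: "Arg2pi (cis (2 * pi * \<epsilon> * t) * cis (- (2 * pi * \<epsilon> * p))) = 2 * pi * \<epsilon> * (t - p)"
    if "p \<le> t" "t < p + 1 / \<epsilon>" for t
  proof (rule Arg2pi_unique[of 1])
    have "\<epsilon> * (t - p) < 1" using that assms(1) by (simp add: field_simps)
    then have "2 * pi * (\<epsilon> * (t - p)) < 2 * pi * 1" by (intro mult_strict_left_mono) auto
    then show "2 * pi * \<epsilon> * (t - p) < 2 * pi" by (simp add: mult.assoc)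
    show "0 \<le> 2 * pi * \<epsilon> * (t - p)" using that assms(1) by simp
    show "of_real 1 * exp (\<i> * of_real (2 * pi * \<epsilon> * (t - p))) =
        cis (2 * pi * \<epsilon> * t) * cis (- (2 * pi * \<epsilon> * p))"
      unfolding cis_conv_exp exp_add[symmetric] by (simp add: algebra_simps)
  qed auto
  show ?thesis using assms *[of "fst x"] *[of "snd x"]
    by (auto simp: torus_inv_def torus_map_def period_box_def)
qed

text \<open>The abstract density result is used for the image of Lebesgue measure on the box under
  \<open>torus_map \<epsilon>\<close>: a continuous function of the torus coordinates is
  automatically periodic, so no boundary condition on the box interferes. The function
  \<open>f\<close> is carried over by \<open>torus_inv\<close>, for which measurability is
  enough.\<close>

lemma trig_dense:
  assumes f: "f \<in> L2" and "\<epsilon> > 0" "e > 0"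
  shows "\<exists>q\<in>lin_span UNIV (character \<epsilon>).
    (\<integral>\<^sup>+x. ennreal ((cmod (f x - q x))\<^sup>2) * indicator (period_box \<epsilon> p) x \<partial>lborel) \<le> ennreal e"
proof -
  define D where "D = period_box \<epsilon> p"
  define z where "z = torus_map \<epsilon>"
  define M where "M = distr (restrict_space lborel D) borel z"
  define P where "P = {q. q \<in> borel_measurable borel \<and> (\<lambda>x. q (z x)) \<in> lin_span UNIV (character \<epsilon>)}"
  have D [measurable]: "D \<in> sets borel" by (simp add: D_def)
  have zb [measurable]: "z \<in> borel_measurable borel"
    unfolding z_def by (intro borel_measurable_continuous_onI continuous_torus_map)
  have z [measurable]: "z \<in> measurable (restrict_space lborel D) borel"
    by (intro measurable_restrict_space1) simp
  have [measurable]: "f \<in> borel_measurable borel" using f by (rule L2D)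
  have sM [simp]: "sets M = sets borel" "space M = UNIV" by (auto simp: M_def)
  have mM: "borel_measurable M = borel_measurable borel" by (intro measurable_cong_sets) auto
  interpret dense_family M P
  proof (intro dense_family.intro dense_family_axioms.intro finite_measureI)
    have "emeasure M (space M) = emeasure lborel D"
      by (simp add: M_def emeasure_distr emeasure_restrict_space space_restrict_space)
    then show "emeasure M (space M) \<noteq> \<infinity>"
      using assms by (simp add: D_def emeasure_period_box)
    show "q \<in> borel_measurable M" if "q \<in> P" for q using that by (auto simp: P_def mM)
    show "(\<lambda>_. 0) \<in> P" by (simp add: P_def trig_const)
    show "(\<lambda>x. q x + r x) \<in> P" if "q \<in> P" "r \<in> P" for q r
      using that lin_span_add by (auto simp: P_def)
    show "(\<lambda>x. a * q x) \<in> P" if "q \<in> P" for q a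
      using that lin_span_scale by (auto simp: P_def)
    show "\<exists>q\<in>P. AE x in M. cmod (of_real (g x) - q x) \<le> d"
      if g: "continuous_on UNIV g" and d: "d > 0" for g :: "complex \<times> complex \<Rightarrow> real" and d
    proof -
      obtain h where h: "continuous_on UNIV h"
        "(\<lambda>x. complex_of_real (h (z x))) \<in> lin_span UNIV (character \<epsilon>)"
        "\<forall>x. \<bar>g (z x) - h (z x)\<bar> < d"
        using trig_approximation[OF g d, of \<epsilon>] unfolding z_def by blast
      have [measurable]: "g \<in> borel_measurable borel" "h \<in> borel_measurable borel"
        using g h by (auto intro: borel_measurable_continuous_onI)
      have "AE x in restrict_space lborel D. cmod (of_real (g (z x)) - of_real (h (z x))) \<le> d"
        using h(3) by (intro AE_I2) (auto simp: less_imp_le simp flip: of_real_diff)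
      then have "AE x in M. cmod (of_real (g x) - of_real (h x)) \<le> d"
        unfolding M_def by (subst AE_distr_iff) auto
      moreover have "(\<lambda>x. complex_of_real (h x)) \<in> P" using h by (simp add: P_def)
      ultimately show ?thesis by (rule bexI)
    qed
  qed simp
  have inv: "torus_inv \<epsilon> p (z x) = x" if "x \<in> D" for x
    using torus_inv[of \<epsilon> x p] that assms by (simp add: z_def D_def)
  define F where "F = (\<lambda>w. f (torus_inv \<epsilon> p w))"
  have F [measurable]: "F \<in> borel_measurable borel" unfolding F_def by measurable
  \<comment> \<open>Pulls squared distances on the torus back to integrals over the box, where
    \<open>F\<close> composed with \<open>z\<close> is \<open>f\<close>.\<close>
  have change: "(\<integral>\<^sup>+w. ennreal ((cmod (F w - q w))\<^sup>2) \<partial>M) =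
      (\<integral>\<^sup>+x. ennreal ((cmod (f x - q (z x)))\<^sup>2) * indicator D x \<partial>lborel)"
    if [measurable]: "q \<in> borel_measurable borel" for q
    unfolding M_def
    by (subst nn_integral_distr)
      (auto simp: nn_integral_restrict_space F_def inv intro!: nn_integral_cong split: split_indicator)
  have "approximable F"
  proof (rule approximable_L2)
    have "(\<integral>\<^sup>+w. ennreal ((cmod (F w))\<^sup>2) \<partial>M) \<le> (\<integral>\<^sup>+x. ennreal ((cmod (f x))\<^sup>2) \<partial>lborel)"
      using change[of "\<lambda>_. 0"] by (auto intro!: nn_integral_mono split: split_indicator)
    also have "\<dots> < \<infinity>" using L2D(2)[OF f] by (simp add: integrable_iff_bounded)
    finally show "(\<integral>\<^sup>+w. ennreal ((cmod (F w))\<^sup>2) \<partial>M) < \<infinity>" .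
  qed (simp add: mM F)
  then obtain q where "q \<in> P" "dist2 F q \<le> ennreal e" using assms unfolding approximable_def by blast
  then show ?thesis using change[of q] unfolding dist2_def P_def D_def by auto
qed

section \<open>Orthonormality and completeness of the characters\<close>

lemma integral_cis_period:
  fixes n :: int
  assumes "\<epsilon> > 0"
  shows "(LINT t|lborel. indicator {p..<p + 1 / \<epsilon>} t * cis (2 * pi * \<epsilon> * (of_int n * t))) =
    (if n = 0 then of_real (1 / \<epsilon>) else 0)"
proof (cases "n = 0")
  case True
  have "(LINT t|lborel. indicator {p..<p + 1 / \<epsilon>} t * cis (2 * pi * \<epsilon> * (of_int n * t))) =
     (LINT t|lborel. complex_of_real (indicator {p..<p + 1 / \<epsilon>} t))"
    by (intro Bochner_Integration.integral_cong) (auto simp: True split: split_indicator)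
  also have "\<dots> = of_real (LINT t|lborel. indicator {p..<p + 1 / \<epsilon>} t)"
    by (rule integral_complex_of_real)
  also have "\<dots> = of_real (1 / \<epsilon>)" using assms by simp
  finally show ?thesis using True by simp
next
  case False
  define c where "c = 2 * pi * \<epsilon> * of_int n"
  have c: "c \<noteq> 0" using False assms by (simp add: c_def)
  define F where "F = (\<lambda>t. (1 / (\<i> * c)) * cis (c * t))"
  have "(LINT t|lborel. indicator {p..<p + 1 / \<epsilon>} t * cis (2 * pi * \<epsilon> * (of_int n * t))) =
     (LINT t|lborel. indicator {p..p + 1 / \<epsilon>} t *\<^sub>R cis (c * t))"
  \<comment> \<open>The fundamental theorem of calculus is applied on a closed interval; the added
    endpoint is a null set.\<close>
  proof (rule integral_cong_AE)
    have "(\<lambda>t. cis (k * t)) \<in> borel_measurable borel" for k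
      unfolding cis_conv_exp by (intro borel_measurable_continuous_onI continuous_intros)
    from this[of c] have [measurable]: "(\<lambda>t. cis (c * t)) \<in> borel_measurable borel" .
    show "(\<lambda>t. indicator {p..p + 1 / \<epsilon>} t *\<^sub>R cis (c * t)) \<in> borel_measurable lborel" by measurable
    have "(\<lambda>t. indicator {p..<p + 1 / \<epsilon>} t * cis (c * t)) \<in> borel_measurable lborel" by measurable
    then show "(\<lambda>t. indicator {p..<p + 1 / \<epsilon>} t * cis (2 * pi * \<epsilon> * (of_int n * t))) \<in> borel_measurable lborel"
      by (simp add: c_def mult.assoc)
    show "AE t in lborel. indicator {p..<p + 1 / \<epsilon>} t * cis (2 * pi * \<epsilon> * (of_int n * t)) =
      indicator {p..p + 1 / \<epsilon>} t *\<^sub>R cis (c * t)"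
      using AE_lborel_singleton[of "p + 1 / \<epsilon>"]
      by eventually_elim (auto simp: c_def mult.assoc scaleR_conv_of_real split: split_indicator)
  qed
  also have "\<dots> = F (p + 1 / \<epsilon>) - F p"
  proof (rule integral_FTC_Icc)
    show "p \<le> p + 1 / \<epsilon>" using assms by simp
    show "continuous_on {p..p + 1 / \<epsilon>} (\<lambda>t. cis (c * t))"
      unfolding cis_conv_exp by (intro continuous_intros)
    show "(F has_vector_derivative cis (c * t)) (at t within {p..p + 1 / \<epsilon>})" for t
    proof -
      have "((\<lambda>u. (1 / (\<i> * c)) * exp (\<i> * c * u)) has_field_derivative exp (\<i> * c * t)) (at (of_real t))"
        using c by (auto intro!: derivative_eq_intros)
      from has_vector_derivative_real_field[OF this] show ?thesis
        by (simp add: F_def cis_conv_exp mult.assoc)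
    qed
  qed
  also have "\<dots> = 0"
  proof -
    have "c * (p + 1 / \<epsilon>) = c * p + 2 * pi * of_int n" using assms by (simp add: c_def field_simps)
    then have "cis (c * (p + 1 / \<epsilon>)) = cis (c * p) * cis (2 * pi * of_int n)"
      by (simp only: cis_mult)
    also have "cis (2 * pi * of_int n) = 1" by (intro cis_multiple_2pi) auto
    finally show ?thesis by (simp add: F_def)
  qed
  finally show ?thesis using False by simp
qed

text \<open>The samplers with the cut-off enlarged from the square of side \<open>T1 + T2\<close> to
  a full period, where they become orthonormal.\<close>

definition box_character :: "real \<Rightarrow> real \<Rightarrow> int \<times> int \<Rightarrow> real \<times> real \<Rightarrow> complex" where
  "box_character \<epsilon> p l x = of_real \<epsilon> * (character \<epsilon> l x * indicator (period_box \<epsilon> p) x)"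

lemma character_measurable [measurable]: "character \<epsilon> l \<in> borel_measurable borel"
  by (intro borel_measurable_continuous_onI continuous_character)

lemma indicator_period_box_integrable:
  "\<epsilon> > 0 \<Longrightarrow> integrable lborel (\<lambda>x. indicator (period_box \<epsilon> p) x :: real)"
  by (simp add: emeasure_period_box integrable_indicator_iff)

lemma character_box_integrable:
  assumes "\<epsilon> > 0"
  shows "integrable lborel (\<lambda>x. character \<epsilon> l x * indicator (period_box \<epsilon> p) x)"
  by (rule Bochner_Integration.integrable_bound[OF indicator_period_box_integrable[OF assms, of p]])
     (auto simp: norm_mult split: split_indicator)

lemma integral_character_box:
  assumes "\<epsilon> > 0"
  shows "(LINT x|lborel. character \<epsilon> l x * indicator (period_box \<epsilon> p) x) =
    (if l = 0 then of_real (1 / \<epsilon>\<^sup>2) else 0)"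
proof -
  define g where "g = (\<lambda>n t. indicator {p..<p + 1 / \<epsilon>} t * cis (2 * pi * \<epsilon> * (of_int n * t)))"
  have eq: "character \<epsilon> l (s, t) * indicator (period_box \<epsilon> p) (s, t) = g (fst l) s * g (snd l) t" for s t
    by (auto simp: character_def g_def period_box_def cis_mult algebra_simps split: split_indicator)
  have "(LINT x|lborel. character \<epsilon> l x * indicator (period_box \<epsilon> p) x) =
     (LINT s|lborel. (LINT t|lborel. character \<epsilon> l (s, t) * indicator (period_box \<epsilon> p) (s, t)))"
    using character_box_integrable[OF assms, of l p]
    by (subst lborel_prod[symmetric], subst lborel_pair.integral_fst') (simp_all add: lborel_prod)
  also have "\<dots> = (LINT s|lborel. g (fst l) s) * (LINT t|lborel. g (snd l) t)"
    unfolding eq by simp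
  also have "\<dots> = (if l = 0 then of_real (1 / \<epsilon>\<^sup>2) else 0)"
    unfolding g_def integral_cis_period[OF assms] by (auto simp: zero_prod_def prod_eq_iff power2_eq_square)
  finally show ?thesis .
qed

lemma box_character_L2: "\<epsilon> > 0 \<Longrightarrow> box_character \<epsilon> p l \<in> L2"
proof -
  assume e: "\<epsilon> > 0"
  have "(\<lambda>x. (cmod (box_character \<epsilon> p l x))\<^sup>2) = (\<lambda>x. \<epsilon>\<^sup>2 * indicator (period_box \<epsilon> p) x)"
    by (auto simp: box_character_def norm_mult fun_eq_iff split: split_indicator)
  then show ?thesis using indicator_period_box_integrable[OF e, of p]
    unfolding L2_def by (auto simp: box_character_def[abs_def])
qed

lemma box_character_orthonormal:
  assumes "\<epsilon> > 0"
  shows "L2_inner (box_character \<epsilon> p k) (box_character \<epsilon> p l) = (if k = l then 1 else 0)"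
proof -
  have "L2_inner (box_character \<epsilon> p k) (box_character \<epsilon> p l) =
    (LINT x|lborel. of_real (\<epsilon>\<^sup>2) * (character \<epsilon> (k - l) x * indicator (period_box \<epsilon> p) x))"
    unfolding L2_inner_def
    by (intro Bochner_Integration.integral_cong)
      (auto simp: box_character_def cnj_character character_add[of \<epsilon> k "- l", simplified]
        power2_eq_square split: split_indicator)
  also have "\<dots> = of_real (\<epsilon>\<^sup>2) * (if k - l = 0 then of_real (1 / \<epsilon>\<^sup>2) else 0)"
    using assms by (simp only: integral_mult_right_zero integral_character_box)
  also have "\<dots> = (if k = l then 1 else 0)" using assms by (simp flip: of_real_mult)
  finally show ?thesis .
qed

text \<open>Given a trigonometric polynomial within \<open>e\<close> of \<open>f\<close> in squared
  norm on the box, \<open>best_approximation\<close> shows that its frequencies already carry all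
  but \<open>e\<close> of the energy. A finite set of frequencies is enough for the tail estimates,
  so no infinite sum appears.\<close>

lemma Parseval_box:
  assumes f: "f \<in> L2" and supp: "AE x in lborel. x \<notin> period_box \<epsilon> p \<longrightarrow> f x = 0"
    and \<epsilon>: "\<epsilon> > 0" and e: "e > 0"
  shows "\<exists>F. finite F \<and> L2.Q f - e \<le> (\<Sum>l\<in>F. (cmod (L2_inner f (box_character \<epsilon> p l)))\<^sup>2)"
proof -
  obtain q where q: "q \<in> lin_span UNIV (character \<epsilon>)"
    "(\<integral>\<^sup>+x. ennreal ((cmod (f x - q x))\<^sup>2) * indicator (period_box \<epsilon> p) x \<partial>lborel) \<le> ennreal e"
    using trig_dense[OF f \<epsilon> e] by blast
  obtain F b where F: "q = (\<lambda>x. \<Sum>l\<in>F. b l * character \<epsilon> l x)" "finite F"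
    using q(1) unfolding lin_span_def by blast
  \<comment> \<open>Division by \<epsilon> cancels the normalisation of
    \<open>box_character\<close>.\<close>
  define h where "h = (\<lambda>x. f x - (\<Sum>l\<in>F. (b l / of_real \<epsilon>) * box_character \<epsilon> p l x))"
  have hL2: "h \<in> L2" unfolding h_def
    using f \<epsilon> by (intro L2.diff_mem L2.sum_mem box_character_L2)
  have h_eq: "h x = f x - q x * indicator (period_box \<epsilon> p) x" for x
    using \<epsilon> by (auto simp: h_def F box_character_def sum_distrib_left mult_ac intro!: sum.cong)
  have "ennreal (L2.Q h) = (\<integral>\<^sup>+x. ennreal ((cmod (h x))\<^sup>2) \<partial>lborel)"
    using L2D(2)[OF hL2] by (simp add: L2_Q hL2 nn_integral_eq_integral)
  also have "\<dots> = (\<integral>\<^sup>+x. ennreal ((cmod (f x - q x))\<^sup>2) * indicator (period_box \<epsilon> p) x \<partial>lborel)"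
    using supp by (intro nn_integral_cong_AE) (auto elim!: eventually_mono simp: h_eq split: split_indicator)
  also have "\<dots> \<le> ennreal e" by (rule q(2))
  finally have "L2.Q h \<le> e" using e by simp
  moreover have "L2.Q f - (\<Sum>l\<in>F. (cmod (L2_inner f (box_character \<epsilon> p l)))\<^sup>2) \<le> L2.Q h"
    unfolding h_def using F(2) f \<epsilon>
    by (intro L2.best_approximation) (auto simp: box_character_L2 box_character_orthonormal)
  ultimately show ?thesis using F(2) by (intro exI[of _ F]) auto
qed

text \<open>For \<open>\<epsilon> = 1 / (T1 + T2)\<close> the closed square of the samplers exceeds
  the half-open period box by its upper edges, which lie on such lines.\<close>

lemma AE_coordinates_neq: "AE x in lborel. fst x \<noteq> (c::real) \<and> snd x \<noteq> (c::real)"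
proof -
  have "{c} \<times> UNIV \<union> UNIV \<times> {c} \<in> null_sets (lborel :: (real \<times> real) measure)"
    unfolding lborel_prod[symmetric]
    by (intro null_sets.Un null_setsI) (auto simp: lborel.emeasure_pair_measure_Times)
  then show ?thesis by (rule AE_I') auto
qed

lemma sampler_eq:
  "sampler T1 T2 \<epsilon> l x = of_real \<epsilon> * (character \<epsilon> l x * indicator ({-T1..T2} \<times> {-T1..T2}) x)"
  by (simp add: sampler_def character_def cis_conv_exp inner_prod_def algebra_simps)

text \<open>The square fits into the period box with corner \<open>- T1\<close> up to a null set. A
  function supported in the square does not notice which of the two cut-offs is used, so its samples
  are its coefficients over the period box.\<close>

lemma Parseval_sampler:
  assumes f: "f \<in> L2_on ({-T1..T2} \<times> {-T1..T2})"
    and "0 < T1" "0 < T2" "0 < \<epsilon>" "\<epsilon> \<le> 1 / (T1 + T2)" "e > 0"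
  shows "\<exists>F. finite F \<and> L2.Q f - e \<le> (\<Sum>l\<in>F. (cmod (L2_inner f (sampler T1 T2 \<epsilon> l)))\<^sup>2)"
proof -
  have fL2: "f \<in> L2" and f0: "AE x in lborel. x \<notin> {-T1..T2} \<times> {-T1..T2} \<longrightarrow> f x = 0"
    using f by (auto simp: L2_on_def)
  have T2: "T2 \<le> - T1 + 1 / \<epsilon>" using assms(2-5) by (simp add: field_simps)
  have supp: "AE x in lborel. x \<notin> period_box \<epsilon> (-T1) \<longrightarrow> f x = 0"
    using f0 AE_coordinates_neq[of T2]
    by eventually_elim (use T2 in \<open>auto simp: period_box_def\<close>)
  have "L2_inner f (sampler T1 T2 \<epsilon> l) = L2_inner f (box_character \<epsilon> (-T1) l)" for l
    unfolding L2_inner_def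
  proof (rule integral_cong_AE)
    have [measurable]: "f \<in> borel_measurable borel" using fL2 by (rule L2D)
    have [measurable]: "{-T1..T2} \<times> {-T1..T2} \<in> sets (borel :: (real \<times> real) measure)"
      by (intro borel_closed closed_Times) auto
    show "(\<lambda>x. f x * cnj (sampler T1 T2 \<epsilon> l x)) \<in> borel_measurable lborel"
      unfolding sampler_eq by measurable
    show "(\<lambda>x. f x * cnj (box_character \<epsilon> (-T1) l x)) \<in> borel_measurable lborel"
      unfolding box_character_def by measurable
    show "AE x in lborel. f x * cnj (sampler T1 T2 \<epsilon> l x) = f x * cnj (box_character \<epsilon> (-T1) l x)"
      using f0 supp by eventually_elim (auto simp: sampler_eq box_character_def split: split_indicator)
  qed
  then show ?thesis using Parseval_box[OF fL2 supp assms(4,6)] by simp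
qed

section \<open>Affine changes of variables\<close>

text \<open>For an affine bijection, \<open>c\<close> is the reciprocal of the absolute
  determinant.\<close>

definition scales_measure :: "(real \<times> real \<Rightarrow> real \<times> real) \<Rightarrow> real \<Rightarrow> bool" where
  "scales_measure T c \<longleftrightarrow> T \<in> borel_measurable borel \<and> c > 0 \<and>
     distr lborel borel T = density lborel (\<lambda>_. ennreal c)"

lemma scales_measureD [measurable_dest]: "scales_measure T c \<Longrightarrow> T \<in> borel_measurable borel"
  by (simp add: scales_measure_def)

lemma scales_integral:
  fixes g :: "real \<times> real \<Rightarrow> 'b::{banach, second_countable_topology}"
  assumes T: "scales_measure T c" and g: "g \<in> borel_measurable borel"
  shows "(LINT x|lborel. g (T x)) = c *\<^sub>R (LINT x|lborel. g x)"
proof -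
  have "(LINT x|lborel. g (T x)) = (LINT x|distr lborel borel T. g x)"
    using T g by (subst integral_distr) (auto simp: scales_measure_def)
  also have "\<dots> = (LINT x|density lborel (\<lambda>_. ennreal c). g x)"
    using T by (simp add: scales_measure_def)
  also have "\<dots> = (LINT x|lborel. c *\<^sub>R g x)"
    using T g by (subst integral_density) (auto simp: scales_measure_def)
  finally show ?thesis by simp
qed

lemma scales_integrable:
  fixes g :: "real \<times> real \<Rightarrow> 'b::{banach, second_countable_topology}"
  assumes T: "scales_measure T c" and g: "integrable lborel g"
  shows "integrable lborel (\<lambda>x. g (T x))"
proof -
  have "integrable (density lborel (\<lambda>_. ennreal c)) g"
    using T g by (subst integrable_density) (auto simp: scales_measure_def)
  then have "integrable (distr lborel borel T) g" using T by (simp add: scales_measure_def)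
  then show ?thesis using T g by (subst (asm) integrable_distr_eq) (auto simp: scales_measure_def)
qed

lemma scales_AE:
  assumes T: "scales_measure T c" and P: "{x. P x} \<in> sets borel"
  shows "(AE x in lborel. P (T x)) \<longleftrightarrow> (AE x in lborel. P x)"
proof -
  have "(AE x in lborel. P (T x)) \<longleftrightarrow> (AE x in distr lborel borel T. P x)"
    using T P by (subst AE_distr_iff) (auto simp: scales_measure_def)
  also have "distr lborel borel T = density lborel (\<lambda>_. ennreal c)"
    using T by (simp add: scales_measure_def)
  also have "(AE x in density lborel (\<lambda>_. ennreal c). P x) \<longleftrightarrow> (AE x in lborel. P x)"
    using T by (subst AE_density) (auto simp: scales_measure_def)
  finally show ?thesis .
qed

lemma scales_L2:
  assumes T: "scales_measure T c" and f: "f \<in> L2"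
  shows "(\<lambda>x. f (T x)) \<in> L2"
proof -
  have "f \<in> borel_measurable borel" using f by (rule L2D)
  moreover have "T \<in> borel_measurable borel" using T by (rule scales_measureD)
  ultimately have "(\<lambda>x. f (T x)) \<in> borel_measurable borel" by measurable
  then show ?thesis using scales_integrable[OF T L2D(2)[OF f]] by (simp add: L2_def)
qed

text \<open>A homeomorphism that preserves null sets in both directions matches the open sets on
  which the two functions vanish almost everywhere.\<close>

lemma ess_supp_compose:
  assumes T: "scales_measure T c" and cont: "continuous_on UNIV T" "continuous_on UNIV S"
    and inv: "\<And>x. S (T x) = x" "\<And>x. T (S x) = x" and f: "f \<in> borel_measurable borel" and a: "a \<noteq> 0"
  shows "ess_supp (\<lambda>x. a * f (T x)) = T -` ess_supp f"
proof -
  have "x \<notin> ess_supp (\<lambda>x. a * f (T x)) \<longleftrightarrow> T x \<notin> ess_supp f" for x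
  proof -
    have AE: "(AE x in lborel. T x \<in> U \<longrightarrow> a * f (T x) = 0) \<longleftrightarrow> (AE x in lborel. x \<in> U \<longrightarrow> f x = 0)"
      if U: "open U" for U
    proof -
      have "{x. x \<in> U \<longrightarrow> f x = 0} = - U \<union> f -` {0}" by auto
      moreover have "f -` {0} \<in> sets borel" using measurable_sets[OF f, of "{0}"] by simp
      ultimately have "{x. x \<in> U \<longrightarrow> f x = 0} \<in> sets borel" using U by auto
      from scales_AE[OF T this] show ?thesis using a by simp
    qed
    show ?thesis
    proof
      assume "x \<notin> ess_supp (\<lambda>x. a * f (T x))"
      then obtain V where V: "open V" "x \<in> V" "AE x in lborel. x \<in> V \<longrightarrow> a * f (T x) = 0"
        unfolding ess_supp_def by auto
      have "open (S -` V)" using open_vimage[OF V(1) cont(2)] .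
      moreover have "T x \<in> S -` V" using V inv by simp
      moreover have "AE x in lborel. x \<in> S -` V \<longrightarrow> f x = 0"
        using AE[OF calculation(1)] V(3) inv by simp
      ultimately show "T x \<notin> ess_supp f" unfolding ess_supp_def by blast
    next
      assume "T x \<notin> ess_supp f"
      then obtain U where U: "open U" "T x \<in> U" "AE x in lborel. x \<in> U \<longrightarrow> f x = 0"
        unfolding ess_supp_def by auto
      have "open (T -` U)" using open_vimage[OF U(1) cont(1)] .
      moreover have "AE x in lborel. x \<in> T -` U \<longrightarrow> a * f (T x) = 0"
        using AE[OF U(1)] U(3) by simp
      ultimately show "x \<notin> ess_supp (\<lambda>x. a * f (T x))"
        using U(2) unfolding ess_supp_def by blast
    qed
  qed
  then show ?thesis by blast
qed

text \<open>Common form of the arguments of \<phi> and \<psi> in the system: a shear after a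
  dilation, then the translation by \<open>- s\<close>. The members built from
  \<open>\<psi>'\<close> reduce to it by exchanging the coordinates.\<close>

definition triangular :: "real \<Rightarrow> real \<Rightarrow> real \<Rightarrow> real \<times> real \<Rightarrow> real \<times> real \<Rightarrow> real \<times> real" where
  "triangular b1 b2 k s x = (b1 * fst x + k * snd x - fst s, b2 * snd x - snd s)"

lemma continuous_triangular: "continuous_on UNIV (triangular b1 b2 k s)"
  unfolding triangular_def by (intro continuous_intros)

text \<open>With the first coordinate integrated first, the shear is only a translation for each
  fixed second coordinate, which Lebesgue measure ignores; the determinant is
  \<open>b1 * b2\<close>.\<close>

lemma triangular_scales:
  assumes b: "b1 > 0" "b2 > 0"
  shows "scales_measure (triangular b1 b2 k s) (1 / (b1 * b2))"
  unfolding scales_measure_def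
proof (intro conjI)
  let ?T = "triangular b1 b2 k s"
  show T: "?T \<in> borel_measurable borel"
    by (intro borel_measurable_continuous_onI continuous_triangular)
  show "1 / (b1 * b2) > 0" using b by simp
  show "distr lborel borel ?T = density lborel (\<lambda>_. ennreal (1 / (b1 * b2)))"
  proof (rule measure_eqI)
    fix A assume "A \<in> sets (distr lborel borel ?T)"
    then have A: "A \<in> sets borel" by simp
    define g where "g = (\<lambda>x. indicator A x :: ennreal)"
    have [measurable]: "g \<in> borel_measurable (borel \<Otimes>\<^sub>M borel)" unfolding g_def borel_prod using A by simp
    have gT: "(\<lambda>x. g (?T x)) \<in> borel_measurable borel"
      using T A unfolding g_def by measurable
    have "emeasure (distr lborel borel ?T) A = (\<integral>\<^sup>+x. g x \<partial>distr lborel borel ?T)"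
      using A by (simp add: g_def)
    also have "\<dots> = (\<integral>\<^sup>+x. g (?T x) \<partial>lborel)"
      using T A by (intro nn_integral_distr) (auto simp: g_def)
    also have "\<dots> = (\<integral>\<^sup>+y. \<integral>\<^sup>+x. g (?T (x, y)) \<partial>lborel \<partial>lborel)"
      using gT by (subst lborel_prod[symmetric], subst lborel_pair.nn_integral_snd) (auto simp: lborel_prod)
    also have "\<dots> = (\<integral>\<^sup>+y. ennreal (1 / b1) * (\<integral>\<^sup>+x. g (x, b2 * y - snd s) \<partial>lborel) \<partial>lborel)"
    proof (intro nn_integral_cong)
      fix y :: real
      have "(\<integral>\<^sup>+x. g (x, b2 * y - snd s) \<partial>lborel) =
          ennreal b1 * (\<integral>\<^sup>+x. g ((k * y - fst s) + b1 * x, b2 * y - snd s) \<partial>lborel)"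
        using b by (subst nn_integral_real_affine[of _ b1 "k * y - fst s"]) auto
      also have "(\<lambda>x. g ((k * y - fst s) + b1 * x, b2 * y - snd s)) = (\<lambda>x. g (?T (x, y)))"
        by (simp add: triangular_def algebra_simps)
      finally show "(\<integral>\<^sup>+x. g (?T (x, y)) \<partial>lborel) = ennreal (1 / b1) * (\<integral>\<^sup>+x. g (x, b2 * y - snd s) \<partial>lborel)"
        using b by (simp add: mult.assoc[symmetric] flip: ennreal_mult')
    qed
    also have "\<dots> = ennreal (1 / b1) * (\<integral>\<^sup>+y. (\<integral>\<^sup>+x. g (x, b2 * y - snd s) \<partial>lborel) \<partial>lborel)"
      by (intro nn_integral_cmult) simp
    also have "(\<integral>\<^sup>+y. (\<integral>\<^sup>+x. g (x, b2 * y - snd s) \<partial>lborel) \<partial>lborel) =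
        ennreal (1 / b2) * (\<integral>\<^sup>+y. (\<integral>\<^sup>+x. g (x, y) \<partial>lborel) \<partial>lborel)"
    proof -
      have "(\<integral>\<^sup>+y. (\<integral>\<^sup>+x. g (x, y) \<partial>lborel) \<partial>lborel) =
          ennreal b2 * (\<integral>\<^sup>+y. (\<integral>\<^sup>+x. g (x, - snd s + b2 * y) \<partial>lborel) \<partial>lborel)"
        using b by (subst nn_integral_real_affine[of _ b2 "- snd s"]) auto
      then show ?thesis
        using b by (simp add: mult.assoc[symmetric] algebra_simps flip: ennreal_mult')
    qed
    also have "(\<integral>\<^sup>+y. (\<integral>\<^sup>+x. g (x, y) \<partial>lborel) \<partial>lborel) = (\<integral>\<^sup>+x. g x \<partial>lborel)"
      unfolding lborel_prod[symmetric]
      by (subst lborel_pair.nn_integral_snd) (auto simp: borel_prod)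
    also have "ennreal (1 / b1) * (ennreal (1 / b2) * (\<integral>\<^sup>+x. g x \<partial>lborel)) =
        ennreal (1 / (b1 * b2)) * emeasure lborel A"
      using b A by (simp add: g_def mult.assoc[symmetric] flip: ennreal_mult')
    also have "\<dots> = emeasure (density lborel (\<lambda>_. ennreal (1 / (b1 * b2)))) A"
      using A by (subst emeasure_density) (auto simp: nn_integral_cmult)
    finally show "emeasure (distr lborel borel ?T) A = emeasure (density lborel (\<lambda>_. ennreal (1 / (b1 * b2)))) A" .
  qed simp
qed

lemma swap_scales: "scales_measure prod.swap 1"
proof -
  have m: "prod.swap \<in> borel_measurable (borel :: (real \<times> real) measure)"
    by (intro borel_measurable_continuous_onI) (auto simp: prod.swap_def intro!: continuous_intros)
  have "distr lborel borel prod.swap = distr lborel (lborel :: (real \<times> real) measure) (\<lambda>(x, y). (y, x))"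
    by (intro distr_cong) auto
  also have "\<dots> = lborel"
    using lborel_pair.distr_pair_swap[where ?'a = real and ?'b = real] by (simp only: lborel_prod)
  finally have "distr lborel borel prod.swap = (lborel :: (real \<times> real) measure)" .
  then show ?thesis using m by (simp add: scales_measure_def density_1)
qed

lemma ess_supp_triangular:
  assumes b: "b1 > 0" "b2 > 0" and f: "f \<in> borel_measurable borel" and a: "a \<noteq> 0"
  shows "ess_supp (\<lambda>x. a * f (triangular b1 b2 k s x)) = triangular b1 b2 k s -` ess_supp f"
proof (rule ess_supp_compose[OF triangular_scales[OF b] continuous_triangular _ _ _ f a])
  define S where "S = (\<lambda>y. ((fst y + fst s - k * (snd y + snd s) / b2) / b1, (snd y + snd s) / b2))"
  show "continuous_on UNIV S" unfolding S_def using b by (intro continuous_intros) auto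
  show "S (triangular b1 b2 k s x) = x" for x
    using b by (simp add: S_def triangular_def prod_eq_iff)
  show "triangular b1 b2 k s (S x) = x" for x
    using b by (simp add: S_def triangular_def prod_eq_iff)
qed

lemma ess_supp_swap:
  assumes "f \<in> borel_measurable borel"
  shows "ess_supp (\<lambda>x. f (prod.swap x)) = prod.swap -` ess_supp f"
  using ess_supp_compose[OF swap_scales _ _ _ _ assms, of prod.swap 1]
  by (simp add: prod.swap_def continuous_on_Pair continuous_on_fst continuous_on_snd)

text \<open>The frequency transforms by the inverse transpose of the linear part. The translation
  contributes only a phase, which the modulus removes.\<close>

lemma norm_fourier_triangular:
  assumes b: "b1 > 0" "b2 > 0" and f: "f \<in> borel_measurable borel"
  shows "cmod (fourier (\<lambda>x. a * f (triangular b1 b2 k s x)) \<xi>) =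
    cmod a / (b1 * b2) * cmod (fourier f (fst \<xi> / b1, (snd \<xi> - k * fst \<xi> / b1) / b2))"
proof -
  define \<eta> where "\<eta> = (fst \<xi> / b1, (snd \<xi> - k * fst \<xi> / b1) / b2)"
  let ?T = "triangular b1 b2 k s"
  define G where "G = (\<lambda>y. (a * cis (- (2 * pi * (s \<bullet> \<eta>)))) * (f y * exp (- 2 * pi * \<i> * complex_of_real (y \<bullet> \<eta>))))"
  have [measurable]: "f \<in> borel_measurable borel" by fact
  have G: "G \<in> borel_measurable borel" unfolding G_def by measurable
  have ip: "x \<bullet> \<xi> = ?T x \<bullet> \<eta> + s \<bullet> \<eta>" for x
    using b by (simp add: triangular_def \<eta>_def inner_prod_def field_simps)
  have "a * f (?T x) * exp (- 2 * pi * \<i> * complex_of_real (x \<bullet> \<xi>)) = G (?T x)" for x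
    unfolding G_def ip cis_conv_exp by (simp add: algebra_simps exp_add[symmetric] flip: exp_add exp_minus)
  then have "fourier (\<lambda>x. a * f (?T x)) \<xi> = (1 / (b1 * b2)) *\<^sub>R (LINT y|lborel. G y)"
    unfolding fourier_def using scales_integral[OF triangular_scales[OF b] G] by simp
  also have "(LINT y|lborel. G y) = (a * cis (- (2 * pi * (s \<bullet> \<eta>)))) * fourier f \<eta>"
    unfolding G_def fourier_def by (rule integral_mult_right_zero)
  finally show ?thesis using b by (simp add: norm_mult \<eta>_def)
qed

lemma fourier_swap:
  assumes "f \<in> borel_measurable borel"
  shows "fourier (\<lambda>x. f (prod.swap x)) \<xi> = fourier f (prod.swap \<xi>)"
proof -
  have [measurable]: "f \<in> borel_measurable borel" by fact
  have "(\<lambda>y. f y * exp (- 2 * pi * \<i> * complex_of_real (y \<bullet> prod.swap \<xi>))) \<in> borel_measurable borel"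
    by measurable
  from scales_integral[OF swap_scales this] show ?thesis
    unfolding fourier_def by (simp add: inner_prod_def prod.swap_def add.commute)
qed

section \<open>Tails of sheared lattice sums\<close>

text \<open>Mean value theorem for \<open>u powr (1 - p)\<close>. The intermediate point is below
  \<open>u + h \<le> 2 * u\<close>, and \<open>2 powr p\<close> pays for moving it back to
  \<open>u\<close>.\<close>

lemma powr_step:
  fixes u h p :: real
  assumes "p > 1" "u \<ge> 1" "0 < h" "h \<le> 1"
  shows "h * u powr (- p) \<le> 2 powr p / (p - 1) * (u powr (1 - p) - (u + h) powr (1 - p))"
proof -
  have "\<exists>z>u. z < u + h \<and> (u + h) powr (1 - p) - u powr (1 - p) =
      (u + h - u) * ((1 - p) * z powr (1 - p - 1))"
    using assms by (intro MVT2 has_real_derivative_powr) auto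
  then obtain z where z: "u < z" "z < u + h"
    "(u + h) powr (1 - p) - u powr (1 - p) = h * ((1 - p) * z powr (- p))" by auto
  have "2 powr (- p) * u powr (- p) = (2 * u) powr (- p)"
    using assms by (simp add: powr_mult)
  also have "\<dots> \<le> z powr (- p)" using z assms by (intro powr_mono2') auto
  finally have "u powr (- p) \<le> 2 powr p * z powr (- p)"
    using assms by (simp add: powr_minus field_simps)
  then have "h * (u powr (- p)) \<le> h * (2 powr p * z powr (- p))"
    using assms by (intro mult_left_mono) auto
  also have "\<dots> = 2 powr p / (p - 1) * (h * ((p - 1) * z powr (- p)))"
    using assms by (simp add: field_simps)
  also have "h * ((p - 1) * z powr (- p)) = u powr (1 - p) - (u + h) powr (1 - p)"
    using z(3) by (simp add: algebra_simps)
  finally show ?thesis .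
qed

definition decay :: "real \<Rightarrow> real \<Rightarrow> real" where
  "decay p y = (1 + \<bar>y\<bar>) powr (- p)"

lemma decay_nonneg [simp]: "0 \<le> decay p y"
  by (simp add: decay_def)

lemma decay_antimono: "p \<ge> 0 \<Longrightarrow> \<bar>x\<bar> \<le> \<bar>y\<bar> \<Longrightarrow> decay p y \<le> decay p x"
  unfolding decay_def by (intro powr_mono2') auto

definition decay_const :: "real \<Rightarrow> real" where
  "decay_const p = 2 powr p / (p - 1)"

text \<open>The weight \<open>h\<close> makes the left side a Riemann sum of an integrable function,
  whence a bound independent of the mesh and of the offset \<open>t\<close>. By
  \<open>powr_step\<close> the sum over consecutive points is dominated by a telescoping
  one.\<close>

lemma sum_decay_one_sided:
  fixes h t Y p :: real and F :: "int set"
  assumes p: "p > 1" and h: "0 < h" "h \<le> 1" and Y: "0 \<le> Y"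
    and F: "finite F" "\<And>n. n \<in> F \<Longrightarrow> Y \<le> h * of_int n - t"
  shows "(\<Sum>n\<in>F. h * decay p (h * of_int n - t)) \<le> decay_const p * (1 + Y) powr (1 - p)"
proof -
  define n0 where "n0 = \<lceil>(Y + t) / h\<rceil>"
  have "(Y + t) / h \<le> of_int n0" unfolding n0_def by (rule le_of_int_ceiling)
  then have "Y + t \<le> of_int n0 * h" using h by (simp only: pos_divide_le_eq)
  then have n0: "Y \<le> h * of_int n0 - t" by (simp add: mult.commute)
  have low: "n0 \<le> n" if "n \<in> F" for n
    using F(2)[OF that] h unfolding n0_def by (intro ceiling_le) (simp add: field_simps)
  \<comment> \<open>Number of consecutive points needed to cover \<open>F\<close>; \<open>n0\<close>
    is inserted so that the maximum exists for empty \<open>F\<close>.\<close>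
  define K where "K = nat (Max (insert n0 F) - n0 + 1)"
  define q where "q = (\<lambda>i::nat. (1 + (h * (of_int n0 + real i) - t)) powr (1 - p))"
  have sub: "F \<subseteq> (\<lambda>i. n0 + int i) ` {..<K}"
  proof
    fix n assume n: "n \<in> F"
    have "n \<le> Max (insert n0 F)" using F(1) n by (intro Max_ge) auto
    then show "n \<in> (\<lambda>i. n0 + int i) ` {..<K}"
      using low[OF n] by (intro image_eqI[of _ _ "nat (n - n0)"]) (auto simp: K_def)
  qed
  have "(\<Sum>n\<in>F. h * decay p (h * of_int n - t)) \<le>
      (\<Sum>n\<in>(\<lambda>i. n0 + int i) ` {..<K}. h * decay p (h * of_int n - t))"
    using sub h by (intro sum_mono2) auto
  also have "\<dots> = (\<Sum>i<K. h * decay p (h * (of_int n0 + real i) - t))"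
    by (subst sum.reindex) (auto simp: inj_on_def)
  also have "\<dots> \<le> (\<Sum>i<K. decay_const p * (q i - q (Suc i)))"
  proof (intro sum_mono)
    fix i
    define u where "u = 1 + (h * (of_int n0 + real i) - t)"
    have "h * real i \<ge> 0" using h by simp
    then have u: "u \<ge> 1" using n0 Y by (simp add: u_def algebra_simps)
    have "h * decay p (h * (of_int n0 + real i) - t) = h * u powr (- p)"
      using u by (simp add: decay_def u_def)
    also have "\<dots> \<le> decay_const p * (u powr (1 - p) - (u + h) powr (1 - p))"
      unfolding decay_const_def by (rule powr_step[OF p u h])
    also have "u powr (1 - p) - (u + h) powr (1 - p) = q i - q (Suc i)"
      by (simp add: q_def u_def algebra_simps)
    finally show "h * decay p (h * (of_int n0 + real i) - t) \<le> decay_const p * (q i - q (Suc i))" .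
  qed
  also have "\<dots> = decay_const p * (q 0 - q K)"
    by (simp add: sum_lessThan_telescope' flip: sum_distrib_left)
  also have "\<dots> \<le> decay_const p * (1 + Y) powr (1 - p)"
  proof (intro mult_left_mono)
    have "q 0 \<le> (1 + Y) powr (1 - p)"
      unfolding q_def using n0 Y p by (intro powr_mono2') auto
    moreover have "q K \<ge> 0" by (simp add: q_def)
    ultimately show "q 0 - q K \<le> (1 + Y) powr (1 - p)" by simp
  qed (use p in \<open>simp add: decay_const_def\<close>)
  finally show ?thesis .
qed

lemma sum_decay_two_sided:
  fixes h t Y p :: real and F :: "int set"
  assumes p: "p > 1" and h: "0 < h" "h \<le> 1" and Y: "0 \<le> Y"
    and F: "finite F" "\<And>n. n \<in> F \<Longrightarrow> Y \<le> \<bar>h * of_int n - t\<bar>"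
  shows "(\<Sum>n\<in>F. h * decay p (h * of_int n - t)) \<le> 2 * decay_const p * (1 + Y) powr (1 - p)"
proof -
  define P where "P = {n \<in> F. h * of_int n - t \<ge> 0}"
  define N where "N = {n \<in> F. h * of_int n - t < 0}"
  have fin: "finite P" "finite N" using F by (auto simp: P_def N_def)
  have PN: "F = P \<union> N" "P \<inter> N = {}" by (auto simp: P_def N_def)
  have "(\<Sum>n\<in>P. h * decay p (h * of_int n - t)) \<le> decay_const p * (1 + Y) powr (1 - p)"
  proof (intro sum_decay_one_sided[OF p h Y] fin)
    show "Y \<le> h * of_int n - t" if "n \<in> P" for n using F(2)[of n] that by (simp add: P_def)
  qed
  moreover have "(\<Sum>n\<in>N. h * decay p (h * of_int n - t)) \<le> decay_const p * (1 + Y) powr (1 - p)"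
  proof -
    have "(\<Sum>n\<in>N. h * decay p (h * of_int n - t)) = (\<Sum>n\<in>uminus ` N. h * decay p (h * of_int n - (- t)))"
      by (subst sum.reindex) (auto simp: inj_on_def decay_def abs_minus_commute intro!: sum.cong)
    also have "\<dots> \<le> decay_const p * (1 + Y) powr (1 - p)"
    proof (intro sum_decay_one_sided[OF p h Y])
      fix n assume "n \<in> uminus ` N"
      then have "- n \<in> N" by auto
      then show "Y \<le> h * of_int n - (- t)" using F(2)[of "- n"] by (simp add: N_def)
    qed (use fin in auto)
    finally show ?thesis .
  qed
  ultimately show ?thesis
    unfolding PN(1) using fin PN(2) by (subst sum.union_disjoint) auto
qed

lemma decay_const_nonneg: "p > 1 \<Longrightarrow> decay_const p \<ge> 0"
  by (simp add: decay_const_def)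

text \<open>Off the box, either the first coordinate of the sheared frequency is at least
  \<open>h1 * M / 2\<close>, or the shear moves the second one by at most half of its size.\<close>

lemma sum_decay_off_box:
  fixes h1 h2 \<kappa> p :: real and M :: nat and F :: "(int \<times> int) set"
  assumes p: "p > 1" and h: "0 < h1" "h1 \<le> h2" "h2 \<le> 1" and \<kappa>: "\<bar>\<kappa>\<bar> * h1 \<le> h2"
    and F: "finite F" "F \<inter> {- int M..int M} \<times> {- int M..int M} = {}"
  shows "(\<Sum>l\<in>F. (h1 * h2) * (decay p (h1 * of_int (fst l)) *
            decay p (h2 * of_int (snd l) - \<kappa> * (h1 * of_int (fst l)))))
         \<le> 12 * (decay_const p)\<^sup>2 * (1 + h1 * M / 2) powr (1 - p)"
proof -
  define D where "D = decay_const p"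
  define Y where "Y = h1 * M / 2"
  have D: "D \<ge> 0" using p by (simp add: D_def decay_const_nonneg)
  have Y: "Y \<ge> 0" using h by (simp add: Y_def)
  define W where "W = (1 + Y) powr (1 - p)"
  have W: "W \<ge> 0" by (simp add: W_def)
  define f where "f = (\<lambda>m n. (h1 * decay p (h1 * of_int m)) * (h2 * decay p (h2 * of_int n - \<kappa> * (h1 * of_int m))))"
  have f0: "f m n \<ge> 0" for m n using h by (simp add: f_def)
  define F1 where "F1 = fst ` F"
  define F2 where "F2 = snd ` F"
  have fin: "finite F1" "finite F2" using F by (auto simp: F1_def F2_def)
  define A where "A = {m \<in> F1. Y \<le> \<bar>h1 * of_int m\<bar>}"
  define B where "B = {n \<in> F2. Y \<le> \<bar>h2 / 2 * of_int n\<bar>}"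
  define A' where "A' = {m \<in> F1. \<bar>h1 * of_int m\<bar> < Y}"
  have finAB: "finite A" "finite A'" "finite B" using fin by (auto simp: A_def B_def A'_def)
  have low: "h2 * \<bar>of_int n\<bar> / 2 \<le> \<bar>h2 * of_int n - \<kappa> * (h1 * of_int m)\<bar> \<and> n \<in> B"
    if mn: "(m, n) \<in> F" and m: "\<bar>h1 * of_int m\<bar> < Y" for m n
  proof -
    have "h1 * \<bar>real_of_int m\<bar> < h1 * (real M / 2)" using m h by (simp add: Y_def abs_mult)
    then have m2: "\<bar>real_of_int m\<bar> < real M / 2" using h by simp
    have m3: "m \<in> {- int M..int M}" using m2 by (simp add: abs_le_iff) linarith
    then have "n \<notin> {- int M..int M}" using mn F(2) by blast
    then have "int M < \<bar>n\<bar>" by auto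
    then have n: "real M < \<bar>real_of_int n\<bar>" by linarith
    have "\<bar>\<kappa> * (h1 * of_int m)\<bar> = (\<bar>\<kappa>\<bar> * h1) * \<bar>real_of_int m\<bar>" using h by (simp add: abs_mult)
    also have "\<dots> \<le> h2 * (\<bar>of_int n\<bar> / 2)" using \<kappa> m2 n h by (intro mult_mono) auto
    finally have "\<bar>\<kappa> * (h1 * of_int m)\<bar> \<le> h2 * \<bar>of_int n\<bar> / 2" by simp
    moreover have "\<bar>h2 * of_int n\<bar> = h2 * \<bar>real_of_int n\<bar>" using h by (simp add: abs_mult)
    ultimately have "h2 * \<bar>of_int n\<bar> / 2 \<le> \<bar>h2 * of_int n - \<kappa> * (h1 * of_int m)\<bar>" by linarith
    moreover have "Y \<le> \<bar>h2 / 2 * of_int n\<bar>"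
    proof -
      have "h1 * real M \<le> h2 * \<bar>real_of_int n\<bar>" using h n by (intro mult_mono) auto
      then show ?thesis using h by (simp add: Y_def abs_mult)
    qed
    moreover have "n \<in> F2" using mn by (force simp: F2_def)
    ultimately show ?thesis by (auto simp: B_def)
  qed
  \<comment> \<open>Halving the frequency decouples the second factor from \<open>m\<close>. The sum
    over \<open>n\<close> then has mesh \<open>h2 / 2\<close>, so its weight is written as
    \<open>2 * (h2 / 2)\<close>.\<close>
  define g where "g = (\<lambda>m n. (h1 * decay p (h1 * of_int m)) * (2 * (h2 / 2 * decay p (h2 / 2 * of_int n - 0))))"
  have g0: "g m n \<ge> 0" for m n using h by (simp add: g_def)
  have fg: "f m n \<le> g m n" if "(m, n) \<in> F" "\<bar>h1 * of_int m\<bar> < Y" for m n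
  proof -
    have "decay p (h2 * of_int n - \<kappa> * (h1 * of_int m)) \<le> decay p (h2 / 2 * of_int n - 0)"
      using low[OF that] p h by (intro decay_antimono) (auto simp: abs_mult)
    then show ?thesis unfolding f_def g_def using h by (intro mult_left_mono) auto
  qed
  have "(\<Sum>l\<in>F. (h1 * h2) * (decay p (h1 * of_int (fst l)) *
            decay p (h2 * of_int (snd l) - \<kappa> * (h1 * of_int (fst l))))) = (\<Sum>(m, n)\<in>F. f m n)"
    by (intro sum.cong) (auto simp: f_def)
  also have "\<dots> \<le> (\<Sum>(m, n)\<in>A \<times> F2. f m n) + (\<Sum>(m, n)\<in>A' \<times> B. g m n)"
  proof -
    have "(\<Sum>(m, n)\<in>F. f m n) = (\<Sum>(m, n)\<in>F \<inter> A \<times> UNIV. f m n) + (\<Sum>(m, n)\<in>F \<inter> A' \<times> UNIV. f m n)"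
    proof -
      have "l \<in> A \<times> UNIV \<longleftrightarrow> l \<notin> A' \<times> UNIV" if "l \<in> F" for l
      proof -
        have "fst l \<in> F1" using that by (simp add: F1_def)
        then show ?thesis by (cases l) (auto simp: A_def A'_def)
      qed
      then have "F = F \<inter> A \<times> UNIV \<union> F \<inter> A' \<times> UNIV" "F \<inter> A \<times> UNIV \<inter> (F \<inter> A' \<times> UNIV) = {}"
        by blast+
      then show ?thesis using F(1) by (metis finite_Int sum.union_disjoint)
    qed
    also have "(\<Sum>(m, n)\<in>F \<inter> A \<times> UNIV. f m n) \<le> (\<Sum>(m, n)\<in>A \<times> F2. f m n)"
      using finAB fin f0 by (intro sum_mono2) (auto simp: F2_def intro: rev_image_eqI)
    also have "(\<Sum>(m, n)\<in>F \<inter> A' \<times> UNIV. f m n) \<le> (\<Sum>(m, n)\<in>F \<inter> A' \<times> UNIV. g m n)"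
      using fg by (intro sum_mono) (auto simp: A'_def)
    also have "\<dots> \<le> (\<Sum>(m, n)\<in>A' \<times> B. g m n)"
      using finAB fin g0 low by (intro sum_mono2) (auto simp: A'_def)
    finally show ?thesis by simp
  qed
  \<comment> \<open>Here the decay comes from the first coordinate; the inner sum is bounded
    uniformly in its offset.\<close>
  also have "(\<Sum>(m, n)\<in>A \<times> F2. f m n) \<le> (2 * D * W) * (2 * D)"
  proof -
    have "(\<Sum>(m, n)\<in>A \<times> F2. f m n) = (\<Sum>m\<in>A. (h1 * decay p (h1 * of_int m)) *
        (\<Sum>n\<in>F2. h2 * decay p (h2 * of_int n - \<kappa> * (h1 * of_int m))))"
      by (simp add: sum.cartesian_product[symmetric] f_def sum_distrib_left)
    also have "\<dots> \<le> (\<Sum>m\<in>A. (h1 * decay p (h1 * of_int m - 0)) * (2 * D))"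
    proof (intro sum_mono)
      fix m
      have "(\<Sum>n\<in>F2. h2 * decay p (h2 * of_int n - \<kappa> * (h1 * of_int m))) \<le> 2 * decay_const p * (1 + 0) powr (1 - p)"
        using h fin by (intro sum_decay_two_sided p) auto
      then show "(h1 * decay p (h1 * of_int m)) *
        (\<Sum>n\<in>F2. h2 * decay p (h2 * of_int n - \<kappa> * (h1 * of_int m))) \<le> (h1 * decay p (h1 * of_int m - 0)) * (2 * D)"
        using h by (simp add: D_def mult_left_mono)
    qed
    also have "\<dots> = (\<Sum>m\<in>A. h1 * decay p (h1 * of_int m - 0)) * (2 * D)"
      by (simp add: sum_distrib_right)
    also have "\<dots> \<le> (2 * decay_const p * (1 + Y) powr (1 - p)) * (2 * D)"
      using D h Y finAB by (intro mult_right_mono sum_decay_two_sided p) (auto simp: A_def)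
    finally show ?thesis by (simp add: D_def W_def)
  qed
  \<comment> \<open>Here the decay comes from the second coordinate. The two products, 4 and 8 times
    \<open>D\<^sup>2 * W\<close>, account for the constant 12.\<close>
  also have "(\<Sum>(m, n)\<in>A' \<times> B. g m n) \<le> (2 * D) * (2 * (2 * D * W))"
  proof -
    have "(\<Sum>(m, n)\<in>A' \<times> B. g m n) = (\<Sum>m\<in>A'. h1 * decay p (h1 * of_int m - 0)) *
        (2 * (\<Sum>n\<in>B. h2 / 2 * decay p (h2 / 2 * of_int n - 0)))"
      unfolding sum_distrib_left[of "2::real"] sum_product
      by (simp add: sum.cartesian_product[symmetric] g_def)
    also have "\<dots> \<le> (2 * decay_const p * (1 + 0) powr (1 - p)) * (2 * (2 * decay_const p * (1 + Y) powr (1 - p)))"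
      using h Y D finAB by (intro mult_mono mult_left_mono sum_decay_two_sided p sum_nonneg)
        (auto simp: B_def D_def intro!: mult_nonneg_nonneg sum_nonneg)
    finally show ?thesis by (simp add: D_def W_def)
  qed
  finally show ?thesis by (simp add: D_def W_def Y_def power2_eq_square algebra_simps)
qed

section \<open>Shearlet systems\<close>

text \<open>In the transformed variables the sampling lattice has meshes
  \<open>\<epsilon> / b1\<close> and \<open>\<epsilon> / b2\<close>, and the normalisation
  \<open>(cmod a)\<^sup>2 = b1 * b2\<close> turns \<open>\<epsilon>\<^sup>2\<close> into exactly
  their product, the weight of a Riemann sum. Squaring doubles the decay exponent to
  \<open>2 * r\<close>, and summation costs one.\<close>

lemma sum_fourier_triangular_off_box:
  fixes f :: "real \<times> real \<Rightarrow> complex" and a :: complex and M :: nat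
  assumes r: "r > 1" and f: "f \<in> borel_measurable borel"
    and bound: "\<And>\<xi>1 \<xi>2. cmod (fourier f (\<xi>1, \<xi>2)) \<le> C / ((1 + \<bar>\<xi>1\<bar>) powr r * (1 + \<bar>\<xi>2\<bar>) powr r)"
    and b: "1 \<le> b2" "b2 \<le> b1" "\<bar>k\<bar> * b2 \<le> b1" and a: "(cmod a)\<^sup>2 = b1 * b2"
    and \<epsilon>: "0 < \<epsilon>" "\<epsilon> \<le> 1"
    and F: "finite F" "F \<inter> {- int M..int M} \<times> {- int M..int M} = {}"
  shows "(\<Sum>l\<in>F. \<epsilon>\<^sup>2 * (cmod (fourier (\<lambda>x. a * f (triangular b1 b2 (k * b2) s x))
            (\<epsilon> * of_int (fst l), \<epsilon> * of_int (snd l))))\<^sup>2)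
         \<le> 12 * (C * decay_const (2 * r))\<^sup>2 * (1 + \<epsilon> * M / (2 * b1)) powr (1 - 2 * r)"
proof -
  have b0: "b1 > 0" "b2 > 0" using b by auto
  define h1 where "h1 = \<epsilon> / b1"
  define h2 where "h2 = \<epsilon> / b2"
  have h: "0 < h1" "h1 \<le> h2" "h2 \<le> 1"
  proof -
    show "0 < h1" using \<epsilon> b0 by (simp add: h1_def)
    show "h1 \<le> h2" unfolding h1_def h2_def using \<epsilon> b b0 by (intro divide_left_mono) auto
    show "h2 \<le> 1" using \<epsilon> b b0 by (simp add: h2_def divide_le_eq)
  qed
  have \<kappa>: "\<bar>k\<bar> * h1 \<le> h2"
  proof -
    have "\<epsilon> * (\<bar>k\<bar> * b2) \<le> \<epsilon> * b1" using b \<epsilon> by (intro mult_left_mono) auto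
    then show ?thesis using b0 by (simp add: h1_def h2_def field_simps)
  qed
  have pointwise: "\<epsilon>\<^sup>2 * (cmod (fourier (\<lambda>x. a * f (triangular b1 b2 (k * b2) s x))
            (\<epsilon> * of_int (fst l), \<epsilon> * of_int (snd l))))\<^sup>2 \<le>
      C\<^sup>2 * ((h1 * h2) * (decay (2 * r) (h1 * of_int (fst l)) *
            decay (2 * r) (h2 * of_int (snd l) - k * (h1 * of_int (fst l)))))" for l :: "int \<times> int"
  proof -
    define \<eta>1 where "\<eta>1 = h1 * of_int (fst l)"
    define \<eta>2 where "\<eta>2 = h2 * of_int (snd l) - k * (h1 * of_int (fst l))"
    have \<eta>: "\<epsilon> * of_int (fst l) / b1 = \<eta>1"
      "(\<epsilon> * of_int (snd l) - (k * b2) * (\<epsilon> * of_int (fst l)) / b1) / b2 = \<eta>2"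
      using b0 by (auto simp: \<eta>1_def \<eta>2_def h1_def h2_def field_simps)
    have "cmod (fourier (\<lambda>x. a * f (triangular b1 b2 (k * b2) s x))
            (\<epsilon> * of_int (fst l), \<epsilon> * of_int (snd l))) = cmod a / (b1 * b2) * cmod (fourier f (\<eta>1, \<eta>2))"
      by (simp add: norm_fourier_triangular[OF b0 f] \<eta>)
    then have "\<epsilon>\<^sup>2 * (cmod (fourier (\<lambda>x. a * f (triangular b1 b2 (k * b2) s x))
            (\<epsilon> * of_int (fst l), \<epsilon> * of_int (snd l))))\<^sup>2 =
        \<epsilon>\<^sup>2 * ((cmod a)\<^sup>2 / (b1 * b2)\<^sup>2 * (cmod (fourier f (\<eta>1, \<eta>2)))\<^sup>2)"
      by (simp only: power_mult_distrib power_divide)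
    also have "\<dots> = (h1 * h2) * (cmod (fourier f (\<eta>1, \<eta>2)))\<^sup>2"
      unfolding a using b0 by (simp add: h1_def h2_def power2_eq_square)
    also have "\<dots> \<le> (h1 * h2) * (C / ((1 + \<bar>\<eta>1\<bar>) powr r * (1 + \<bar>\<eta>2\<bar>) powr r))\<^sup>2"
      using h by (intro mult_left_mono power_mono bound) auto
    also have "(C / ((1 + \<bar>\<eta>1\<bar>) powr r * (1 + \<bar>\<eta>2\<bar>) powr r))\<^sup>2 = C\<^sup>2 * (decay (2 * r) \<eta>1 * decay (2 * r) \<eta>2)"
    proof -
      have "(u powr r)\<^sup>2 = u powr (2 * r)" for u :: real
        by (simp add: power2_eq_square powr_add[symmetric])
      then show ?thesis
        by (simp add: decay_def power_divide power_mult_distrib powr_minus_divide)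
    qed
    finally show ?thesis by (simp add: \<eta>1_def \<eta>2_def mult_ac)
  qed
  have "(\<Sum>l\<in>F. \<epsilon>\<^sup>2 * (cmod (fourier (\<lambda>x. a * f (triangular b1 b2 (k * b2) s x))
            (\<epsilon> * of_int (fst l), \<epsilon> * of_int (snd l))))\<^sup>2) \<le>
     C\<^sup>2 * (\<Sum>l\<in>F. (h1 * h2) * (decay (2 * r) (h1 * of_int (fst l)) *
            decay (2 * r) (h2 * of_int (snd l) - k * (h1 * of_int (fst l)))))"
    unfolding sum_distrib_left by (intro sum_mono pointwise)
  also have "\<dots> \<le> C\<^sup>2 * (12 * (decay_const (2 * r))\<^sup>2 * (1 + h1 * M / 2) powr (1 - 2 * r))"
    using r h \<kappa> F by (intro mult_left_mono sum_decay_off_box) auto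
  finally show ?thesis by (simp add: h1_def power_mult_distrib mult_ac)
qed

lemma card_int_abs_le:
  fixes x :: real
  assumes "x \<ge> 0"
  shows "finite {m::int. \<bar>of_int m\<bar> \<le> x}" "real (card {m::int. \<bar>of_int m\<bar> \<le> x}) \<le> 2 * x + 1"
proof -
  have eq: "{m::int. \<bar>of_int m\<bar> \<le> x} = {- \<lfloor>x\<rfloor>..\<lfloor>x\<rfloor>}"
    by (auto simp: abs_le_iff le_floor_iff minus_le_iff)
  show "finite {m::int. \<bar>of_int m\<bar> \<le> x}" unfolding eq by simp
  have "real (card {m::int. \<bar>of_int m\<bar> \<le> x}) = 2 * of_int \<lfloor>x\<rfloor> + 1"
    unfolding eq using assms by simp
  also have "\<dots> \<le> 2 * x + 1" by simp
  finally show "real (card {m::int. \<bar>of_int m\<bar> \<le> x}) \<le> 2 * x + 1" .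
qed

lemma scale_powers:
  "2 powr (real j / 2) * 2 powr (real j / 2) = 2 ^ j" "1 \<le> 2 powr (real j / 2)"
  "2 powr (real j / 2) \<le> 2 ^ j"
  by (auto simp: powr_add[symmetric] powr_realpow[symmetric] ge_one_powr_ge_zero)

lemma shears_iff: "k \<in> shears j \<longleftrightarrow> \<bar>of_int k\<bar> \<le> 2 powr (real j / 2)"
  by (simp add: shears_def)

text \<open>The cone restriction in the form in which the tail estimate and the count of
  translations use it.\<close>

lemma shears_bound: "k \<in> shears j \<Longrightarrow> \<bar>real_of_int k\<bar> * 2 powr (real j / 2) \<le> 2 ^ j"
  unfolding shears_iff scale_powers(1)[symmetric] by (intro mult_right_mono) auto

lemma finite_shears: "finite (shears j)"
  using card_int_abs_le(1)[of "2 powr (real j / 2)"] by (simp add: shears_def)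

lemma card_shears: "real (card (shears j)) \<le> 3 * 2 powr (real j / 2)"
  using card_int_abs_le(2)[of "2 powr (real j / 2)"] scale_powers(2)[of j] by (simp add: shears_def)

locale shearlet_system =
  fixes \<phi> \<psi> \<psi>' :: "real \<times> real \<Rightarrow> complex" and c1 c2 \<alpha> r :: real and a :: nat
    and v :: "shearlet_index \<Rightarrow> real \<times> real \<Rightarrow> complex"
  assumes c1: "0 < c1" and c2: "0 < c2" and adm: "admissible_generators a \<alpha> r \<phi> \<psi> \<psi>'"
    and v_def: "v = shearlet (c1, c2) \<phi> \<psi> \<psi>'"
begin

lemma r: "r > 3" and a_pos: "a > 0" and \<phi>: "\<phi> \<in> L2" and \<psi>: "\<psi> \<in> L2"
  and supp: "ess_supp \<phi> \<subseteq> square a" "ess_supp \<psi> \<subseteq> square a"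
  using adm by (auto simp: admissible_generators_def)

lemma \<psi>'_eq: "\<psi>' x = \<psi> (prod.swap x)"
  using adm by (cases x) (auto simp: admissible_generators_def)

text \<open>The factor \<open>1\<close> and the product \<open>0 * 1\<close> match the shapes
  \<open>a\<close> and \<open>k * b2\<close> in
  \<open>sum_fourier_triangular_off_box\<close>.\<close>

lemma v_Phi: "v (Phi m) = (\<lambda>x. 1 * \<phi> (triangular 1 1 (0 * 1) (c1 * of_int (fst m), c1 * of_int (snd m)) x))"
  by (cases m) (auto simp: v_def triangular_def minus_prod_def)

lemma v_Psi: "v (Psi j k m) = (\<lambda>x. of_real (2 powr (3 * real j / 4)) *
    \<psi> (triangular (2 ^ j) (2 powr (real j / 2)) (of_int k * 2 powr (real j / 2))
        (c1 * of_int (fst m), c2 * of_int (snd m)) x))"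
  by (cases m) (auto simp: v_def triangular_def minus_prod_def shear_def dil_def mult.assoc)

text \<open>Exchanging the coordinates turns the second cone into the first, so supports, tails and
  counts for \<open>Psi'\<close> are inherited from \<open>Psi\<close>.\<close>

lemma v_Psi': "v (Psi' j k m) = (\<lambda>x. v (Psi j k (prod.swap m)) (prod.swap x))"
  unfolding v_Psi
  by (cases m) (auto simp: v_def \<psi>'_eq triangular_def minus_prod_def shear'_def dil'_def mult_ac add_ac)

lemma v_L2: "v i \<in> L2"
proof -
  have Psi: "v (Psi j k m) \<in> L2" for j k m
    unfolding v_Psi by (intro L2_scale scales_L2[OF triangular_scales] \<psi>) auto
  show ?thesis
  proof (cases i)
    case (Phi m)
    then show ?thesis unfolding Phi v_Phi
      by (intro L2_scale scales_L2[OF triangular_scales] \<phi>) auto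
  next
    case (Psi' j k m)
    show ?thesis unfolding Psi' v_Psi' by (intro scales_L2[OF swap_scales] Psi)
  qed (simp add: Psi)
qed

lemma ess_supp_Phi:
  "ess_supp (v (Phi m)) = triangular 1 1 (0 * 1) (c1 * of_int (fst m), c1 * of_int (snd m)) -` ess_supp \<phi>"
  unfolding v_Phi by (intro ess_supp_triangular L2D(1)[OF \<phi>]) auto

lemma ess_supp_Psi:
  "ess_supp (v (Psi j k m)) = triangular (2 ^ j) (2 powr (real j / 2)) (of_int k * 2 powr (real j / 2))
        (c1 * of_int (fst m), c2 * of_int (snd m)) -` ess_supp \<psi>"
  unfolding v_Psi by (intro ess_supp_triangular L2D(1)[OF \<psi>]) auto

lemma meets_Psi': "meets a v (Psi' j k m) \<longleftrightarrow> meets a v (Psi j k (prod.swap m))"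
proof -
  have "ess_supp (v (Psi' j k m)) = prod.swap -` ess_supp (v (Psi j k (prod.swap m)))"
    unfolding v_Psi'[of j k m] by (intro ess_supp_swap L2D(1) v_L2)
  moreover have "prod.swap x \<in> square a \<longleftrightarrow> x \<in> square a" for x
    by (cases x) (auto simp: square_def)
  ultimately show ?thesis unfolding meets_def
    by (metis (no_types, opaque_lifting) disjoint_iff swap_swap vimage_eq)
qed

text \<open>One constant serves all generators up to scale \<open>J\<close>, whatever the shear and
  the translation: the bound for a single generator grows with its larger dilation factor, and that
  factor is at most \<open>2 ^ J\<close>.\<close>

lemma tail_bound:
  "\<exists>K>0. \<forall>J i. \<forall>\<epsilon>::real. \<forall>F. \<forall>M::nat. i \<in> index_set a v J \<longrightarrow> 0 < \<epsilon> \<longrightarrow> \<epsilon> \<le> 1 \<longrightarrow> finite F \<longrightarrow>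
     F \<inter> {- int M..int M} \<times> {- int M..int M} = {} \<longrightarrow>
     (\<Sum>l\<in>F. \<epsilon>\<^sup>2 * (cmod (fourier (v i) (\<epsilon> * of_int (fst l), \<epsilon> * of_int (snd l))))\<^sup>2)
       \<le> K * (1 + \<epsilon> * M / (2 * 2 ^ J)) powr (1 - 2 * r)"
proof -
  obtain C1 where C1: "C1 > 0" "\<And>\<xi>1 \<xi>2. cmod (fourier \<phi> (\<xi>1, \<xi>2)) \<le>
        C1 / ((1 + \<bar>\<xi>1\<bar>) powr r * (1 + \<bar>\<xi>2\<bar>) powr r)"
    using adm unfolding admissible_generators_def by blast
  obtain C2 where C2: "C2 > 0" "\<And>\<xi>1 \<xi>2. cmod (fourier \<psi> (\<xi>1, \<xi>2)) \<le>
        C2 * min 1 (\<bar>\<xi>1\<bar> powr \<alpha>) / ((1 + \<bar>\<xi>1\<bar>) powr r * (1 + \<bar>\<xi>2\<bar>) powr r)"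
    using adm unfolding admissible_generators_def by blast
  have C2': "cmod (fourier \<psi> (\<xi>1, \<xi>2)) \<le> C2 / ((1 + \<bar>\<xi>1\<bar>) powr r * (1 + \<bar>\<xi>2\<bar>) powr r)" for \<xi>1 \<xi>2
  proof -
    \<comment> \<open>Brings the bound for \<psi> to the product form shared with \<phi>.\<close>
    have "C2 * min 1 (\<bar>\<xi>1\<bar> powr \<alpha>) \<le> C2 * 1" using C2(1) by (intro mult_left_mono) auto
    then show ?thesis by (intro order.trans[OF C2(2)] divide_right_mono) auto
  qed
  define D where "D = decay_const (2 * r)"
  have D: "D > 0" using r by (simp add: D_def decay_const_def)
  define K where "K = 12 * (C1 * D)\<^sup>2 + 12 * (C2 * D)\<^sup>2"
  have K: "K > 0" using C1 D by (simp add: K_def add_pos_nonneg)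
  have mono: "(1 + \<epsilon> * real M / (2 * b)) powr (1 - 2 * r) \<le> (1 + \<epsilon> * real M / (2 * 2 ^ J)) powr (1 - 2 * r)"
    if "b \<le> 2 ^ J" "b > 0" "\<epsilon> > 0" for b \<epsilon> :: real and M J :: nat
    using that r by (intro powr_mono2' add_left_mono divide_left_mono mult_left_mono) (auto intro: add_pos_nonneg)
  have tail_Psi: "(\<Sum>l\<in>F. \<epsilon>\<^sup>2 * (cmod (fourier (v (Psi j k m)) (\<epsilon> * of_int (fst l), \<epsilon> * of_int (snd l))))\<^sup>2)
       \<le> K * (1 + \<epsilon> * M / (2 * 2 ^ J)) powr (1 - 2 * r)"
    if j: "j < J" and k: "k \<in> shears j" and \<epsilon>: "0 < \<epsilon>" "\<epsilon> \<le> 1"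
      and F: "finite F" "F \<inter> {- int M..int M} \<times> {- int M..int M} = {}" for j k m J \<epsilon> F and M :: nat
  proof -
    \<comment> \<open>\<open>2 powr (3 * j / 4)\<close> is the square root of the determinant
      \<open>2 ^ j * 2 powr (j / 2)\<close>.\<close>
    have "(cmod (complex_of_real (2 powr (3 * real j / 4))))\<^sup>2 = 2 powr (3 * real j / 4) * 2 powr (3 * real j / 4)"
      by (simp add: power2_eq_square)
    also have "\<dots> = 2 ^ j * 2 powr (real j / 2)"
      by (simp add: powr_realpow[symmetric] powr_add[symmetric] field_simps)
    finally have "(\<Sum>l\<in>F. \<epsilon>\<^sup>2 * (cmod (fourier (v (Psi j k m)) (\<epsilon> * of_int (fst l), \<epsilon> * of_int (snd l))))\<^sup>2)
        \<le> 12 * (C2 * D)\<^sup>2 * (1 + \<epsilon> * M / (2 * 2 ^ j)) powr (1 - 2 * r)"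
      unfolding v_Psi D_def using r C2' scale_powers[of j] shears_bound[OF k] \<epsilon> F
      by (intro sum_fourier_triangular_off_box L2D(1)[OF \<psi>]) auto
    also have "\<dots> \<le> K * (1 + \<epsilon> * M / (2 * 2 ^ J)) powr (1 - 2 * r)"
      using \<epsilon> j by (intro mult_mono mono) (auto simp: K_def)
    finally show ?thesis .
  qed
  show ?thesis
  proof (intro exI[of _ K] conjI K allI impI)
    fix J i F and \<epsilon> :: real and M :: nat
    assume i: "i \<in> index_set a v J" and \<epsilon>: "0 < \<epsilon>" "\<epsilon> \<le> 1"
      and F: "finite F" "F \<inter> {- int M..int M} \<times> {- int M..int M} = {}"
    show "(\<Sum>l\<in>F. \<epsilon>\<^sup>2 * (cmod (fourier (v i) (\<epsilon> * of_int (fst l), \<epsilon> * of_int (snd l))))\<^sup>2)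
       \<le> K * (1 + \<epsilon> * M / (2 * 2 ^ J)) powr (1 - 2 * r)"
    proof (cases i)
      case (Phi m)
      have "(\<Sum>l\<in>F. \<epsilon>\<^sup>2 * (cmod (fourier (v (Phi m)) (\<epsilon> * of_int (fst l), \<epsilon> * of_int (snd l))))\<^sup>2)
        \<le> 12 * (C1 * D)\<^sup>2 * (1 + \<epsilon> * M / (2 * 1)) powr (1 - 2 * r)"
        unfolding v_Phi D_def using r C1(2) \<epsilon> F
        by (intro sum_fourier_triangular_off_box L2D(1)[OF \<phi>]) auto
      also have "\<dots> \<le> K * (1 + \<epsilon> * M / (2 * 2 ^ J)) powr (1 - 2 * r)"
        using \<epsilon> by (intro mult_mono mono) (auto simp: K_def)
      finally show ?thesis using Phi by simp
    next
      case (Psi j k m)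
      then show ?thesis using tail_Psi[of j J k \<epsilon> F M m] i \<epsilon> F by (auto simp: index_set_def)
    next
      case (Psi' j k m)
      then have jk: "j < J" "k \<in> shears j" using i by (auto simp: index_set_def)
      \<comment> \<open>The box is symmetric under exchange of the coordinates, so swapped
        frequencies stay off it.\<close>
      have "(\<Sum>l\<in>F. \<epsilon>\<^sup>2 * (cmod (fourier (v i) (\<epsilon> * of_int (fst l), \<epsilon> * of_int (snd l))))\<^sup>2) =
        (\<Sum>l\<in>prod.swap ` F. \<epsilon>\<^sup>2 * (cmod (fourier (v (Psi j k (prod.swap m))) (\<epsilon> * of_int (fst l), \<epsilon> * of_int (snd l))))\<^sup>2)"
        unfolding Psi' v_Psi'[of j k m] fourier_swap[OF L2D(1)[OF v_L2]]
        by (subst sum.reindex) auto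
      also have "\<dots> \<le> K * (1 + \<epsilon> * M / (2 * 2 ^ J)) powr (1 - 2 * r)"
      proof (intro tail_Psi jk \<epsilon>)
        show "prod.swap ` F \<inter> {- int M..int M} \<times> {- int M..int M} = {}" using F(2) by fastforce
      qed (use F in simp)
      finally show ?thesis .
    qed
  qed
qed

end

section \<open>Counting generators\<close>

lemma finite_prod_card_le:
  fixes x y :: real and P :: "(int \<times> int) set"
  assumes "x \<ge> 0" "y \<ge> 0" "\<And>m. m \<in> P \<Longrightarrow> \<bar>of_int (fst m)\<bar> \<le> x \<and> \<bar>of_int (snd m)\<bar> \<le> y"
  shows "finite P" "real (card P) \<le> (2 * x + 1) * (2 * y + 1)"
proof -
  define X where "X = {m::int. \<bar>of_int m\<bar> \<le> x}"
  define Y where "Y = {m::int. \<bar>of_int m\<bar> \<le> y}"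
  have fin: "finite X" "finite Y" unfolding X_def Y_def using assms card_int_abs_le(1) by auto
  have sub: "P \<subseteq> X \<times> Y"
    using assms(3) by (auto simp: X_def Y_def dest!: assms(3))
  show "finite P" using sub fin finite_subset by blast
  have "real (card P) \<le> real (card (X \<times> Y))" using sub fin by (intro of_nat_mono card_mono) auto
  also have "\<dots> = real (card X) * real (card Y)" by (simp add: card_cartesian_product)
  also have "\<dots> \<le> (2 * x + 1) * (2 * y + 1)"
    unfolding X_def Y_def using assms by (intro mult_mono card_int_abs_le) auto
  finally show "real (card P) \<le> (2 * x + 1) * (2 * y + 1)" .
qed

context shearlet_system
begin

text \<open>Some \<open>x\<close> and its image both lie in the square, so the translation is the
  linear image of \<open>x\<close> up to an error in that square. The shear moves the first
  coordinate by at most \<open>2 ^ j * a\<close>, no more than the dilation can.\<close>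

lemma meets_Psi_bound:
  assumes k: "k \<in> shears j" and m: "meets a v (Psi j k m)"
  shows "\<bar>of_int (fst m)\<bar> \<le> 2 * 2 ^ j * a / c1 \<and> \<bar>of_int (snd m)\<bar> \<le> 2 * 2 powr (real j / 2) * a / c2"
proof -
  define b1 where "b1 = (2::real) ^ j"
  define b2 where "b2 = 2 powr (real j / 2)"
  have b: "1 \<le> b2" "b2 \<le> b1" using scale_powers[of j] by (auto simp: b1_def b2_def)
  obtain x where x: "x \<in> square a" "x \<in> ess_supp (v (Psi j k m))" using m by (auto simp: meets_def)
  then have T: "triangular b1 b2 (of_int k * b2) (c1 * of_int (fst m), c2 * of_int (snd m)) x \<in> square a"
    using supp(2) unfolding ess_supp_Psi b1_def b2_def by auto
  have x01: "0 \<le> fst x" "fst x \<le> a" "0 \<le> snd x" "snd x \<le> a" using x by (auto simp: square_def)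
  have t: "0 \<le> b1 * fst x + of_int k * b2 * snd x - c1 * of_int (fst m)"
      "b1 * fst x + of_int k * b2 * snd x - c1 * of_int (fst m) \<le> a"
      "0 \<le> b2 * snd x - c2 * of_int (snd m)" "b2 * snd x - c2 * of_int (snd m) \<le> a"
    using T by (auto simp: square_def triangular_def)
  have 1: "b1 * fst x \<le> b1 * a" "0 \<le> b1 * fst x" "b2 * snd x \<le> b2 * a" "0 \<le> b2 * snd x"
    using x01 b by (auto intro: mult_left_mono)
  have "\<bar>of_int k * b2 * snd x\<bar> = \<bar>of_int k\<bar> * b2 * snd x" using x01 b by (simp add: abs_mult)
  also have "\<dots> \<le> b1 * a"
    using shears_bound[OF k] x01 b by (intro mult_mono) (auto simp: b1_def b2_def)
  finally have 2: "\<bar>of_int k * b2 * snd x\<bar> \<le> b1 * a" .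
  \<comment> \<open>Absorbs the summand \<open>a\<close> contributed by the image point.\<close>
  have 3: "1 * real a \<le> b1 * a" "1 * real a \<le> b2 * a" 
    using b mult_right_mono[of 1 b1 "real a"] mult_right_mono[of 1 b2 "real a"] by auto
  have "\<bar>c1 * of_int (fst m)\<bar> \<le> 2 * b1 * a" using t 1 2 3 by linarith
  moreover have "\<bar>c2 * of_int (snd m)\<bar> \<le> 2 * b2 * a" using t 1 3 by linarith
  ultimately show ?thesis
    using c1 c2 by (simp add: abs_mult b1_def b2_def le_divide_eq mult.commute)
qed

lemma meets_Phi_bound:
  assumes m: "meets a v (Phi m)"
  shows "\<bar>of_int (fst m)\<bar> \<le> a / c1 \<and> \<bar>of_int (snd m)\<bar> \<le> a / c1"
proof -
  obtain x where x: "x \<in> square a" "x \<in> ess_supp (v (Phi m))" using m by (auto simp: meets_def)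
  then have T: "triangular 1 1 (0 * 1) (c1 * of_int (fst m), c1 * of_int (snd m)) x \<in> square a"
    using supp(1) unfolding ess_supp_Phi by auto
  have "\<bar>c1 * of_int (fst m)\<bar> \<le> a" "\<bar>c1 * of_int (snd m)\<bar> \<le> a"
    using T x(1) by (auto simp: square_def triangular_def)
  then show ?thesis
    using c1 by (simp add: abs_mult le_divide_eq mult.commute)
qed

definition Psi_level :: "nat \<Rightarrow> shearlet_index set" where
  "Psi_level j = {Psi j k m | k m. k \<in> shears j \<and> meets a v (Psi j k m)}"

text \<open>There are of the order of \<open>2 powr (j / 2)\<close> shears, \<open>2 ^ j\<close>
  first and \<open>2 powr (j / 2)\<close> second translations; the product of the three is
  \<open>4 ^ j\<close>.\<close>

lemma Psi_level:
  "finite (Psi_level j)" "real (card (Psi_level j)) \<le> 3 * (4 * a / c1 + 1) * (4 * a / c2 + 1) * 4 ^ j"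
proof -
  define b1 where "b1 = (2::real) ^ j"
  define b2 where "b2 = 2 powr (real j / 2)"
  have b: "1 \<le> b2" "b2 \<le> b1" "b2 * b2 = b1" using scale_powers[of j] by (auto simp: b1_def b2_def)
  define R where "R = {m :: int \<times> int. \<bar>of_int (fst m)\<bar> \<le> 2 * b1 * a / c1 \<and> \<bar>of_int (snd m)\<bar> \<le> 2 * b2 * a / c2}"
  have R: "finite R" "real (card R) \<le> (2 * (2 * b1 * a / c1) + 1) * (2 * (2 * b2 * a / c2) + 1)"
    using b c1 c2 finite_prod_card_le[of "2 * b1 * a / c1" "2 * b2 * a / c2" R] by (auto simp: R_def)
  have sub: "Psi_level j \<subseteq> (\<lambda>(k, m). Psi j k m) ` (shears j \<times> R)"
    using meets_Psi_bound by (force simp: Psi_level_def R_def b1_def b2_def)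
  have fin: "finite (shears j \<times> R)" using finite_shears R by simp
  show "finite (Psi_level j)" using sub fin finite_surj by blast
  have "real (card (Psi_level j)) \<le> real (card (shears j \<times> R))"
    using surj_card_le[OF fin sub] by simp
  also have "\<dots> = real (card (shears j)) * real (card R)" by (simp add: card_cartesian_product)
  also have "\<dots> \<le> (3 * b2) * ((2 * (2 * b1 * a / c1) + 1) * (2 * (2 * b2 * a / c2) + 1))"
    using R(2) card_shears[of j] b by (intro mult_mono) (auto simp: b2_def)
  also have "\<dots> \<le> (3 * b2) * ((b1 * (4 * a / c1 + 1)) * (b2 * (4 * a / c2 + 1)))"
    using b c1 c2 by (intro mult_left_mono mult_mono) (auto simp: algebra_simps)
  also have "\<dots> = 3 * (4 * a / c1 + 1) * (4 * a / c2 + 1) * (b1 * (b2 * b2))" by (simp only: mult_ac)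
  also have "b1 * (b2 * b2) = 4 ^ j"
    unfolding b(3) by (simp add: b1_def flip: power_mult_distrib)
  finally show "real (card (Psi_level j)) \<le> 3 * (4 * a / c1 + 1) * (4 * a / c2 + 1) * 4 ^ j" .
qed

lemma index_set_eq: "index_set a v J = Phi ` {m. meets a v (Phi m)} \<union>
    (\<Union>j<J. Psi_level j \<union> (\<lambda>i. case i of Psi j k m \<Rightarrow> Psi' j k (prod.swap m) | _ \<Rightarrow> i) ` Psi_level j)"
  (is "?L = ?R")
proof
  let ?s = "\<lambda>i. case i of Psi j k m \<Rightarrow> Psi' j k (prod.swap m) | _ \<Rightarrow> i"
  show "?L \<subseteq> ?R"
  proof
    fix i assume i: "i \<in> index_set a v J"
    show "i \<in> ?R"
    proof (cases i)
      case (Psi' j k m)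
      then have "j < J" "k \<in> shears j" "meets a v (Psi j k (prod.swap m))"
        using i meets_Psi' by (auto simp: index_set_def)
      then have "Psi j k (prod.swap m) \<in> Psi_level j" unfolding Psi_level_def by blast
      moreover have "i = ?s (Psi j k (prod.swap m))" using Psi' by simp
      ultimately show ?thesis using \<open>j < J\<close> by blast
    qed (use i in \<open>auto simp: index_set_def Psi_level_def\<close>)
  qed
  show "?R \<subseteq> ?L"
    by (auto simp: index_set_def Psi_level_def meets_Psi')
qed

lemma finite_index_set: "finite (index_set a v J)"
proof -
  have "finite {m. meets a v (Phi m)}"
    using c1 meets_Phi_bound by (intro finite_prod_card_le(1)[of "a / c1" "a / c1"]) auto
  then show ?thesis unfolding index_set_eq by (auto simp: Psi_level)
qed

lemma num_generators_upper:
  "\<exists>C>0. \<forall>J. real (num_generators a v J) \<le> C * 4 ^ J"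
proof -
  define C0 where "C0 = real (card (Phi ` {m. meets a v (Phi m)}))"
  define L where "L = 3 * (4 * a / c1 + 1) * (4 * a / c2 + 1)"
  let ?s = "\<lambda>i. case i of Psi j k m \<Rightarrow> Psi' j k (prod.swap m) | _ \<Rightarrow> i"
  have L: "L > 0" using c1 c2 by (simp add: L_def add_nonneg_pos)
  have "real (num_generators a v J) \<le> (C0 + 2 * L) * 4 ^ J" for J
  proof -
    have "num_generators a v J \<le> card (Phi ` {m. meets a v (Phi m)}) +
        card (\<Union>j<J. Psi_level j \<union> ?s ` Psi_level j)"
      unfolding num_generators_def index_set_eq by (rule card_Un_le)
    also have "card (\<Union>j<J. Psi_level j \<union> ?s ` Psi_level j) \<le> (\<Sum>j<J. card (Psi_level j \<union> ?s ` Psi_level j))"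
      by (intro card_UN_le) auto
    also have "\<dots> \<le> (\<Sum>j<J. 2 * card (Psi_level j))"
    proof (intro sum_mono)
      fix j
      have "card (Psi_level j \<union> ?s ` Psi_level j) \<le> card (Psi_level j) + card (?s ` Psi_level j)"
        by (rule card_Un_le)
      also have "card (?s ` Psi_level j) \<le> card (Psi_level j)" by (rule card_image_le[OF Psi_level(1)])
      finally show "card (Psi_level j \<union> ?s ` Psi_level j) \<le> 2 * card (Psi_level j)" by simp
    qed
    finally have "num_generators a v J \<le> card (Phi ` {m. meets a v (Phi m)}) + (\<Sum>j<J. 2 * card (Psi_level j))"
      by simp
    then have "real (num_generators a v J) \<le> real (card (Phi ` {m. meets a v (Phi m)}) + (\<Sum>j<J. 2 * card (Psi_level j)))"
      by (rule of_nat_mono)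
    also have "\<dots> = C0 + (\<Sum>j<J. 2 * real (card (Psi_level j)))"
      by (simp add: C0_def)
    also have "\<dots> \<le> C0 * 4 ^ J + (\<Sum>j<J. 2 * (L * 4 ^ j))"
    proof (intro add_mono sum_mono mult_left_mono)
      show "C0 \<le> C0 * 4 ^ J" by (simp add: C0_def mult_le_cancel_left1)
    qed (use Psi_level(2) in \<open>auto simp: L_def\<close>)
    also have "(\<Sum>j<J. 2 * (L * 4 ^ j)) = 2 * L * (\<Sum>j<J. 4 ^ j)" by (simp add: sum_distrib_left mult.assoc)
    also have "(\<Sum>j<J. (4::real) ^ j) \<le> 4 ^ J"
    proof (induction J)
      case (Suc J)
      have "0 \<le> (4::real) ^ J" by simp
      with Suc show ?case unfolding sum.lessThan_Suc power_Suc by linarith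
    qed simp
    finally show ?thesis using L by (simp add: algebra_simps)
  qed
  then show ?thesis using L by (intro exI[of _ "C0 + 2 * L"]) (auto simp: C0_def add_nonneg_pos)
qed

text \<open>A point \<open>p\<close> of the support of \<open>\<psi>\<close> is moved into the support of \<open>Psi j k m\<close>; counting the
  \<open>m\<close> for which it lands in the square amounts to counting lattice points in a parallelogram.\<close>

lemma card_Psi_level_lower:
  assumes p: "p \<in> ess_supp \<psi>" and j: "2 * c1 \<le> 2 ^ j * a" "2 * c2 \<le> 2 powr (real j / 2) * a"
  shows "a\<^sup>2 / (4 * c1 * c2) * 4 ^ j \<le> real (card (Psi_level j))"
proof -
  define b1 where "b1 = (2::real) ^ j"
  define b2 where "b2 = 2 powr (real j / 2)"
  have b: "1 \<le> b2" "b2 \<le> b1" "b2 * b2 = b1" using scale_powers[of j] by (auto simp: b1_def b2_def)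
  define N1 where "N1 = nat \<lfloor>b1 * a / c1\<rfloor>"
  define N2 where "N2 = nat \<lfloor>b2 * a / c2\<rfloor>"
  define m2 where "m2 = (\<lambda>n::nat. \<lceil>- snd p / c2\<rceil> + int n)"
  \<comment> \<open>The row of usable first translations starts at a place depending on the shear
    and on the second translation, because shearing back shifts the first coordinate by
    \<open>k\<close> times the second.\<close>
  define m1 where "m1 = (\<lambda>(k::int) (n2::nat) (n1::nat).
    \<lceil>(of_int k * (snd p + c2 * of_int (m2 n2)) - fst p) / c1\<rceil> + int n1)"
  define g where "g = (\<lambda>(k, n2, n1). Psi j k (m1 k n2 n1, m2 n2))"
  \<comment> \<open>Nonnegative shears suffice: there are \<open>\<lfloor>b2\<rfloor> + 1\<close> of
    them, hence at least \<open>b2\<close>.\<close>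
  define S where "S = {0..\<lfloor>b2\<rfloor>} \<times> {..<N2} \<times> {..<N1}"
  \<comment> \<open>Source of the two hypotheses on \<open>j\<close>: rounding down costs at most
    half once the value is at least 2.\<close>
  have half: "real (nat \<lfloor>y\<rfloor>) \<ge> y / 2" if "y \<ge> 2" for y :: real
    using that by linarith
  have N1: "b1 * a / c1 / 2 \<le> real N1" unfolding N1_def
    using j(1) c1 by (intro half) (simp add: b1_def le_divide_eq)
  have N2: "b2 * a / c2 / 2 \<le> real N2" unfolding N2_def
    using j(2) c2 by (intro half) (simp add: b2_def le_divide_eq)
  have N1': "c1 * real N1 \<le> b1 * a"
  proof -
    have "real N1 \<le> b1 * a / c1" unfolding N1_def using b c1 by simp
    then show ?thesis using c1 by (simp add: le_divide_eq mult.commute)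
  qed
  have N2': "c2 * real N2 \<le> b2 * a"
  proof -
    have "real N2 \<le> b2 * a / c2" unfolding N2_def using b c2 by simp
    then show ?thesis using c2 by (simp add: le_divide_eq mult.commute)
  qed
  \<comment> \<open>\<open>n < N\<close> leaves room for one more step \<open>c\<close>, which pays
    for the rounding up in \<open>\<lceil>u / c\<rceil>\<close>.\<close>
  have lattice: "u \<le> c * (of_int \<lceil>u / c\<rceil> + real n) \<and> c * (of_int \<lceil>u / c\<rceil> + real n) \<le> u + B"
    if c: "c > 0" and n: "n < N" and B: "c * real N \<le> B" for u c B :: real and n N :: nat
  proof -
    define z where "z = real_of_int \<lceil>u / c\<rceil>"
    have "u / c \<le> z" "z \<le> u / c + 1" unfolding z_def by linarith+
    then have 1: "u \<le> c * z" "c * z \<le> u + c"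
      using c by (auto simp: field_simps)
    have "c * (real n + 1) \<le> c * real N" using n c by (intro mult_left_mono) auto
    then have "c * real n + c \<le> B" using B by (simp add: algebra_simps)
    moreover have "0 \<le> c * real n" using c by simp
    ultimately show ?thesis using 1 unfolding z_def[symmetric] distrib_left by linarith
  qed
  have "g ` S \<subseteq> Psi_level j"
  proof
    fix i assume "i \<in> g ` S"
    then obtain k n2 n1 where i: "i = Psi j k (m1 k n2 n1, m2 n2)"
      and k: "0 \<le> k" "k \<le> \<lfloor>b2\<rfloor>" and n: "n2 < N2" "n1 < N1" by (auto simp: g_def S_def)
    have ks: "k \<in> shears j" using k by (simp add: shears_iff le_floor_iff b2_def)
    \<comment> \<open>\<open>(y1, y2)\<close> is \<open>p\<close> translated and sheared back;
      division by the dilation factors then gives the preimage \<open>x\<close> of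
      \<open>p\<close>.\<close>
    define y2 where "y2 = snd p + c2 * of_int (m2 n2)"
    define y1 where "y1 = fst p + c1 * of_int (m1 k n2 n1) - of_int k * y2"
    have y2: "0 \<le> y2" "y2 \<le> b2 * a"
      using lattice[OF c2 n(1) N2', of "- snd p"] by (auto simp: y2_def m2_def)
    have y1: "0 \<le> y1" "y1 \<le> b1 * a"
      using lattice[OF c1 n(2) N1', of "of_int k * y2 - fst p"] by (auto simp: y1_def m1_def y2_def)
    define x where "x = (y1 / b1, y2 / b2)"
    have "x \<in> square a" using y1 y2 b by (auto simp: x_def square_def divide_le_eq mult.commute)
    moreover have "triangular b1 b2 (of_int k * b2) (c1 * of_int (m1 k n2 n1), c2 * of_int (m2 n2)) x = p"
      using b by (auto simp: triangular_def x_def prod_eq_iff y1_def y2_def)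
    then have "x \<in> ess_supp (v (Psi j k (m1 k n2 n1, m2 n2)))"
      unfolding ess_supp_Psi using p by (simp add: b1_def b2_def)
    ultimately have "meets a v i" unfolding meets_def i by blast
    then show "i \<in> Psi_level j" using ks i by (auto simp: Psi_level_def)
  qed
  moreover have "inj_on g S" by (auto simp: inj_on_def g_def m1_def m2_def)
  ultimately have "card S \<le> card (Psi_level j)" using card_inj_on_le Psi_level(1) by blast
  then have le: "real (card S) \<le> real (card (Psi_level j))" by simp
  have "a\<^sup>2 / (4 * c1 * c2) * 4 ^ j = b2 * ((b2 * a / c2 / 2) * (b1 * a / c1 / 2))"
  proof -
    have "4 ^ j = b1 * (b2 * b2)" unfolding b(3) by (simp add: b1_def flip: power_mult_distrib)
    then show ?thesis by (simp add: power2_eq_square mult_ac)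
  qed
  also have "\<dots> \<le> (of_int \<lfloor>b2\<rfloor> + 1) * (real N2 * real N1)"
    using N1 N2 b c1 c2 by (intro mult_mono) (auto simp: add_nonneg_nonneg)
  also have "\<dots> = real (card S)" using b by (simp add: S_def card_cartesian_product)
  finally show ?thesis using le by simp
qed

lemma index_set_mono: "J \<le> J' \<Longrightarrow> index_set a v J \<subseteq> index_set a v J'"
  by (auto simp: index_set_def)

lemma num_generators_mono: "J \<le> J' \<Longrightarrow> num_generators a v J \<le> num_generators a v J'"
  unfolding num_generators_def using finite_index_set index_set_mono by (intro card_mono)

text \<open>The top level alone has the right order of size; it is level \<open>J - 1\<close>, which
  explains the last division by 4 in \<open>c\<close>. Infinitely many indices force \<psi> to have
  nonempty support, because only finitely many of them are of the form \<open>Phi m\<close>.\<close>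

lemma num_generators_lower:
  assumes "infinite (full_index_set a v)"
  shows "\<exists>c>0. \<exists>J0\<ge>1. \<forall>J\<ge>J0. c * 4 ^ J \<le> real (num_generators a v J)"
proof -
  have "ess_supp \<psi> \<noteq> {}"
  proof
    assume e: "ess_supp \<psi> = {}"
    have n: "\<not> meets a v (Psi j k m)" for j k m unfolding meets_def ess_supp_Psi e by simp
    have "full_index_set a v \<subseteq> index_set a v 0"
      unfolding full_index_set_def index_set_def by (auto simp: n meets_Psi')
    then show False using assms finite_index_set finite_subset by blast
  qed
  then obtain p where p: "p \<in> ess_supp \<psi>" by blast
  obtain n1 where n1: "2 * c1 / a < 2 ^ n1" using real_arch_pow[of 2 "2 * c1 / a"] by auto
  obtain n2 where n2: "2 * c2 / a < 2 ^ n2" using real_arch_pow[of 2 "2 * c2 / a"] by auto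
  define c where "c = a\<^sup>2 / (4 * c1 * c2) / 4"
  have "c * 4 ^ J \<le> real (num_generators a v J)" if J: "J \<ge> n1 + 2 * n2 + 1" for J
  proof -
    define j where "j = J - 1"
    have j: "J = Suc j" "n1 \<le> j" "2 * n2 \<le> j" using J by (auto simp: j_def)
    have "2 * c1 / a \<le> 2 ^ j"
      using order.trans[OF less_imp_le[OF n1] power_increasing[OF j(2), of "2::real"]] by simp
    moreover have "2 * c2 / a \<le> 2 powr (real j / 2)"
    proof -
      have "2 ^ n2 = 2 powr real n2" by (simp add: powr_realpow)
      also have "\<dots> \<le> 2 powr (real j / 2)" using j(3) by (intro powr_mono) auto
      finally show ?thesis using n2 by simp
    qed
    ultimately have "a\<^sup>2 / (4 * c1 * c2) * 4 ^ j \<le> real (card (Psi_level j))"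
      using a_pos by (intro card_Psi_level_lower[OF p]) (auto simp: divide_le_eq)
    also have "\<dots> \<le> real (num_generators a v J)"
      unfolding num_generators_def using finite_index_set[of J] j(1)
      by (intro of_nat_mono card_mono) (auto simp: index_set_eq)
    finally show ?thesis by (simp add: c_def j(1))
  qed
  moreover have "c > 0" using c1 c2 a_pos by (simp add: c_def)
  ultimately show ?thesis by (intro exI[of _ c] conjI exI[of _ "n1 + 2 * n2 + 1"]) auto
qed

text \<open>The positions of the elements of \<open>index_set a v J\<close> are closed downwards,
  since everything in it precedes everything of scale at least \<open>J\<close>. Their number is
  \<open>num_generators a v J\<close>, so they are exactly the first positions.\<close>

lemma enumeration_initial:
  assumes e: "is_enumeration a v e" and N: "N \<le> num_generators a v J"
  shows "e ` {..<N} \<subseteq> index_set a v J"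
proof
  have bij: "bij_betw e UNIV (full_index_set a v)"
    and prec: "\<And>p q. precedes (e p) (e q) \<Longrightarrow> p < q"
    using e by (auto simp: is_enumeration_def)
  have full: "e p \<in> full_index_set a v" for p using bij by (auto simp: bij_betw_def)
  define P where "P = {p. e p \<in> index_set a v J}"
  have "e ` P = index_set a v J"
    using bij unfolding P_def bij_betw_def full_index_set_def by (auto simp: image_iff)
  moreover have "inj_on e P" using bij by (auto simp: bij_betw_def inj_on_def)
  ultimately have cardP: "card P = num_generators a v J"
    unfolding num_generators_def by (metis card_image)
  have down: "p \<in> P" if "q \<in> P" "p < q" for p q
  proof (rule ccontr)
    assume "p \<notin> P"
    then have "precedes (e q) (e p)"
      using that full[of p] by (cases "e q"; cases "e p") (auto simp: P_def full_index_set_def index_set_def)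
    then show False using prec that by fastforce
  qed
  fix i assume "i \<in> e ` {..<N}"
  then obtain p where p: "p < N" "i = e p" by auto
  have "p \<in> P"
  proof (rule ccontr)
    assume "p \<notin> P"
    then have "P \<subseteq> {..<p}" using down by (metis lessThan_iff linorder_neqE_nat subsetI)
    then have "card P \<le> p" using card_mono[of "{..<p}" P] by simp
    then show False using p N cardP by simp
  qed
  then show "i \<in> index_set a v J" using p by (simp add: P_def)
qed

end

section \<open>Stable sampling\<close>

lemma sampler_L2: "sampler T1 T2 \<epsilon> l \<in> L2"
proof -
  define S where "S = {-T1..T2} \<times> {-T1..T2}"
  have S: "S \<in> sets borel" "emeasure lborel S < \<infinity>"
  proof -
    show "S \<in> sets borel" unfolding S_def by (intro borel_closed closed_Times) auto
    have "bounded S" unfolding S_def by (intro bounded_Times) auto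
    then show "emeasure lborel S < \<infinity>" by (rule emeasure_bounded_finite)
  qed
  have "(\<lambda>x. (cmod (sampler T1 T2 \<epsilon> l x))\<^sup>2) = (\<lambda>x. \<epsilon>\<^sup>2 * indicator S x)"
    unfolding sampler_eq by (auto simp: S_def norm_mult fun_eq_iff split: split_indicator)
  moreover have "integrable lborel (\<lambda>x. \<epsilon>\<^sup>2 * indicator S x :: real)"
    using S by (intro integrable_mult_right) (simp add: integrable_indicator_iff)
  moreover have "sampler T1 T2 \<epsilon> l \<in> borel_measurable borel"
    using S(1) unfolding sampler_eq[abs_def] S_def[symmetric] by measurable
  ultimately show ?thesis by (simp add: L2_def)
qed

lemma inner_sampler:
  assumes f: "f \<in> L2_on ({-T1..T2} \<times> {-T1..T2})"
  shows "L2_inner f (sampler T1 T2 \<epsilon> l) = of_real \<epsilon> * fourier f (\<epsilon> * of_int (fst l), \<epsilon> * of_int (snd l))"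
proof -
  define \<xi> where "\<xi> = (\<epsilon> * of_int (fst l), \<epsilon> * of_int (snd l))"
  have [measurable]: "f \<in> borel_measurable borel" "sampler T1 T2 \<epsilon> l \<in> borel_measurable borel"
    using f sampler_L2[of T1 T2 \<epsilon> l] by (auto simp: L2_on_def intro: L2D)
  have "L2_inner f (sampler T1 T2 \<epsilon> l) =
      (LINT x|lborel. of_real \<epsilon> * (f x * exp (- 2 * pi * \<i> * complex_of_real (x \<bullet> \<xi>))))"
    unfolding L2_inner_def
  proof (rule integral_cong_AE)
    show "AE x in lborel. f x * cnj (sampler T1 T2 \<epsilon> l x) =
        of_real \<epsilon> * (f x * exp (- 2 * pi * \<i> * complex_of_real (x \<bullet> \<xi>)))"
    proof -
      have "AE x in lborel. x \<notin> {-T1..T2} \<times> {-T1..T2} \<longrightarrow> f x = 0" using f by (simp add: L2_on_def)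
      then show ?thesis
      proof eventually_elim
        case (elim x)
        have "cnj (character \<epsilon> l x) = exp (- 2 * pi * \<i> * complex_of_real (x \<bullet> \<xi>))"
          unfolding cnj_character unfolding character_def cis_conv_exp \<xi>_def inner_prod_def
          by (simp add: algebra_simps)
        then show ?case using elim by (cases "x \<in> {-T1..T2} \<times> {-T1..T2}") (auto simp: sampler_eq)
      qed
    qed
  qed measurable
  also have "\<dots> = of_real \<epsilon> * fourier f \<xi>"
    unfolding fourier_def by (rule integral_mult_right_zero)
  finally show ?thesis by (simp add: \<xi>_def)
qed

text \<open>Cauchy-Schwarz for the sampled function against the unit vector
  \<open>f\<close>.\<close>

lemma sampling_op_norm_ge:
  assumes f: "f \<in> L2" "L2_norm f = 1"
  shows "(\<Sum>l\<in>{- int M1..int M1} \<times> {- int M2..int M2}. (cmod (L2_inner f (sampler T1 T2 \<epsilon> l)))\<^sup>2)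
    \<le> L2_norm (sampling_op T1 T2 \<epsilon> M1 M2 f)"
proof -
  let ?I = "{- int M1..int M1} \<times> {- int M2..int M2}"
  define b where "b = (\<lambda>l. L2_inner f (sampler T1 T2 \<epsilon> l))"
  define g where "g = (\<lambda>x. \<Sum>l\<in>?I. b l * sampler T1 T2 \<epsilon> l x)"
  define s where "s = (\<Sum>l\<in>?I. (cmod (b l))\<^sup>2)"
  have g_eq: "sampling_op T1 T2 \<epsilon> M1 M2 f = g"
    by (simp add: fun_eq_iff sampling_op_def g_def b_def)
  have g: "g \<in> L2" unfolding g_def by (intro L2.sum_mem sampler_L2)
  have "L2_inner g f = (\<Sum>l\<in>?I. b l * L2_inner (sampler T1 T2 \<epsilon> l) f)"
    unfolding g_def by (intro L2.B_sum sampler_L2 f)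
  also have "\<dots> = (\<Sum>l\<in>?I. of_real ((cmod (b l))\<^sup>2))"
    by (intro sum.cong refl) (simp add: L2.B_cnj[OF f(1) sampler_L2] b_def complex_norm_square del: of_real_power)
  also have "\<dots> = of_real s" by (simp add: s_def)
  finally have "s\<^sup>2 = (cmod (L2_inner g f))\<^sup>2" by simp
  also have "\<dots> \<le> L2.Q g * L2.Q f" by (rule L2.Cauchy_Schwarz[OF g f(1)])
  also have "\<dots> = (L2_norm g)\<^sup>2" using f by (simp add: L2_norm_sq[symmetric] g)
  finally have "s \<le> L2_norm g" by (rule power2_le_imp_le) (simp add: L2_norm_def)
  then show ?thesis by (simp add: g_eq s_def b_def)
qed

context shearlet_system
begin

lemma span_L2: "f \<in> lin_span I v \<Longrightarrow> f \<in> L2"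
  unfolding lin_span_def by (auto intro!: L2.sum_mem v_L2)

lemma span_L2_on:
  assumes sp: "sampling_params a v T1 T2 \<epsilon>" and f: "f \<in> lin_span (full_index_set a v) v"
  shows "f \<in> L2_on ({-T1..T2} \<times> {-T1..T2})"
proof -
  have "\<exists>g\<in>lin_span (full_index_set a v) v. L2_norm (\<lambda>x. f x - g x) < e" if "e > 0" for e
    using f that by (intro bexI[of _ f]) (auto simp: L2_norm_def)
  then have "f \<in> closed_span (full_index_set a v) v"
    using span_L2[OF f] by (simp add: closed_span_def)
  then show ?thesis using sp by (auto simp: sampling_params_def)
qed

text \<open>A null function has empty support. In particular each reconstruction space with
  \<open>N \<ge> 1\<close> contains a unit vector, on which the frame bound and the stability
  constant rely to be meaningful.\<close>

lemma meets_Q_pos: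
  assumes "meets a v i"
  shows "L2.Q (v i) > 0"
proof (rule ccontr)
  assume "\<not> ?thesis"
  then have "L2.Q (v i) = 0" using L2.Q_nonneg[OF v_L2, of i] by simp
  then have "AE x in lborel. (cmod (v i x))\<^sup>2 = 0"
    using integral_nonneg_eq_0_iff_AE[OF L2D(2)[OF v_L2[of i]]] by (simp add: L2_Q v_L2)
  then have "UNIV \<in> {U. open U \<and> (AE x in lborel. x \<in> U \<longrightarrow> v i x = 0)}" by simp
  then have "ess_supp (v i) = {}" unfolding ess_supp_def by blast
  then show False using assms by (simp add: meets_def)
qed

lemma full_index_meets: "i \<in> full_index_set a v \<Longrightarrow> meets a v i"
  by (auto simp: full_index_set_def index_set_def)

lemma full_index_all: "full_index_set a v \<subseteq> all_indices"
  by (auto simp: full_index_set_def index_set_def all_indices_def)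

context
  fixes e :: "nat \<Rightarrow> shearlet_index"
  assumes e: "is_enumeration a v e"
begin

section \<open>Frame bounds of the reconstruction spaces\<close>

lemma e_full: "e p \<in> full_index_set a v"
  using e by (auto simp: is_enumeration_def bij_betw_def)

lemma e_inj: "inj_on e A"
  using e by (auto simp: is_enumeration_def bij_betw_def inj_on_def)

lemma rec_space_eq: "rec_space v e N = {(\<lambda>x. \<Sum>i\<in>e ` {..<N}. b i * v i x) | b. True}"
  unfolding rec_space_def by (intro lin_span_finite) simp

lemma rec_space_full: "rec_space v e N \<subseteq> lin_span (full_index_set a v) v"
  unfolding rec_space_def lin_span_def using e_full by blast

lemma rec_space_L2: "f \<in> rec_space v e N \<Longrightarrow> f \<in> L2"
  unfolding rec_space_def by (rule span_L2)

lemma v_in_rec_space: "N \<ge> 1 \<Longrightarrow> v (e 0) \<in> rec_space v e N"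
  unfolding rec_space_def by (intro lin_span_base) auto

lemma Q_v_e_pos: "L2.Q (v (e 0)) > 0"
  using meets_Q_pos full_index_meets e_full by blast

lemma frame_set_eq: "{A. \<forall>f\<in>rec_space v e N. A * (L2_norm f)\<^sup>2 \<le>
      (\<Sum>\<^sub>\<infinity>i\<in>e ` {..<N}. (cmod (L2_inner f (v i)))\<^sup>2)} =
   {A. \<forall>f\<in>rec_space v e N. A * L2.Q f \<le> (\<Sum>i\<in>e ` {..<N}. (cmod (L2_inner f (v i)))\<^sup>2)}"
  by (auto simp: L2_norm_sq rec_space_L2 infsum_finite)

text \<open>A supremum of reals is informative only for a nonempty set bounded above. A positive
  element comes from \<open>lower_frame_bound_exists\<close>, an upper bound from testing with
  \<open>v (e 0)\<close>. The optimal bound is itself admissible, since for each \<open>f\<close>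
  the condition on \<open>A\<close> is closed.\<close>

lemma rec_frame_bound:
  assumes N: "N \<ge> 1"
  shows "rec_frame_bound v e N > 0"
    "f \<in> rec_space v e N \<Longrightarrow>
      rec_frame_bound v e N * L2.Q f \<le> (\<Sum>i\<in>e ` {..<N}. (cmod (L2_inner f (v i)))\<^sup>2)"
proof -
  define G where "G = (\<lambda>f. \<Sum>i\<in>e ` {..<N}. (cmod (L2_inner f (v i)))\<^sup>2)"
  define \<A> where "\<A> = {A. \<forall>f\<in>rec_space v e N. A * L2.Q f \<le> G f}"
  have bound: "rec_frame_bound v e N = Sup \<A>"
    unfolding rec_frame_bound_def lower_frame_bound_def frame_set_eq \<A>_def G_def ..
  obtain A0 where A0: "A0 > 0" "\<And>c. A0 * L2.Q (\<lambda>x. \<Sum>i\<in>e ` {..<N}. c i * v i x) \<le>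
           G (\<lambda>x. \<Sum>j\<in>e ` {..<N}. c j * v j x)"
    using L2.lower_frame_bound_exists[of "e ` {..<N}" v] v_L2 unfolding G_def by blast
  have A0_mem: "A0 \<in> \<A>" using A0(2) by (auto simp: \<A>_def rec_space_eq)
  have upper: "A \<le> G f / L2.Q f" if "A \<in> \<A>" "f \<in> rec_space v e N" "L2.Q f > 0" for A f
    using that by (auto simp: \<A>_def le_divide_eq)
  have "bdd_above \<A>"
    using upper[OF _ v_in_rec_space[OF N] Q_v_e_pos] by (intro bdd_aboveI)
  then have "A0 \<le> Sup \<A>" using A0_mem by (intro cSup_upper)
  then show "rec_frame_bound v e N > 0" using A0(1) bound by simp
  show "rec_frame_bound v e N * L2.Q f \<le> (\<Sum>i\<in>e ` {..<N}. (cmod (L2_inner f (v i)))\<^sup>2)"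
    if f: "f \<in> rec_space v e N"
  proof (cases "L2.Q f = 0")
    case False
    then have Q: "L2.Q f > 0" using L2.Q_nonneg[OF rec_space_L2[OF f]] by simp
    have "Sup \<A> \<le> G f / L2.Q f" using A0_mem upper[OF _ f Q] by (intro cSup_least) auto
    then show ?thesis using Q by (simp add: bound G_def le_divide_eq)
  qed (simp add: sum_nonneg)
qed

text \<open>Testing with a single generator compares \<open>A\<^sub>N\<close> with the upper frame
  bound of the whole system. Uniformity in \<open>N\<close> is what allows the ceiling in
  \<open>M\<close> to be absorbed into a constant.\<close>

lemma rec_frame_bound_le:
  assumes fr: "shearlet_frame (c1, c2) \<phi> \<psi> \<psi>'"
  shows "\<exists>B>0. \<forall>N\<ge>1. rec_frame_bound v e N \<le> B"
proof -
  obtain B where B: "B > 0" and frame: "\<And>f. f \<in> L2 \<Longrightarrow>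
      (\<lambda>i. (cmod (L2_inner f (v i)))\<^sup>2) summable_on all_indices \<and>
      (\<Sum>\<^sub>\<infinity>i\<in>all_indices. (cmod (L2_inner f (v i)))\<^sup>2) \<le> B * (L2_norm f)\<^sup>2"
    using fr unfolding shearlet_frame_def is_frame_for_def v_def[symmetric] by blast
  have "rec_frame_bound v e N \<le> B" if N: "N \<ge> 1" for N
  proof -
    let ?f = "v (e 0)"
    have "rec_frame_bound v e N * L2.Q ?f \<le> (\<Sum>i\<in>e ` {..<N}. (cmod (L2_inner ?f (v i)))\<^sup>2)"
      by (rule rec_frame_bound(2)[OF N v_in_rec_space[OF N]])
    also have "\<dots> \<le> (\<Sum>\<^sub>\<infinity>i\<in>all_indices. (cmod (L2_inner ?f (v i)))\<^sup>2)"
      using frame[OF v_L2, of "e 0"] e_full full_index_all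
      by (intro finite_sum_le_infsum) auto
    also have "\<dots> \<le> B * L2.Q ?f" using frame[OF v_L2, of "e 0"] by (simp add: L2_norm_sq v_L2)
    finally show ?thesis using Q_v_e_pos by simp
  qed
  then show ?thesis using B by blast
qed

lemma rec_space_coefficients:
  assumes N: "N \<ge> 1" and f: "f \<in> rec_space v e N"
  shows "\<exists>c. L2.Q (\<lambda>x. f x - (\<Sum>i\<in>e ` {..<N}. c i * v i x)) = 0 \<and>
     rec_frame_bound v e N * (\<Sum>i\<in>e ` {..<N}. (cmod (c i))\<^sup>2) \<le> L2.Q f"
proof -
  obtain b where "f = (\<lambda>x. \<Sum>i\<in>e ` {..<N}. b i * v i x)" using f unfolding rec_space_eq by blast
  moreover have "(\<lambda>x. \<Sum>i\<in>e ` {..<N}. c i * v i x) \<in> rec_space v e N" for c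
    unfolding rec_space_eq by blast
  ultimately show ?thesis
    using L2.frame_coefficients[of "e ` {..<N}" v "rec_frame_bound v e N" b]
      rec_frame_bound[OF N] v_L2 by auto
qed

text \<open>The constant precedes all other quantifiers: it comes from the generating system alone,
  not from the window, \<epsilon>, the scale or \<open>N\<close>.\<close>

lemma sampling_lower_bound:
  "\<exists>K>0. \<forall>T1 T2. \<forall>\<epsilon>::real. \<forall>J N f. \<forall>M::nat. sampling_params a v T1 T2 \<epsilon> \<longrightarrow> 1 \<le> N \<longrightarrow>
     N \<le> num_generators a v J \<longrightarrow> f \<in> rec_space v e N \<longrightarrow> L2_norm f = 1 \<longrightarrow>
     1 - K * 4 ^ J / rec_frame_bound v e N * (1 + \<epsilon> * M / (2 * 2 ^ J)) powr (1 - 2 * r)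
       \<le> L2_norm (sampling_op T1 T2 \<epsilon> M M f)"
proof -
  from tail_bound obtain K where "K > 0" and tail0: "\<forall>J i. \<forall>\<epsilon>::real. \<forall>F. \<forall>M::nat. i \<in> index_set a v J \<longrightarrow>
     0 < \<epsilon> \<longrightarrow> \<epsilon> \<le> 1 \<longrightarrow> finite F \<longrightarrow> F \<inter> {- int M..int M} \<times> {- int M..int M} = {} \<longrightarrow>
     (\<Sum>l\<in>F. \<epsilon>\<^sup>2 * (cmod (fourier (v i) (\<epsilon> * of_int (fst l), \<epsilon> * of_int (snd l))))\<^sup>2)
       \<le> K * (1 + \<epsilon> * M / (2 * 2 ^ J)) powr (1 - 2 * r)" by (elim exE conjE)
  note K = \<open>K > 0\<close> tail0[rule_format]
  obtain C where C: "C > 0" "\<And>J. real (num_generators a v J) \<le> C * 4 ^ J"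
    using num_generators_upper by blast
  show ?thesis
  proof (intro exI[of _ "C * K"] conjI allI impI)
    show "C * K > 0" using C K by simp
    fix T1 T2 \<epsilon> :: real and J N f and M :: nat
    assume sp: "sampling_params a v T1 T2 \<epsilon>" and N: "1 \<le> N" "N \<le> num_generators a v J"
      and f: "f \<in> rec_space v e N" "L2_norm f = 1"
    have \<epsilon>: "0 < \<epsilon>" "\<epsilon> \<le> 1" using sp by (auto simp: sampling_params_def)
    define I where "I = e ` {..<N}"
    define A where "A = rec_frame_bound v e N"
    define W where "W = (1 + \<epsilon> * M / (2 * 2 ^ J)) powr (1 - 2 * r)"
    define s where "s = sampler T1 T2 \<epsilon>"
    define box where "box = {- int M..int M} \<times> {- int M..int M}"
    have A: "A > 0" unfolding A_def by (rule rec_frame_bound(1)[OF N(1)])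
    have fL2: "f \<in> L2" using f(1) by (rule rec_space_L2)
    have Qf: "L2.Q f = 1" using f(2) L2_norm_sq[OF fL2] by simp
    have sL2: "s l \<in> L2" for l unfolding s_def by (rule sampler_L2)
    have fQ: "f \<in> L2_on ({-T1..T2} \<times> {-T1..T2})"
      using span_L2_on[OF sp] rec_space_full f(1) by blast
    have vQ: "v i \<in> L2_on ({-T1..T2} \<times> {-T1..T2})" if "i \<in> I" for i
      using that e_full by (intro span_L2_on[OF sp] lin_span_base) (auto simp: I_def)
    have I: "I \<subseteq> index_set a v J" "finite I" "card I = N"
      using enumeration_initial[OF e N(2)] card_image[OF e_inj, of "{..<N}"] by (auto simp: I_def)
    obtain c where c: "L2.Q (\<lambda>x. f x - (\<Sum>i\<in>I. c i * v i x)) = 0" "A * (\<Sum>i\<in>I. (cmod (c i))\<^sup>2) \<le> 1"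
      using rec_space_coefficients[OF N(1) f(1)] Qf unfolding I_def A_def by auto
    \<comment> \<open>A null difference does not change samples, so \<open>f\<close> may be replaced
      by its expansion, one frequency at a time.\<close>
    have fs: "(cmod (L2_inner f (s l)))\<^sup>2 \<le> 1 / A * (\<Sum>i\<in>I. (cmod (L2_inner (v i) (s l)))\<^sup>2)" for l
    proof -
      have "L2_inner f (s l) = L2_inner (\<lambda>x. \<Sum>i\<in>I. c i * v i x) (s l)"
        by (intro L2.Q_null_diff(1) fL2 sL2 c L2.sum_mem v_L2)
      also have "\<dots> = (\<Sum>i\<in>I. c i * L2_inner (v i) (s l))"
        by (intro L2.B_sum v_L2 sL2)
      finally have "cmod (L2_inner f (s l)) \<le> (\<Sum>i\<in>I. cmod (c i) * cmod (L2_inner (v i) (s l)))"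
        by (simp add: sum_norm_le norm_mult)
      then have "(cmod (L2_inner f (s l)))\<^sup>2 \<le> (\<Sum>i\<in>I. cmod (c i) * cmod (L2_inner (v i) (s l)))\<^sup>2"
        by (intro power_mono) auto
      also have "\<dots> \<le> (\<Sum>i\<in>I. (cmod (c i))\<^sup>2) * (\<Sum>i\<in>I. (cmod (L2_inner (v i) (s l)))\<^sup>2)"
        by (rule Cauchy_Schwarz_ineq_sum)
      also have "\<dots> \<le> 1 / A * (\<Sum>i\<in>I. (cmod (L2_inner (v i) (s l)))\<^sup>2)"
        using c(2) A by (intro mult_right_mono sum_nonneg) (auto simp: le_divide_eq mult.commute)
      finally show ?thesis .
    qed
    have tail: "(\<Sum>l\<in>F. (cmod (L2_inner f (s l)))\<^sup>2) \<le> C * K * 4 ^ J / A * W"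
      if F: "finite F" "F \<inter> box = {}" for F
    proof -
      have "(\<Sum>l\<in>F. (cmod (L2_inner f (s l)))\<^sup>2) \<le> (\<Sum>l\<in>F. 1 / A * (\<Sum>i\<in>I. (cmod (L2_inner (v i) (s l)))\<^sup>2))"
        by (intro sum_mono fs)
      also have "\<dots> = 1 / A * (\<Sum>i\<in>I. \<Sum>l\<in>F. (cmod (L2_inner (v i) (s l)))\<^sup>2)"
        by (subst sum.swap) (simp add: sum_distrib_left)
      also have "\<dots> \<le> 1 / A * (\<Sum>i\<in>I. K * W)"
      proof (intro mult_left_mono sum_mono)
        fix i assume i: "i \<in> I"
        have "(\<Sum>l\<in>F. (cmod (L2_inner (v i) (s l)))\<^sup>2) =
            (\<Sum>l\<in>F. \<epsilon>\<^sup>2 * (cmod (fourier (v i) (\<epsilon> * of_int (fst l), \<epsilon> * of_int (snd l))))\<^sup>2)"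
          using \<epsilon> by (simp add: s_def inner_sampler[OF vQ[OF i]] norm_mult power_mult_distrib)
        also have "\<dots> \<le> K * W"
          unfolding W_def using I i F \<epsilon> by (intro K(2)) (auto simp: box_def)
        finally show "(\<Sum>l\<in>F. (cmod (L2_inner (v i) (s l)))\<^sup>2) \<le> K * W" .
      qed (use A in simp)
      also have "\<dots> = 1 / A * (real N * (K * W))" using I by simp
      also have "\<dots> \<le> 1 / A * ((C * 4 ^ J) * (K * W))"
        using A K(1) order.trans[OF of_nat_mono[OF N(2)] C(2)]
        by (intro mult_left_mono mult_right_mono) (auto simp: W_def)
      finally show ?thesis by (simp add: mult_ac)
    qed
    \<comment> \<open>All but \<open>d\<close> of the energy sits in a finite set of frequencies,
      and \<open>tail\<close> controls the part of that set off the box.\<close>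
    have total: "1 - d \<le> (\<Sum>l\<in>box. (cmod (L2_inner f (s l)))\<^sup>2) + C * K * 4 ^ J / A * W" if d: "d > 0" for d
    proof -
      obtain F where F: "finite F" "L2.Q f - d \<le> (\<Sum>l\<in>F. (cmod (L2_inner f (s l)))\<^sup>2)"
        using Parseval_sampler[OF fQ _ _ _ _ d, of \<epsilon>] sp unfolding sampling_params_def s_def by blast
      have "(\<Sum>l\<in>F. (cmod (L2_inner f (s l)))\<^sup>2) =
          (\<Sum>l\<in>F \<inter> box. (cmod (L2_inner f (s l)))\<^sup>2) + (\<Sum>l\<in>F - box. (cmod (L2_inner f (s l)))\<^sup>2)"
        using F(1) by (subst sum.Int_Diff[of F _ box]) auto
      also have "(\<Sum>l\<in>F \<inter> box. (cmod (L2_inner f (s l)))\<^sup>2) \<le> (\<Sum>l\<in>box. (cmod (L2_inner f (s l)))\<^sup>2)"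
        by (intro sum_mono2) (auto simp: box_def)
      also have "(\<Sum>l\<in>F - box. (cmod (L2_inner f (s l)))\<^sup>2) \<le> C * K * 4 ^ J / A * W"
        using F(1) by (intro tail) auto
      finally show ?thesis using F(2) Qf by simp
    qed
    have "1 \<le> (\<Sum>l\<in>box. (cmod (L2_inner f (s l)))\<^sup>2) + C * K * 4 ^ J / A * W"
    proof (rule field_le_epsilon)
      fix d :: real assume "0 < d"
      from total[OF this]
      show "1 \<le> (\<Sum>l\<in>box. (cmod (L2_inner f (s l)))\<^sup>2) + C * K * 4 ^ J / A * W + d" by linarith
    qed
    also have "(\<Sum>l\<in>box. (cmod (L2_inner f (s l)))\<^sup>2) \<le> L2_norm (sampling_op T1 T2 \<epsilon> M M f)"
      unfolding box_def s_def by (rule sampling_op_norm_ge[OF fL2 f(2)])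
    finally show "1 - C * K * 4 ^ J / rec_frame_bound v e N * (1 + \<epsilon> * M / (2 * 2 ^ J)) powr (1 - 2 * r)
       \<le> L2_norm (sampling_op T1 T2 \<epsilon> M M f)"
      by (simp add: A_def W_def)
  qed
qed

lemma four_power: "(4::real) ^ n = 2 powr (2 * real n)"
proof -
  have "2 powr (2 * real n) = 2 powr real (2 * n)" by simp
  also have "\<dots> = 2 ^ (2 * n)" by (rule powr_realpow) simp
  finally show ?thesis by (simp add: power_mult)
qed

lemma stability_bound:
  assumes \<delta>: "\<delta> \<ge> 2 / (2 * r - 1)" and \<theta>: "\<theta> > 1"
  shows "\<exists>S>0. \<forall>T1 T2 \<epsilon>. sampling_params a v T1 T2 \<epsilon> \<longrightarrow>
        (\<forall>J\<ge>1. \<forall>N\<ge>1. N \<le> num_generators a v J \<longrightarrow>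
          (let M = nat \<lceil>S * rec_frame_bound v e N powr (- 1 / (2 * r - 1)) *
                         2 powr (real J * (1 + \<delta>)) / \<epsilon>\<rceil>
           in stability_const v e T1 T2 \<epsilon> N M M \<ge> 1 / \<theta>))"
proof -
  from sampling_lower_bound obtain K where K: "K > 0" and low0:
    "\<forall>T1 T2. \<forall>\<epsilon>::real. \<forall>J N f. \<forall>M::nat. sampling_params a v T1 T2 \<epsilon> \<longrightarrow> 1 \<le> N \<longrightarrow>
     N \<le> num_generators a v J \<longrightarrow> f \<in> rec_space v e N \<longrightarrow> L2_norm f = 1 \<longrightarrow>
     1 - K * 4 ^ J / rec_frame_bound v e N * (1 + \<epsilon> * M / (2 * 2 ^ J)) powr (1 - 2 * r)
       \<le> L2_norm (sampling_op T1 T2 \<epsilon> M M f)" by (elim exE conjE)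
  note low = low0[rule_format]
  define q where "q = 2 * r - 1"
  have q: "q > 0" using r by (simp add: q_def)
  \<comment> \<open>The admissible loss of energy: \<open>1 - \<tau> = 1 / \<theta>\<close>.\<close>
  define \<tau> where "\<tau> = 1 - 1 / \<theta>"
  have \<tau>: "\<tau> > 0" using \<theta> by (simp add: \<tau>_def)
  \<comment> \<open>Chosen for \<open>(S / 2) powr (- q) = \<tau> / K\<close>; the factor 2 offsets
    the one in \<open>2 * 2 ^ J\<close>.\<close>
  define S where "S = 2 * (K / \<tau>) powr (1 / q)"
  have S: "S > 0" using K \<tau> by (simp add: S_def)
  show ?thesis
  proof (intro exI[of _ S] conjI S allI impI)
    fix T1 T2 \<epsilon> :: real and J N :: nat
    assume sp: "sampling_params a v T1 T2 \<epsilon>" and J: "1 \<le> J" and N: "1 \<le> N" "N \<le> num_generators a v J"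
    have \<epsilon>: "\<epsilon> > 0" using sp by (simp add: sampling_params_def)
    define A where "A = rec_frame_bound v e N"
    have A: "A > 0" unfolding A_def by (rule rec_frame_bound(1)[OF N(1)])
    define M where "M = nat \<lceil>S * A powr (- 1 / q) * 2 powr (real J * (1 + \<delta>)) / \<epsilon>\<rceil>"
    have "S * A powr (- 1 / q) * 2 powr (real J * (1 + \<delta>)) / \<epsilon> \<le> real M"
      unfolding M_def by (rule real_nat_ceiling_ge)
    then have M: "S * A powr (- 1 / q) * 2 powr (real J * (1 + \<delta>)) \<le> \<epsilon> * M"
      using \<epsilon> by (simp add: divide_le_eq mult.commute)
    \<comment> \<open>A lower bound for \<open>\<epsilon> * M / (2 * 2 ^ J)\<close>. Raised to the
      power \<open>- q\<close> it yields a factor \<open>A\<close>, which cancels the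
      \<open>1 / A\<close> from the dual coefficients, and a negative power of 2.\<close>
    define y where "y = S / 2 * A powr (- 1 / q) * 2 powr (real J * \<delta>)"
    have y: "y > 0" using S A by (simp add: y_def)
    have "y \<le> 1 + \<epsilon> * M / (2 * 2 ^ J)"
    proof -
      have "y = S * A powr (- 1 / q) * 2 powr (real J * (1 + \<delta>)) / (2 * 2 ^ J)"
        by (simp add: y_def powr_add powr_realpow distrib_left)
      also have "\<dots> \<le> \<epsilon> * M / (2 * 2 ^ J)" using M by (intro divide_right_mono) auto
      finally show ?thesis by simp
    qed
    then have "(1 + \<epsilon> * M / (2 * 2 ^ J)) powr (- q) \<le> y powr (- q)"
      using y q by (intro powr_mono2') auto
    also have "y powr (- q) = (S / 2) powr (- q) * A * 2 powr (- (real J * (\<delta> * q)))"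
    proof -
      have gen: "(s * A powr (- 1 / q) * 2 powr (real J * \<delta>)) powr (- q) =
          s powr (- q) * A * 2 powr (- (real J * (\<delta> * q)))" if "s > 0" for s
        using that A q by (simp add: powr_mult powr_powr mult_ac)
      show ?thesis unfolding y_def by (rule gen) (use S in simp)
    qed
    also have "(S / 2) powr (- q) = \<tau> / K"
      using K \<tau> q by (simp add: S_def powr_powr powr_minus)
    also have "\<tau> / K * A * 2 powr (- (real J * (\<delta> * q))) \<le> \<tau> / K * A * (1 / 4 ^ J)"
    proof (intro mult_left_mono)
      \<comment> \<open>Where the hypothesis on \<delta> enters: the surplus power of 2 has to
        outweigh the \<open>4 ^ J\<close> in the number of generators.\<close>
      have "2 \<le> \<delta> * q" using \<delta> q by (simp add: q_def divide_le_eq)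
      then have "2 powr (- (real J * (\<delta> * q))) \<le> 2 powr (- (real J * 2))"
        by (intro powr_mono) (auto intro: mult_left_mono)
      also have "\<dots> = 1 / 4 ^ J" by (simp add: four_power powr_minus_divide mult.commute)
      finally show "2 powr (- (real J * (\<delta> * q))) \<le> 1 / 4 ^ J" .
    qed (use K \<tau> A in simp)
    finally have W: "(1 + \<epsilon> * M / (2 * 2 ^ J)) powr (1 - 2 * r) \<le> \<tau> / K * A * (1 / 4 ^ J)"
      by (simp add: q_def)
    have "K * 4 ^ J / A * (1 + \<epsilon> * M / (2 * 2 ^ J)) powr (1 - 2 * r) \<le> K * 4 ^ J / A * (\<tau> / K * A * (1 / 4 ^ J))"
      using K A by (intro mult_left_mono W) auto
    also have "\<dots> = \<tau>" using K A by simp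
    finally have bound: "1 / \<theta> \<le> L2_norm (sampling_op T1 T2 \<epsilon> M M f)" if "f \<in> rec_space v e N" "L2_norm f = 1" for f
      using low[OF sp N that, of M] by (simp add: \<tau>_def A_def)
    have "1 / \<theta> \<le> stability_const v e T1 T2 \<epsilon> N M M"
      unfolding stability_const_def
    \<comment> \<open>The infimum must not be over the empty set; the normalised first generator is
      a unit vector of the space.\<close>
    proof (rule cInf_greatest)
      define g where "g = (\<lambda>x. of_real (1 / L2_norm (v (e 0))) * v (e 0) x)"
      have "L2_norm (v (e 0)) > 0" using Q_v_e_pos by (simp add: L2_norm_eq v_L2)
      moreover have "L2_norm g = \<bar>1 / L2_norm (v (e 0))\<bar> * L2_norm (v (e 0))"
        unfolding g_def L2_norm_def by (simp add: norm_mult norm_divide power_divide real_sqrt_divide)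
      ultimately have "L2_norm g = 1" by simp
      moreover have "g \<in> rec_space v e N"
        unfolding g_def rec_space_def using N(1) by (intro lin_span_scale lin_span_base) auto
      ultimately show "{L2_norm (sampling_op T1 T2 \<epsilon> M M f) | f. f \<in> rec_space v e N \<and> L2_norm f = 1} \<noteq> {}"
        by blast
    qed (use bound in auto)
    then show "let M = nat \<lceil>S * rec_frame_bound v e N powr (- 1 / (2 * r - 1)) *
                         2 powr (real J * (1 + \<delta>)) / \<epsilon>\<rceil>
           in 1 / \<theta> \<le> stability_const v e T1 T2 \<epsilon> N M M"
      by (simp add: M_def A_def q_def)
  qed
qed

section \<open>The stable sampling rate\<close>

lemma full_index_infinite: "infinite (full_index_set a v)"
  using e bij_betw_finite[of e UNIV "full_index_set a v"] by (auto simp: is_enumeration_def)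

lemma exists_scale: "\<exists>J\<ge>1. N \<le> num_generators a v J"
proof -
  obtain c J0 where c: "c > 0" "J0 \<ge> 1" "\<And>J. J \<ge> J0 \<Longrightarrow> c * 4 ^ J \<le> real (num_generators a v J)"
    using num_generators_lower[OF full_index_infinite] by blast
  have "\<exists>n. real N / c < 4 ^ n" by (rule real_arch_pow) simp
  then obtain n where "real N / c < 4 ^ n" by blast
  then have "real N < c * 4 ^ n" using c(1) by (simp add: divide_less_eq mult.commute)
  also have "\<dots> \<le> c * 4 ^ (J0 + n)" using c(1) by (intro mult_left_mono power_increasing) auto
  also have "\<dots> \<le> real (num_generators a v (J0 + n))" by (intro c(3)) simp
  finally show ?thesis using c(2) by (intro exI[of _ "J0 + n"]) auto
qed

text \<open>The least sufficient \<open>J\<close> works, because minimality gives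
  \<open>c * 4 ^ (J - 1) \<le> N\<close>. Taking \<open>N\<close> large keeps \<open>J - 1\<close>
  in the range of the lower count.\<close>

lemma minimal_scale:
  "\<exists>C>0. \<exists>N0. \<forall>N\<ge>N0. \<exists>J\<ge>1. N \<le> num_generators a v J \<and> 4 ^ J \<le> C * real N"
proof -
  obtain c J0 where c: "c > 0" "J0 \<ge> 1" "\<And>J. J \<ge> J0 \<Longrightarrow> c * 4 ^ J \<le> real (num_generators a v J)"
    using num_generators_lower[OF full_index_infinite] by blast
  have "\<exists>J\<ge>1. N \<le> num_generators a v J \<and> 4 ^ J \<le> 4 / c * real N"
    if N: "Suc (num_generators a v J0) \<le> N" for N
  proof -
    define J where "J = (LEAST J. N \<le> num_generators a v J)"
    have J: "N \<le> num_generators a v J"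
      unfolding J_def using exists_scale[of N] by (intro LeastI_ex[of "\<lambda>J. N \<le> num_generators a v J"]) blast
    have "J0 < J"
    proof (rule ccontr)
      assume "\<not> J0 < J"
      then show False using num_generators_mono[of J J0] J N by simp
    qed
    then have "\<not> N \<le> num_generators a v (J - 1)"
      unfolding J_def by (intro not_less_Least) simp
    then have "real (num_generators a v (J - 1)) \<le> real N" by simp
    moreover have "c * 4 ^ (J - 1) \<le> real (num_generators a v (J - 1))"
      using \<open>J0 < J\<close> by (intro c(3)) simp
    ultimately have "c * 4 ^ (J - 1) \<le> real N" by linarith
    moreover have "(4::real) ^ J = 4 * 4 ^ (J - 1)" using \<open>J0 < J\<close> by (cases J) auto
    ultimately have "4 ^ J \<le> 4 / c * real N" using c(1) by (simp add: field_simps)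
    then show ?thesis using J \<open>J0 < J\<close> by (intro exI[of _ J]) auto
  qed
  moreover have "4 / c > 0" using c(1) by simp
  ultimately show ?thesis by blast
qed

lemma sampling_rate_bound:
  assumes fr: "shearlet_frame (c1, c2) \<phi> \<psi> \<psi>'" and \<delta>: "\<delta> \<ge> 2 / (2 * r - 1)" and \<theta>: "\<theta> > 1"
    and sp: "sampling_params a v T1 T2 \<epsilon>"
  shows "\<forall>N\<ge>1. measurement_counts v e T1 T2 \<epsilon> N \<theta> \<noteq> {}"
    "(\<lambda>N. real (stable_sampling_rate v e T1 T2 \<epsilon> N \<theta>)) \<in>
          O(\<lambda>N. real N powr (1 + \<delta>) * rec_frame_bound v e N powr (- 2 / (2 * r - 1)))"
proof -
  \<comment> \<open>\<open>measurement_counts\<close> asks for a strict inequality and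
    \<open>stability_bound\<close> yields a weak one; a threshold strictly between 1 and \<theta>
    bridges the gap.\<close>
  define \<theta>' where "\<theta>' = (1 + \<theta>) / 2"
  have \<theta>': "1 < \<theta>'" "\<theta>' < \<theta>" using \<theta> by (auto simp: \<theta>'_def)
  have \<epsilon>: "\<epsilon> > 0" using sp by (simp add: sampling_params_def)
  define q where "q = 2 * r - 1"
  have q: "q > 0" using r by (simp add: q_def)
  have \<delta>0: "\<delta> > 0" using \<delta> q less_le_trans[of 0 "2 / q" \<delta>] by (simp add: q_def)
  define A where "A = rec_frame_bound v e"
  have A: "A N > 0" if "N \<ge> 1" for N unfolding A_def by (rule rec_frame_bound(1)[OF that])
  obtain B where B: "B > 0" "\<And>N. N \<ge> 1 \<Longrightarrow> A N \<le> B"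
    using rec_frame_bound_le[OF fr] unfolding A_def by blast
  obtain S where S: "S > 0" and stab: "\<And>J N. 1 \<le> J \<Longrightarrow> 1 \<le> N \<Longrightarrow> N \<le> num_generators a v J \<Longrightarrow>
      (let M = nat \<lceil>S * A N powr (- 1 / q) * 2 powr (real J * (1 + \<delta>)) / \<epsilon>\<rceil>
       in stability_const v e T1 T2 \<epsilon> N M M \<ge> 1 / \<theta>')"
    using stability_bound[OF \<delta> \<theta>'(1)] sp unfolding A_def q_def by blast
  define x where "x = (\<lambda>J N. S * A N powr (- 1 / q) * 2 powr (real J * (1 + \<delta>)) / \<epsilon>)"
  define M where "M = (\<lambda>J N. nat \<lceil>x J N\<rceil>)"
  \<comment> \<open>A positive lower bound for \<open>x J N\<close>, uniform in \<open>J\<close> and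
    \<open>N \<ge> 1\<close>: with it \<open>M\<close> is at least 1, and rounding up costs only the
    factor \<open>1 + 1 / x0\<close>.\<close>
  define x0 where "x0 = S * B powr (- 1 / q) / \<epsilon>"
  have x0: "x0 > 0" using S B \<epsilon> by (simp add: x0_def)
  have x_ge: "x0 \<le> x J N" if "N \<ge> 1" for J N
  proof -
    have "S * B powr (- 1 / q) * 1 \<le> S * A N powr (- 1 / q) * 2 powr (real J * (1 + \<delta>))"
      using S B(2)[OF that] A[OF that] q \<delta>0
      by (intro mult_mono mult_left_mono powr_mono2' ge_one_powr_ge_zero) auto
    then show ?thesis unfolding x0_def x_def using \<epsilon> by (intro divide_right_mono) auto
  qed
  have M_pos: "1 \<le> M J N" if "N \<ge> 1" for J N
    using x0 x_ge[OF that, of J] unfolding M_def by linarith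
  have M_le: "real (M J N) \<le> (1 + 1 / x0) * x J N" if "N \<ge> 1" for J N
  proof -
    have "real (M J N) \<le> x J N + 1" using x0 x_ge[OF that, of J] unfolding M_def by linarith
    also have "1 \<le> 1 / x0 * x J N" using x0 x_ge[OF that, of J] by (simp add: le_divide_eq)
    finally show ?thesis by (simp add: algebra_simps)
  qed
  have mem: "M J N * M J N \<in> measurement_counts v e T1 T2 \<epsilon> N \<theta>"
    if "1 \<le> J" "1 \<le> N" "N \<le> num_generators a v J" for J N
  proof -
    have "1 / \<theta> < 1 / \<theta>'" using \<theta>' by (intro divide_strict_left_mono) auto
    also have "\<dots> \<le> stability_const v e T1 T2 \<epsilon> N (M J N) (M J N)"
      using stab[OF that] by (simp add: M_def x_def Let_def)
    finally show ?thesis unfolding measurement_counts_def using M_pos[OF that(2)] by blast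
  qed
  show "\<forall>N\<ge>1. measurement_counts v e T1 T2 \<epsilon> N \<theta> \<noteq> {}"
    using mem exists_scale by blast
  obtain C N0 where C: "C > 0" and scale: "\<And>N. N \<ge> N0 \<Longrightarrow> \<exists>J\<ge>1. N \<le> num_generators a v J \<and> 4 ^ J \<le> C * real N"
    using minimal_scale by blast
  \<comment> \<open>Squaring \<open>x J N\<close> gives \<open>A N powr (- 2 / q)\<close> and
    \<open>(4 ^ J) powr (1 + \<delta>)\<close>, and the minimal scale allows \<open>4 ^ J\<close> to
    be replaced by \<open>C * N\<close>.\<close>
  define c where "c = ((1 + 1 / x0) * S / \<epsilon>)\<^sup>2 * C powr (1 + \<delta>)"
  have "real (stable_sampling_rate v e T1 T2 \<epsilon> N \<theta>) \<le> c * (real N powr (1 + \<delta>) * A N powr (- 2 / q))"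
    if N: "N \<ge> max 1 N0" for N
  proof -
    have N1: "N \<ge> 1" using N by simp
    obtain J where J: "J \<ge> 1" "N \<le> num_generators a v J" "4 ^ J \<le> C * real N"
      using scale[of N] N by auto
    have "stable_sampling_rate v e T1 T2 \<epsilon> N \<theta> \<le> M J N * M J N"
      unfolding stable_sampling_rate_def by (intro cInf_lower mem J N1) simp
    then have "real (stable_sampling_rate v e T1 T2 \<epsilon> N \<theta>) \<le> real (M J N) * real (M J N)"
      by (simp flip: of_nat_mult)
    also have "\<dots> \<le> ((1 + 1 / x0) * x J N) * ((1 + 1 / x0) * x J N)"
      using M_le[OF N1, of J] x0 x_ge[OF N1, of J] by (intro mult_mono) auto
    also have "\<dots> = ((1 + 1 / x0) * S / \<epsilon>)\<^sup>2 * ((A N powr (- 1 / q) * A N powr (- 1 / q)) *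
        (2 powr (real J * (1 + \<delta>)) * 2 powr (real J * (1 + \<delta>))))"
      unfolding x_def using \<epsilon> by (simp add: power2_eq_square field_simps)
    also have "A N powr (- 1 / q) * A N powr (- 1 / q) = A N powr (- 2 / q)"
      by (simp add: powr_add[symmetric])
    also have "2 powr (real J * (1 + \<delta>)) * 2 powr (real J * (1 + \<delta>)) = (4 ^ J) powr (1 + \<delta>)"
      unfolding four_power by (simp add: powr_powr powr_add[symmetric] algebra_simps)
    also have "((1 + 1 / x0) * S / \<epsilon>)\<^sup>2 * (A N powr (- 2 / q) * (4 ^ J) powr (1 + \<delta>)) \<le>
        ((1 + 1 / x0) * S / \<epsilon>)\<^sup>2 * (A N powr (- 2 / q) * (C * real N) powr (1 + \<delta>))"
      using J(3) \<delta>0 by (intro mult_left_mono powr_mono2) auto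
    also have "(C * real N) powr (1 + \<delta>) = C powr (1 + \<delta>) * real N powr (1 + \<delta>)" using C by (simp add: powr_mult)
    finally show ?thesis by (simp add: c_def mult_ac)
  qed
  then show "(\<lambda>N. real (stable_sampling_rate v e T1 T2 \<epsilon> N \<theta>)) \<in>
          O(\<lambda>N. real N powr (1 + \<delta>) * rec_frame_bound v e N powr (- 2 / (2 * r - 1)))"
    unfolding A_def q_def
    by (intro bigoI[of _ c] eventually_mono[OF eventually_ge_at_top[of "max 1 N0"]]) auto
qed

end

end

theorem theorem4p1:
  fixes \<phi> \<psi> \<psi>' :: "real \<times> real \<Rightarrow> complex"
    and c1 c2 \<alpha> r \<delta> :: real
    and a :: nat
    and e :: "nat \<Rightarrow> shearlet_index"
    and v :: "shearlet_index \<Rightarrow> real \<times> real \<Rightarrow> complex"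
  defines "v \<equiv> shearlet (c1, c2) \<phi> \<psi> \<psi>'"
  assumes "0 < c1" and "0 < c2"
    and "admissible_generators a \<alpha> r \<phi> \<psi> \<psi>'"
    and "shearlet_frame (c1, c2) \<phi> \<psi> \<psi>'"
    and "is_enumeration a v e"
    and "\<delta> \<ge> 2 / (2 * r - 1)"
  shows "(\<lambda>J. real (num_generators a v J)) \<in> O(\<lambda>J. 2 ^ (2 * J)) \<and>
    (\<forall>\<theta>>1.
      (\<exists>S>0. \<forall>T1 T2 \<epsilon>. sampling_params a v T1 T2 \<epsilon> \<longrightarrow>
        (\<forall>J\<ge>1. \<forall>N\<ge>1. N \<le> num_generators a v J \<longrightarrow>
          (let M = nat \<lceil>S * rec_frame_bound v e N powr (- 1 / (2 * r - 1)) *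
                         2 powr (real J * (1 + \<delta>)) / \<epsilon>\<rceil>
           in stability_const v e T1 T2 \<epsilon> N M M \<ge> 1 / \<theta>))) \<and>
      (\<forall>T1 T2 \<epsilon>. sampling_params a v T1 T2 \<epsilon> \<longrightarrow>
        (\<forall>N\<ge>1. measurement_counts v e T1 T2 \<epsilon> N \<theta> \<noteq> {}) \<and>
        (\<lambda>N. real (stable_sampling_rate v e T1 T2 \<epsilon> N \<theta>)) \<in>
          O(\<lambda>N. real N powr (1 + \<delta>) * rec_frame_bound v e N powr (- 2 / (2 * r - 1)))))"
proof -
  interpret shearlet_system \<phi> \<psi> \<psi>' c1 c2 \<alpha> r a v
    using assms by unfold_locales auto
  obtain C where C: "\<And>J. real (num_generators a v J) \<le> C * 4 ^ J"
    using num_generators_upper by blast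
  have "(\<lambda>J. real (num_generators a v J)) \<in> O(\<lambda>J. 2 ^ (2 * J))"
    using C by (intro bigoI[of _ C] always_eventually allI) (simp add: power_mult)
  then show ?thesis
    using stability_bound[OF assms(6,7)] sampling_rate_bound[OF assms(6,5,7)] by blast
qed

end
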